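(* For the $k$-variable polynomial semiring $\mathbb{T}[\pmb x]$ and the $k$-variable Laurent polynomial semiring $\mathbb{T}(\pmb x)$ over the tropical semifield $\mathbb{T}$ we have that: (i) Every prime congruence of $\mathbb{T}(\pmb x)$ is of the form $P(U)_{\mathbb{T}}$ for a t-admissible matrix $U$. For every prime congruence $P$ of $\mathbb{T}[\pmb x]$ there is a (possibly empty) subset $H$ of the variables $\pmb x$ and a prime $P[U]_{\mathbb{T}}$ of the polynomial semiring $\mathbb{T}[\pmb x']$ with variables $\pmb x'=\pmb x\setminus H$, such that $P$ is generated by the pairs $\{(x_i,0)\mid x_i\in H\}$ and the image of $P[U]_{\mathbb{T}}$ under the embedding $\mathbb{T}[\pmb x']\hookrightarrow\mathbb{T}[\pmb x]$. (ii) The minimal prime congruences of $\mathbb{T}[\pmb x]$ have $\{0\}$ as their kernel. Every minimal prime of $\mathbb{T}[\pmb x]$ (resp. $\mathbb{T}(\pmb x)$) is of the form $P[U]_{\mathbb{T}}$ (resp. $P(U)_{\mathbb{T}}$), where $U$ is a t-admissible matrix with $\mathrm{Ker}(U)\cap(\mathbb{R}\oplus\mathbb{Z}^k)=\{\pmb 0\}$. (iii) $\dim(\mathbb{T}(\pmb x))=\dim(\mathbb{T}[\pmb x])=k+1$. (iv) For any $f,g\in\mathbb{T}(\pmb x)$ (resp. $f,g\in\mathbb{T}[\pmb x]$) the pair $(f,g)$ lies in the radical of the trivial congruence of $\mathbb{T}(\pmb x)$ (resp. $\mathbb{T}[\pmb x]$) if and only if $\overline{newt(f)}=\overline{newt(g)}$.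 (v) Every proper radical congruence of $\mathbb{T}(\pmb x)$ is QC. The congruence $\mathrm{Rad}(\Delta)$ in $\mathbb{T}[\pmb x]$ is QC.
   Context: A semiring is a commutative semiring with additive identity $0$ and multiplicative identity $1$, with $1\neq 0$ and $a\cdot 0=0$ for all $a$; a $\mathbb{B}$-algebra is a semiring with idempotent addition. $\mathbb{T}$ is the tropical semifield on $\mathbb{R}\cup\{-\infty\}$ with maximum as addition and usual addition as multiplication; its elements are written $t^c$ ($c\in\mathbb{R}$) and $0$ (for $-\infty$), so $1=t^0$. For $\pmb x=(x_1,\dots,x_k)$, $\mathbb{T}[\pmb x]$ (resp. $\mathbb{T}(\pmb x)$) is the semiring of formal polynomials (resp. Laurent polynomials), i.e. formal $\mathbb{T}$-linear combinations of monomials $\pmb x^{\pmb n}$ with $\pmb n\in\mathbb{N}^k$ (resp. $\pmb n\in\mathbb{Z}^k$), where $0\in\mathbb{N}$. A congruence of $A$ is an equivalence relation $I\subseteq A\times A$ compatible with addition and multiplication; it is proper if $I\ne A\times A$; $\Delta$ is the trivial congruence (the diagonal). The kernel of a congruence is the equivalence class of $0$. A congruence $P$ is prime if it is proper and for all pairs $\alpha,\beta\in A\times A$ such that the twisted product $\alpha\beta=(\alpha_1\beta_1+\alpha_2\beta_2,\alpha_1\beta_2+\alpha_2\beta_1)$ is in $P$, we have $\alpha\in P$ or $\beta\in P$; minimal primes are minimal with respect to inclusion. $\dim(A)$ is the length (number of strict inclusions) of the longest chain of prime congruences of $A$. $\mathrm{Rad}(I)$ is the intersection of all prime congruences containing $I$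 (an empty intersection being $A\times A$), and $I$ is radical if $\mathrm{Rad}(I)=I$. $I$ is QC if it is proper and $A/I$ is cancellative, i.e. $ab=ac$ in $A/I$ implies $a=0$ or $b=c$. A real $l\times(k+1)$ matrix $U$ ($l\ge 0$) is t-admissible if for every $1\le i\le l$ there is $\pmb v\in\mathbb{R}\oplus\mathbb{Z}^k$ such that the $i$-th entry is the first non-zero entry of $U\pmb v$, and the first column of $U$ either has all entries $0$ or has positive first non-zero entry. For a t-admissible $U$, $P(U)_{\mathbb{T}}$ is the (prime) congruence of $\mathbb{T}(\pmb x)$ generated by the pairs $(t^{c_1}\pmb x^{\pmb n_1}+t^{c_2}\pmb x^{\pmb n_2},\,t^{c_2}\pmb x^{\pmb n_2})$ such that $U((c_2,\pmb n_2)-(c_1,\pmb n_1))$ is $\pmb 0$ or has positive first non-zero coordinate; $P[U]_{\mathbb{T}}$ is its restriction to $\mathbb{T}[\pmb x]$. The same notation is used for any finite set of variables (the number of columns being one more than the number of variables). $\mathrm{Ker}(U)$ is the kernel of the linear map given by $U$. For $f=\sum_i t^{c_i}\pmb x^{\pmb n_i}$, $newt(f)\subseteq\mathbb{R}^{k+1}$ is the convex hull of the points $(c_i,\pmb n_i)\in\mathbb{R}\oplus\mathbb{Z}^k$ (and $newt(0)=\emptyset$); its hat is $\overline{newt(f)}=\{(y_0,\dots,y_k)\in newt(f)\mid \forall z>y_0:\ (z,y_1,\dots,y_k)\notin newt(f)\}$. *)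

theory Defs
  imports "HOL-Analysis.Analysis" "HOL-Library.Poly_Mapping" "HOL-Library.Extended_Nat"
begin

section \<open>The tropical semifield\<close>

text \<open>\<open>Tpow c\<close> is \<open>t\<close> to the power \<open>c\<close>; \<open>NegInf\<close> is the additive neutral element.\<close>

datatype trop = NegInf | Tpow real

instantiation trop :: comm_semiring_1
begin

definition zero_trop :: trop where "0 = NegInf"

definition one_trop :: trop where "1 = Tpow 0"

fun plus_trop :: "trop \<Rightarrow> trop \<Rightarrow> trop" where
  "NegInf + b = b"
| "a + NegInf = a"
| "Tpow c + Tpow d = Tpow (max c d)"

fun times_trop :: "trop \<Rightarrow> trop \<Rightarrow> trop" where
  "NegInf * b = NegInf"
| "a * NegInf = NegInf"
| "Tpow c * Tpow d = Tpow (c + d)"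

instance
proof
  fix a b c :: trop
  show "a + b + c = a + (b + c)" by (cases a; cases b; cases c) auto
  show "a + b = b + a" by (cases a; cases b) auto
  show "0 + a = a" by (simp add: zero_trop_def)
  show "a * b * c = a * (b * c)" by (cases a; cases b; cases c) auto
  show "a * b = b * a" by (cases a; cases b) auto
  show "1 * a = a" by (cases a) (auto simp: one_trop_def)
  show "(a + b) * c = a * c + b * c" by (cases a; cases b; cases c) (auto simp: max_def)
  show "0 * a = 0" by (simp add: zero_trop_def)
  show "a * 0 = 0" by (cases a) (auto simp: zero_trop_def)
  show "(0::trop) \<noteq> 1" by (simp add: zero_trop_def one_trop_def)
qed

end

section \<open>Congruences of semirings\<close>

text \<open>A semiring is given as a carrier set \<open>A\<close> inside a type of class \<open>comm_semiring_1\<close>; it is always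
  applied to sets that contain 0 and 1 and are closed under addition and multiplication.\<close>

definition congruence :: "'a::comm_semiring_1 set \<Rightarrow> ('a \<times> 'a) set \<Rightarrow> bool" where
  "congruence A I \<longleftrightarrow> equiv A I \<and>
     (\<forall>(a, b) \<in> I. \<forall>(c, d) \<in> I. (a + c, b + d) \<in> I \<and> (a * c, b * d) \<in> I)"

definition proper_congruence :: "'a::comm_semiring_1 set \<Rightarrow> ('a \<times> 'a) set \<Rightarrow> bool" where
  "proper_congruence A I \<longleftrightarrow> congruence A I \<and> I \<noteq> A \<times> A"

definition generated_congruence ::
    "'a::comm_semiring_1 set \<Rightarrow> ('a \<times> 'a) set \<Rightarrow> ('a \<times> 'a) set" where
  "generated_congruence A S = A \<times> A \<inter> \<Inter>{I. congruence A I \<and> S \<subseteq> I}"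

definition congruence_kernel ::
    "'a::comm_semiring_1 set \<Rightarrow> ('a \<times> 'a) set \<Rightarrow> 'a set" where
  "congruence_kernel A I = {a \<in> A. (a, 0) \<in> I}"

definition twisted_product :: "'a::comm_semiring_1 \<times> 'a \<Rightarrow> 'a \<times> 'a \<Rightarrow> 'a \<times> 'a" where
  "twisted_product \<alpha> \<beta> =
     (fst \<alpha> * fst \<beta> + snd \<alpha> * snd \<beta>, fst \<alpha> * snd \<beta> + snd \<alpha> * fst \<beta>)"

definition prime_congruence :: "'a::comm_semiring_1 set \<Rightarrow> ('a \<times> 'a) set \<Rightarrow> bool" where
  "prime_congruence A P \<longleftrightarrow> proper_congruence A P \<and>
     (\<forall>\<alpha> \<in> A \<times> A. \<forall>\<beta> \<in> A \<times> A. twisted_product \<alpha> \<beta> \<in> P \<longrightarrow> \<alpha> \<in> P \<or> \<beta> \<in> P)"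

definition minimal_prime_congruence ::
    "'a::comm_semiring_1 set \<Rightarrow> ('a \<times> 'a) set \<Rightarrow> bool" where
  "minimal_prime_congruence A P \<longleftrightarrow> prime_congruence A P \<and>
     (\<forall>Q. prime_congruence A Q \<and> Q \<subseteq> P \<longrightarrow> Q = P)"

text \<open>The supremum is taken in \<open>enat\<close>, so a finite value is attained by a chain if \<open>A\<close> has a
  prime congruence.\<close>

definition congruence_dim :: "'a::comm_semiring_1 set \<Rightarrow> enat" where
  "congruence_dim A = Sup {enat n | n. \<exists>P :: nat \<Rightarrow> ('a \<times> 'a) set.
     (\<forall>i\<le>n. prime_congruence A (P i)) \<and> (\<forall>i<n. P i \<subset> P (Suc i))}"

definition Rad :: "'a::comm_semiring_1 set \<Rightarrow> ('a \<times> 'a) set \<Rightarrow> ('a \<times> 'a) set" where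
  "Rad A I = A \<times> A \<inter> \<Inter>{P. prime_congruence A P \<and> I \<subseteq> P}"

definition radical_congruence :: "'a::comm_semiring_1 set \<Rightarrow> ('a \<times> 'a) set \<Rightarrow> bool" where
  "radical_congruence A I \<longleftrightarrow> congruence A I \<and> Rad A I = I"

text \<open>The class of \<open>a\<close> in the quotient of \<open>A\<close> by \<open>I\<close> is \<open>I `` {a}\<close>.\<close>

definition QC :: "'a::comm_semiring_1 set \<Rightarrow> ('a \<times> 'a) set \<Rightarrow> bool" where
  "QC A I \<longleftrightarrow> proper_congruence A I \<and>
     (\<forall>a\<in>A. \<forall>b\<in>A. \<forall>c\<in>A. I `` {a * b} = I `` {a * c} \<longrightarrow>
        I `` {a} = I `` {0} \<or> I `` {b} = I `` {c})"

section \<open>Polynomials and Laurent polynomials\<close>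

text \<open>The variables are the elements of a subset \<open>X\<close> of a finite type \<open>'v\<close>; an exponent vector on \<open>X\<close>
  is an integer vector that vanishes outside \<open>X\<close>. All Laurent semirings for \<open>X\<close> ranging over the subsets
  of \<open>'v\<close>, and the polynomial semirings inside them, are subsemirings of one type, so
  restricting a congruence is intersecting it, and the embeddings are inclusions.\<close>

type_synonym 'v laurent_poly = "(int ^ 'v) \<Rightarrow>\<^sub>0 trop"

definition laurent :: "'v::finite set \<Rightarrow> 'v laurent_poly set" where
  "laurent X = {f. \<forall>n \<in> Poly_Mapping.keys f. \<forall>j. j \<notin> X \<longrightarrow> n $ j = 0}"

definition polys :: "'v::finite set \<Rightarrow> 'v laurent_poly set" where
  "polys X = {f \<in> laurent X. \<forall>n \<in> Poly_Mapping.keys f. \<forall>j. 0 \<le> n $ j}"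

lemma laurent_subsemiring:
  "0 \<in> laurent X" "1 \<in> laurent X"
  "f \<in> laurent X \<Longrightarrow> g \<in> laurent X \<Longrightarrow> f + g \<in> laurent X"
  "f \<in> laurent X \<Longrightarrow> g \<in> laurent X \<Longrightarrow> f * g \<in> laurent X"
  using keys_add[of f g] keys_mult[of f g] by (fastforce simp: laurent_def)+

lemma polys_subsemiring:
  "0 \<in> polys X" "1 \<in> polys X"
  "f \<in> polys X \<Longrightarrow> g \<in> polys X \<Longrightarrow> f + g \<in> polys X"
  "f \<in> polys X \<Longrightarrow> g \<in> polys X \<Longrightarrow> f * g \<in> polys X"
  using keys_add[of f g] keys_mult[of f g]
  by (fastforce simp: polys_def laurent_subsemiring)+

definition term_of :: "real \<Rightarrow> int ^ 'v \<Rightarrow> 'v::finite laurent_poly" where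
  "term_of c n = Poly_Mapping.single n (Tpow c)"

definition var :: "'v \<Rightarrow> 'v::finite laurent_poly" where
  "var j = term_of 0 (axis j 1)"

section \<open>The congruences given by matrices\<close>

text \<open>\<open>point c n\<close> is the vector with coordinates \<open>c\<close> and \<open>n\<close>. \<open>vectors X\<close> is the
  copy of the real space of dimension \<open>card X + 1\<close> consisting of the vectors that vanish outside \<open>X\<close>,
  and \<open>lattice_vectors X\<close> is the subset where only the first coordinate may be non-integral.\<close>

definition point :: "real \<Rightarrow> int ^ 'v \<Rightarrow> real \<times> (real ^ 'v::finite)" where
  "point c n = (c, \<chi> j. of_int (n $ j))"

definition vectors :: "'v set \<Rightarrow> (real \<times> (real ^ 'v::finite)) set" where
  "vectors X = {y. \<forall>j. j \<notin> X \<longrightarrow> snd y $ j = 0}"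

definition lattice_vectors :: "'v set \<Rightarrow> (real \<times> (real ^ 'v::finite)) set" where
  "lattice_vectors X = {y \<in> vectors X. \<forall>j. snd y $ j \<in> \<int>}"

text \<open>A matrix with \<open>l\<close> rows has the entries \<open>U i a\<close> with \<open>i < l\<close>, where the first column is
  \<open>a = None\<close> and the column of the variable \<open>j \<in> X\<close> is \<open>a = Some j\<close>; the values of \<open>U\<close> elsewhere
  are irrelevant.\<close>

type_synonym 'v matrix = "nat \<Rightarrow> 'v option \<Rightarrow> real"

definition mat_app :: "'v set \<Rightarrow> 'v matrix \<Rightarrow> real \<times> (real ^ 'v::finite) \<Rightarrow> nat \<Rightarrow> real" where
  "mat_app X U y i = U i None * fst y + (\<Sum>j\<in>X. U i (Some j) * snd y $ j)"

definition first_nonzero :: "(nat \<Rightarrow> real) \<Rightarrow> nat \<Rightarrow> bool" where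
  "first_nonzero w i \<longleftrightarrow> w i \<noteq> 0 \<and> (\<forall>j<i. w j = 0)"

definition lex_nonneg :: "nat \<Rightarrow> (nat \<Rightarrow> real) \<Rightarrow> bool" where
  "lex_nonneg l w \<longleftrightarrow> (\<forall>i<l. w i = 0) \<or> (\<exists>i<l. first_nonzero w i \<and> 0 < w i)"

definition t_admissible :: "'v::finite set \<Rightarrow> nat \<Rightarrow> 'v matrix \<Rightarrow> bool" where
  "t_admissible X l U \<longleftrightarrow>
     (\<forall>i<l. \<exists>v \<in> lattice_vectors X. first_nonzero (mat_app X U v) i) \<and>
     lex_nonneg l (\<lambda>i. U i None)"

definition Ker :: "'v::finite set \<Rightarrow> nat \<Rightarrow> 'v matrix \<Rightarrow> (real \<times> (real ^ 'v)) set" where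
  "Ker X l U = {y \<in> vectors X. \<forall>i<l. mat_app X U y i = 0}"

definition laurent_prime ::
    "'v::finite set \<Rightarrow> nat \<Rightarrow> 'v matrix \<Rightarrow> ('v laurent_poly \<times> 'v laurent_poly) set" where
  "laurent_prime X l U = generated_congruence (laurent X)
     {(term_of c1 n1 + term_of c2 n2, term_of c2 n2) | c1 n1 c2 n2.
        term_of c1 n1 \<in> laurent X \<and> term_of c2 n2 \<in> laurent X \<and>
        lex_nonneg l (mat_app X U (point c2 n2 - point c1 n1))}"

definition poly_prime ::
    "'v::finite set \<Rightarrow> nat \<Rightarrow> 'v matrix \<Rightarrow> ('v laurent_poly \<times> 'v laurent_poly) set" where
  "poly_prime X l U = laurent_prime X l U \<inter> polys X \<times> polys X"

section \<open>Newton polytopes\<close>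

definition newt :: "'v::finite laurent_poly \<Rightarrow> (real \<times> (real ^ 'v)) set" where
  "newt f = convex hull {point c n | c n. Poly_Mapping.lookup f n = Tpow c}"

definition newt_hat :: "'v::finite laurent_poly \<Rightarrow> (real \<times> (real ^ 'v)) set" where
  "newt_hat f = {(y0, y). (y0, y) \<in> newt f \<and> (\<forall>z>y0. (z, y) \<notin> newt f)}"

end

theory Submission
  imports Defs
begin

text \<open>
  Addition in the quotient by a prime congruence is linear, because the twisted product of
  \<open>(a + b, a)\<close> and \<open>(a + b, b)\<close> is diagonal. A prime is therefore the same as a set of surviving
  variables \<open>Y\<close> together with a translation-invariant total preorder on the monomials in \<open>Y\<close>,
  i.e. a cone \<open>C\<close> in \<open>\<real> \<oplus> \<int>\<^sup>Y\<close> with \<open>C \<union> -C\<close> everything: two polynomials are congruent iff their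
  maximal surviving monomials are equivalent.

  The key fact is that a real nonnegative combination of elements of \<open>C\<close> that is a lattice vector
  lies in \<open>C\<close> (Dirichlet approximation; the continuous first coordinate is controlled by monotonicity).
  Hence the strictly positive elements can be separated from \<open>0\<close> by a linear functional, and
  induction on the dimension of its kernel produces the rows of a t-admissible matrix. The same fact
  shows that elements of infinitely increasing size are linearly independent, which bounds the
  dimension by \<open>k + 1\<close>, and that every lattice point of the Newton polytope of \<open>f\<close> is, in every such
  preorder, below some monomial of \<open>f\<close>, which gives one half of the description of the radical; the other half is
  separation of a point from a closed convex set.
\<close>

section \<open>Support points of Laurent polynomials\<close>

text \<open>Polynomials are handled through finite sets of points in the real space. Equal exponents
  merge into the larger coefficient, so supports are not additive; all comparisons therefore ask for
  some larger point, a condition that is stable under moving points upwards. Polynomials have more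
  primes than Laurent polynomials, because variables can be killed. The bridge between the two cases
  is that a killed variable can be put back as an infinitely small one. Breaking the remaining ties
  by a full lexicographic order shows that every prime contains the congruence of an antisymmetric
  preorder in all variables. This one fact gives the minimal primes, their kernels and the reduction
  of the radical of the trivial congruence to order cones. Part (v) rests on zero kernels: a nonzero
  factor can be cancelled modulo a whole family of primes if none of them kills it. Laurent
  monomials are units, so all Laurent primes qualify; for polynomials the primes in all variables
  do, and they suffice for the radical of the trivial congruence. The dimension \<open>k + 1\<close>
  counts one row for \<open>t\<close> and one for each variable, and truncating a lexicographic
  matrix attains it.\<close>

definition supp :: "'v::finite laurent_poly \<Rightarrow> (real \<times> (real ^ 'v)) set" where
  "supp f = {point c n | c n. Poly_Mapping.lookup f n = Tpow c}"

text \<open>The floor turns real exponents back into integers; it is exact on lattice vectors, the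
  intended arguments.\<close>

definition monomial :: "real \<times> (real ^ 'v) \<Rightarrow> 'v::finite laurent_poly" where
  "monomial p = term_of (fst p) (\<chi> j. \<lfloor>snd p $ j\<rfloor>)"

lemma newt_eq_hull_supp: "newt f = convex hull (supp f)"
  by (simp add: newt_def supp_def)

lemma point_eq_iff [simp]: "point c n = point d m \<longleftrightarrow> c = d \<and> n = m"
  by (auto simp: point_def vec_eq_iff)

lemma point_add: "point c n + point d m = point (c + d) (n + m)"
  by (simp add: point_def vec_eq_iff)

lemma point_zero [simp]: "point 0 0 = 0"
  by (simp add: point_def vec_eq_iff zero_prod_def)

lemma point_vertical: "point c 0 = (c, 0)"
  by (simp add: point_def vec_eq_iff)

lemma point_in_lattice_iff: "point c n \<in> lattice_vectors X \<longleftrightarrow> (\<forall>j. j \<notin> X \<longrightarrow> n $ j = 0)"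
  by (auto simp: lattice_vectors_def vectors_def point_def)

lemma lattice_vectorE:
  assumes "y \<in> lattice_vectors X"
  obtains c n where "y = point c n" "\<forall>j. j \<notin> X \<longrightarrow> n $ j = 0"
proof -
  have "\<forall>j. \<exists>m::int. snd y $ j = of_int m"
    using assms by (auto simp: lattice_vectors_def Ints_def)
  then obtain m where m: "\<And>j. snd y $ j = of_int (m j)" by metis
  have "y = point (fst y) (\<chi> j. m j)"
    by (simp add: point_def prod_eq_iff vec_eq_iff m)
  then show thesis
    using assms that point_in_lattice_iff by metis
qed

lemma lattice_vectors_closed [intro]:
  "x \<in> lattice_vectors X \<Longrightarrow> y \<in> lattice_vectors X \<Longrightarrow> x + y \<in> lattice_vectors X"
  "x \<in> lattice_vectors X \<Longrightarrow> y \<in> lattice_vectors X \<Longrightarrow> x - y \<in> lattice_vectors X"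
  "x \<in> lattice_vectors X \<Longrightarrow> - x \<in> lattice_vectors X"
  by (auto simp: lattice_vectors_def vectors_def)

lemma vertical_in_lattice [simp, intro]: "(r, 0) \<in> lattice_vectors X"
  by (auto simp: lattice_vectors_def vectors_def)

lemma zero_in_lattice [simp, intro]: "0 \<in> lattice_vectors X"
  by (auto simp: lattice_vectors_def vectors_def)

lemma lattice_vectors_mono: "Y \<subseteq> X \<Longrightarrow> lattice_vectors Y \<subseteq> lattice_vectors X"
  by (auto simp: lattice_vectors_def vectors_def)

lemma lattice_vectors_scale:
  "x \<in> lattice_vectors X \<Longrightarrow> real m *\<^sub>R x \<in> lattice_vectors X"
  by (auto simp: lattice_vectors_def vectors_def)

lemma lattice_vectors_sum:
  "(\<And>i. i \<in> I \<Longrightarrow> f i \<in> lattice_vectors X) \<Longrightarrow> sum f I \<in> lattice_vectors X"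
  by (induction I rule: infinite_finite_induct) auto

lemma monomial_point [simp]: "monomial (point c n) = term_of c n"
  by (simp add: monomial_def point_def)

lemma monomial_add:
  assumes "p \<in> lattice_vectors X" "q \<in> lattice_vectors X"
  shows "monomial (p + q) = monomial p * monomial q"
proof -
  obtain c n where p: "p = point c n" using assms(1) by (rule lattice_vectorE)
  obtain d m where q: "q = point d m" using assms(2) by (rule lattice_vectorE)
  show ?thesis
    by (simp add: p q point_add term_of_def mult_single)
qed

lemma monomial_zero [simp]: "monomial 0 = 1"
  using monomial_point[of 0 0] by (simp add: term_of_def flip: single_one one_trop_def)

lemma supp_monomial:
  assumes "p \<in> lattice_vectors X"
  shows "supp (monomial p) = {p}"
proof -
  obtain c n where p: "p = point c n" using assms(1) by (rule lattice_vectorE)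
  show ?thesis
    by (auto simp: p supp_def term_of_def lookup_single when_def zero_trop_def split: if_splits)
qed

lemma supp_zero [simp]: "supp 0 = {}"
  by (auto simp: supp_def zero_trop_def)

lemma keys_iff: "n \<in> Poly_Mapping.keys f \<longleftrightarrow> (\<exists>c. Poly_Mapping.lookup f n = Tpow c)"
  by (cases "Poly_Mapping.lookup f n") (auto simp: in_keys_iff zero_trop_def)

lemma supp_lattice_UNIV: "p \<in> supp f \<Longrightarrow> p \<in> lattice_vectors UNIV"
  by (auto simp: supp_def point_in_lattice_iff)

lemma finite_supp [simp]: "finite (supp f)"
proof -
  \<comment> \<open>The value 0 for \<open>NegInf\<close> is a dummy: keys have nonzero
    coefficients.\<close>
  have "supp f \<subseteq> (\<lambda>n. point (case Poly_Mapping.lookup f n of Tpow c \<Rightarrow> c | NegInf \<Rightarrow> 0) n)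
      ` Poly_Mapping.keys f"
    unfolding supp_def by (force simp: keys_iff)
  then show ?thesis
    by (rule finite_subset) simp
qed

lemma point_in_supp_iff: "point c n \<in> supp f \<longleftrightarrow> Poly_Mapping.lookup f n = Tpow c"
  by (auto simp: supp_def)

lemma supp_pointE:
  assumes "p \<in> supp f"
  obtains c n where "p = point c n" "Poly_Mapping.lookup f n = Tpow c"
  using assms by (auto simp: supp_def)

lemma supp_empty_iff [simp]: "supp f = {} \<longleftrightarrow> f = 0"
proof
  assume empty: "supp f = {}"
  have "n \<notin> Poly_Mapping.keys f" for n
  proof
    assume "n \<in> Poly_Mapping.keys f"
    then obtain c where "Poly_Mapping.lookup f n = Tpow c" by (auto simp: keys_iff)
    then have "point c n \<in> supp f" by (simp add: point_in_supp_iff)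
    then show False using empty by simp
  qed
  then have "Poly_Mapping.keys f = {}" by blast
  then show "f = 0" by simp
qed simp

lemma laurent_iff_supp: "f \<in> laurent X \<longleftrightarrow> supp f \<subseteq> lattice_vectors X"
proof
  show "f \<in> laurent X \<Longrightarrow> supp f \<subseteq> lattice_vectors X"
    by (auto simp: laurent_def keys_iff point_in_lattice_iff elim!: supp_pointE)
  assume sub: "supp f \<subseteq> lattice_vectors X"
  have "n $ j = 0" if "Poly_Mapping.lookup f n = Tpow c" "j \<notin> X" for n c j
  proof -
    have "point c n \<in> lattice_vectors X"
      using sub that(1) by (auto simp: supp_def)
    then show ?thesis
      using that(2) by (simp add: point_in_lattice_iff)
  qed
  then show "f \<in> laurent X"
    by (auto simp: laurent_def keys_iff)
qed

definition nonneg_lattice :: "'v set \<Rightarrow> (real \<times> (real ^ 'v::finite)) set" where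
  "nonneg_lattice X = {y \<in> lattice_vectors X. \<forall>j. 0 \<le> snd y $ j}"

lemma polys_iff_supp: "f \<in> polys X \<longleftrightarrow> supp f \<subseteq> nonneg_lattice X"
proof
  show "f \<in> polys X \<Longrightarrow> supp f \<subseteq> nonneg_lattice X"
  proof
    fix p assume f: "f \<in> polys X" and p: "p \<in> supp f"
    then obtain c n where n: "p = point c n" "Poly_Mapping.lookup f n = Tpow c"
      by (blast elim: supp_pointE)
    have "0 \<le> n $ j" for j using f n(2) by (auto simp: polys_def keys_iff)
    moreover have "p \<in> lattice_vectors X" using f p by (auto simp: polys_def laurent_iff_supp)
    ultimately show "p \<in> nonneg_lattice X" by (simp add: nonneg_lattice_def n point_def)
  qed
  assume sub: "supp f \<subseteq> nonneg_lattice X"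
  have "0 \<le> n $ j" if "Poly_Mapping.lookup f n = Tpow c" for n c j
    using sub that point_in_supp_iff[of c n f] by (auto simp: nonneg_lattice_def point_def)
  then show "f \<in> polys X"
    using sub unfolding polys_def laurent_iff_supp nonneg_lattice_def by (auto simp: keys_iff)
qed

lemma polys_subset_laurent: "polys X \<subseteq> laurent X"
  by (auto simp: polys_def)

lemma laurent_poly_eq_sum: "f = (\<Sum>n\<in>Poly_Mapping.keys f. Poly_Mapping.single n (Poly_Mapping.lookup f n))"
  by (intro poly_mapping_eqI)
    (simp add: lookup_sum lookup_single when_def in_keys_iff sum.delta)

text \<open>An exponent carries at most one coefficient, so no two points of the support collide.
  This reduces congruence arguments to monomials.\<close>

lemma eq_sum_monomial: "f = (\<Sum>p\<in>supp f. monomial p)"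
proof -
  have inj: "inj_on (\<lambda>n. point (case Poly_Mapping.lookup f n of Tpow c \<Rightarrow> c | NegInf \<Rightarrow> 0) n)
      (Poly_Mapping.keys f)" (is "inj_on ?h _")
    by (auto simp: inj_on_def)
  have im: "supp f = ?h ` Poly_Mapping.keys f"
    unfolding supp_def by (force simp: keys_iff)
  have "(\<Sum>p\<in>supp f. monomial p) = (\<Sum>n\<in>Poly_Mapping.keys f. monomial (?h n))"
    unfolding im by (rule sum.reindex[OF inj, unfolded o_def])
  also have "\<dots> = (\<Sum>n\<in>Poly_Mapping.keys f. Poly_Mapping.single n (Poly_Mapping.lookup f n))"
    by (rule sum.cong) (auto simp: keys_iff term_of_def)
  finally show ?thesis using laurent_poly_eq_sum[of f] by simp
qed

lemma trop_add_idem: "(a::trop) + a = a"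
  by (cases a) auto

lemma laurent_poly_add_idem: "(f::'v::finite laurent_poly) + f = f"
  by (intro poly_mapping_eqI) (simp add: lookup_add trop_add_idem)

text \<open>A monomial is swallowed by a larger coefficient of the same exponent, so the support of a sum
  or product agrees with the union or Minkowski sum only up to moving points upwards.\<close>

lemma supp_add_subset: "supp (f + g) \<subseteq> supp f \<union> supp g"
proof
  fix p assume "p \<in> supp (f + g)"
  then obtain c n where p: "p = point c n"
    "Poly_Mapping.lookup f n + Poly_Mapping.lookup g n = Tpow c"
    by (auto simp: supp_def lookup_add)
  then have "Poly_Mapping.lookup f n = Tpow c \<or> Poly_Mapping.lookup g n = Tpow c"
    by (cases "Poly_Mapping.lookup f n"; cases "Poly_Mapping.lookup g n")
      (auto simp: max_def split: if_splits)
  then show "p \<in> supp f \<union> supp g"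
    using p by (auto simp: supp_def)
qed

lemma supp_add_lift:
  assumes "p \<in> supp f \<union> supp g"
  shows "\<exists>r\<ge>0. p + (r, 0) \<in> supp (f + g)"
proof -
  obtain c n where p: "p = point c n"
    "Poly_Mapping.lookup f n = Tpow c \<or> Poly_Mapping.lookup g n = Tpow c"
    using assms by (auto simp: supp_def)
  then have "\<exists>d\<ge>c. Poly_Mapping.lookup f n + Poly_Mapping.lookup g n = Tpow d"
    by (cases "Poly_Mapping.lookup f n"; cases "Poly_Mapping.lookup g n") auto
  then obtain d where "d \<ge> c" "point d n \<in> supp (f + g)"
    by (auto simp: supp_def lookup_add)
  then show ?thesis
    by (intro exI[of _ "d - c"]) (simp add: p point_add flip: point_vertical)
qed

lemma supp_sum_subset: "supp (sum h I) \<subseteq> (\<Union>i\<in>I. supp (h i))"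
proof (induction I rule: infinite_finite_induct)
  case (insert i I)
  then show ?case using supp_add_subset[of "h i" "sum h I"] by auto
qed simp_all

lemma supp_sum_lift:
  assumes "finite I" "i \<in> I" "p \<in> supp (h i)"
  shows "\<exists>r\<ge>0. p + (r, 0) \<in> supp (sum h I)"
proof -
  have eq: "sum h I = h i + sum h (I - {i})"
    using assms by (simp add: sum.remove)
  show ?thesis
    unfolding eq by (rule supp_add_lift) (use assms in auto)
qed

text \<open>With the product written as a sum of monomials, the facts on supports of sums apply to
  products.\<close>

lemma times_eq_sum_monomial: "f * g = (\<Sum>(p, q)\<in>supp f \<times> supp g. monomial (p + q))"
proof -
  have "f * g = (\<Sum>p\<in>supp f. monomial p) * (\<Sum>q\<in>supp g. monomial q)"
    using eq_sum_monomial[of f] eq_sum_monomial[of g] by simp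
  also have "\<dots> = (\<Sum>p\<in>supp f. \<Sum>q\<in>supp g. monomial p * monomial q)"
    by (simp add: sum_product)
  also have "\<dots> = (\<Sum>p\<in>supp f. \<Sum>q\<in>supp g. monomial (p + q))"
    by (intro sum.cong refl) (metis supp_lattice_UNIV monomial_add)
  finally show ?thesis
    by (simp add: sum.cartesian_product)
qed

lemma supp_mult_subset:
  assumes "x \<in> supp (f * g)"
  obtains p q where "p \<in> supp f" "q \<in> supp g" "x = p + q"
proof -
  have "x \<in> (\<Union>z\<in>supp f \<times> supp g. supp (case z of (p, q) \<Rightarrow> monomial (p + q)))"
    using assms supp_sum_subset unfolding times_eq_sum_monomial by blast
  then obtain p q where pq: "p \<in> supp f" "q \<in> supp g" "x \<in> supp (monomial (p + q))"
    by auto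
  then show thesis
    using that supp_monomial[of "p + q" UNIV] supp_lattice_UNIV by blast
qed

lemma supp_mult_lift:
  assumes "p \<in> supp f" "q \<in> supp g"
  shows "\<exists>r\<ge>0. p + q + (r, 0) \<in> supp (f * g)"
  unfolding times_eq_sum_monomial
proof (rule supp_sum_lift[of _ "(p, q)"])
  show "p + q \<in> supp (case (p, q) of (p, q) \<Rightarrow> monomial (p + q))"
    using supp_monomial[OF lattice_vectors_closed(1)[OF assms[THEN supp_lattice_UNIV]]] by simp
qed (use assms in auto)

section \<open>Total preorders on the lattice\<close>

text \<open>Read \<open>q - p \<in> C\<close> as: the monomial at \<open>p\<close> is at most the
  one at \<open>q\<close>. The last clause makes this preorder respect the order of the
  coefficients. The whole lattice is allowed; it is the cone of the matrix without rows.\<close>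

definition order_cone :: "'v::finite set \<Rightarrow> (real \<times> (real ^ 'v)) set \<Rightarrow> bool" where
  "order_cone X C \<longleftrightarrow> C \<subseteq> lattice_vectors X \<and> (\<forall>x\<in>C. \<forall>y\<in>C. x + y \<in> C) \<and>
     (\<forall>x\<in>lattice_vectors X. x \<in> C \<or> - x \<in> C) \<and> (\<forall>r\<ge>0. (r, 0) \<in> C)"

text \<open>Asking for some larger point instead of comparing maxima avoids choosing a maximum and
  covers the zero polynomial, whose support is empty.\<close>

definition dominated :: "'a::ab_group_add set \<Rightarrow> 'a set \<Rightarrow> 'a set \<Rightarrow> bool" where
  "dominated C S T \<longleftrightarrow> (\<forall>p\<in>S. \<exists>q\<in>T. q - p \<in> C)"

text \<open>Intersecting with \<open>vectors Y\<close> discards the monomials that contain a killed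
  variable. With the semiring as a parameter, restriction to a subsemiring only changes
  \<open>A\<close>.\<close>

definition cone_congruence ::
    "'v::finite laurent_poly set \<Rightarrow> 'v set \<Rightarrow> (real \<times> (real ^ 'v)) set \<Rightarrow>
      ('v laurent_poly \<times> 'v laurent_poly) set" where
  "cone_congruence A Y C = {(f, g) \<in> A \<times> A.
     dominated C (supp f \<inter> vectors Y) (supp g \<inter> vectors Y) \<and>
     dominated C (supp g \<inter> vectors Y) (supp f \<inter> vectors Y)}"

lemma order_coneD:
  assumes "order_cone X C"
  shows order_cone_subset: "C \<subseteq> lattice_vectors X"
    and order_cone_add: "x \<in> C \<Longrightarrow> y \<in> C \<Longrightarrow> x + y \<in> C"
    and order_cone_total: "x \<in> lattice_vectors X \<Longrightarrow> x \<notin> C \<Longrightarrow> - x \<in> C"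
    and order_cone_vertical: "0 \<le> r \<Longrightarrow> (r, 0) \<in> C"
    and order_cone_zero: "0 \<in> C"
  using assms unfolding order_cone_def by (auto simp: zero_prod_def)

lemma order_cone_sum:
  assumes C: "order_cone X C" and "\<And>i. i \<in> I \<Longrightarrow> f i \<in> C"
  shows "sum f I \<in> C"
  using assms(2)
proof (induction I rule: infinite_finite_induct)
  case (insert x F)
  then have "f x + sum f F \<in> C" by (intro order_cone_add[OF C]) auto
  then show ?case using insert.hyps by simp
qed (simp_all add: order_cone_zero[OF C])

lemma order_cone_scale:
  assumes "order_cone X C" "x \<in> C"
  shows "real m *\<^sub>R x \<in> C"
  using order_cone_sum[OF assms(1), of "{..<m}" "\<lambda>_. x"] assms(2)
  by (simp add: scaleR_conv_of_real sum_constant_scaleR)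

text \<open>If \<open>- x\<close> were in \<open>C\<close>, adding \<open>m - 1\<close> copies of it
  to \<open>m\<close> copies of \<open>x\<close> would give \<open>x\<close> itself.\<close>

lemma order_cone_cancel_scale:
  assumes C: "order_cone X C" and x: "x \<in> lattice_vectors X"
    and m: "m > 0" "real m *\<^sub>R x \<in> C"
  shows "x \<in> C"
proof (rule ccontr)
  assume "x \<notin> C"
  then have "- x \<in> C" using order_cone_total[OF C x] by simp
  then have "real (m - 1) *\<^sub>R (- x) \<in> C" by (rule order_cone_scale[OF C])
  then have "real m *\<^sub>R x + real (m - 1) *\<^sub>R (- x) \<in> C"
    using m order_cone_add[OF C] by blast
  moreover have "real m *\<^sub>R x + real (m - 1) *\<^sub>R (- x) = x"
    using m(1) by (simp add: of_nat_diff algebra_simps)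
  ultimately show False using \<open>x \<notin> C\<close> by simp
qed

text \<open>Totality is asked for on \<open>S\<close> only, because the lemma is also applied to the
  cone of a prime before that is known to be an order cone.\<close>

lemma exists_max_difference:
  fixes S C :: "'a::ab_group_add set"
  assumes "finite S" "S \<noteq> {}" and total: "\<And>p q. p \<in> S \<Longrightarrow> q \<in> S \<Longrightarrow> q - p \<in> C \<or> p - q \<in> C"
    and add: "\<And>x y. x \<in> C \<Longrightarrow> y \<in> C \<Longrightarrow> x + y \<in> C"
  shows "\<exists>q\<in>S. \<forall>p\<in>S. q - p \<in> C"
  using assms(1,2) total
proof (induction S rule: finite_ne_induct)
  case (singleton x)
  show ?case using singleton[of x x] by simp
next
  case (insert x S)
  then obtain q where q: "q \<in> S" "\<forall>p\<in>S. q - p \<in> C" by auto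
  show ?case
  proof (cases "q - x \<in> C")
    case True then show ?thesis using q by auto
  next
    case False
    then have xq: "x - q \<in> C" using insert.prems[of x q] q(1) by auto
    have "x - p \<in> C" if "p \<in> S" for p
      using add[OF xq, of "q - p"] q that by simp
    then show ?thesis using insert.prems[of x x] by auto
  qed
qed

lemma order_cone_max:
  assumes C: "order_cone X C" and "finite S" "S \<noteq> {}" "S \<subseteq> lattice_vectors X"
  shows "\<exists>q\<in>S. \<forall>p\<in>S. q - p \<in> C"
proof (rule exists_max_difference)
  fix p q assume "p \<in> S" "q \<in> S"
  then have "q - p \<in> lattice_vectors X" using assms(4) by auto
  then show "q - p \<in> C \<or> p - q \<in> C" using order_cone_total[OF C, of "q - p"] by auto
qed (use assms order_cone_add[OF C] in auto)

lemma dominated_refl: "order_cone X C \<Longrightarrow> dominated C S S"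
  unfolding dominated_def by (metis diff_self order_cone_zero)

lemma dominated_trans:
  assumes "order_cone X C" "dominated C S T" "dominated C T W"
  shows "dominated C S W"
  unfolding dominated_def
proof
  fix p assume "p \<in> S"
  then obtain q where q: "q \<in> T" "q - p \<in> C" using assms(2) by (auto simp: dominated_def)
  then obtain r where r: "r \<in> W" "r - q \<in> C" using assms(3) by (auto simp: dominated_def)
  have "r - p \<in> C" using order_cone_add[OF assms(1) r(2) q(2)] by simp
  then show "\<exists>q\<in>W. q - p \<in> C" using r by blast
qed

lemma laurent_supp_Int: "f \<in> laurent Y \<Longrightarrow> supp f \<inter> vectors Y = supp f"
  by (auto simp: laurent_iff_supp lattice_vectors_def)

lemma cone_congruence_iff:
  assumes "A \<subseteq> laurent Y"
  shows "(f, g) \<in> cone_congruence A Y C \<longleftrightarrow>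
    f \<in> A \<and> g \<in> A \<and> dominated C (supp f) (supp g) \<and> dominated C (supp g) (supp f)"
  using assms by (auto simp: cone_congruence_def laurent_supp_Int subset_iff)

lemma cone_congruence_Int: "B \<subseteq> A \<Longrightarrow> cone_congruence A Y C \<inter> B \<times> B = cone_congruence B Y C"
  by (auto simp: cone_congruence_def)

section \<open>Order cones define prime congruences\<close>

lemma dominated_supp_add:
  assumes C: "order_cone X C"
    and "dominated C (supp f) (supp g)" "dominated C (supp f') (supp g')"
  shows "dominated C (supp (f + f')) (supp (g + g'))"
  unfolding dominated_def
proof
  fix p assume "p \<in> supp (f + f')"
  then have "\<exists>q\<in>supp g \<union> supp g'. q - p \<in> C"
    using supp_add_subset assms unfolding dominated_def by blast
  then obtain q r where q: "q - p \<in> C" "r \<ge> 0" "q + (r, 0) \<in> supp (g + g')"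
    using supp_add_lift by blast
  have "(q - p) + (r, 0) \<in> C"
    using order_cone_add[OF C q(1) order_cone_vertical[OF C q(2)]] .
  then show "\<exists>q\<in>supp (g + g'). q - p \<in> C"
    using q(3) by (intro bexI[OF _ q(3)]) (simp add: algebra_simps)
qed

lemma dominated_supp_mult:
  assumes C: "order_cone X C"
    and "dominated C (supp f) (supp g)" "dominated C (supp f') (supp g')"
  shows "dominated C (supp (f * f')) (supp (g * g'))"
  unfolding dominated_def
proof
  fix x assume "x \<in> supp (f * f')"
  then obtain p p' where p: "p \<in> supp f" "p' \<in> supp f'" "x = p + p'"
    by (rule supp_mult_subset)
  obtain q where q: "q \<in> supp g" "q - p \<in> C" using p assms unfolding dominated_def by blast
  obtain q' where q': "q' \<in> supp g'" "q' - p' \<in> C" using p assms unfolding dominated_def by blast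
  obtain r where r: "r \<ge> 0" "q + q' + (r, 0) \<in> supp (g * g')"
    using supp_mult_lift[OF q(1) q'(1)] by blast
  have "(q - p) + (q' - p') + (r, 0) \<in> C"
    using order_cone_add[OF C order_cone_add[OF C q(2) q'(2)] order_cone_vertical[OF C r(1)]] .
  then show "\<exists>q\<in>supp (g * g'). q - x \<in> C"
    using p(3) by (intro bexI[OF _ r(2)]) (simp add: algebra_simps)
qed

lemma cone_congruence_congruence:
  assumes C: "order_cone X C" and A: "A \<subseteq> laurent X"
    and closed: "\<And>f g. f \<in> A \<Longrightarrow> g \<in> A \<Longrightarrow> f + g \<in> A \<and> f * g \<in> A"
  shows "congruence A (cone_congruence A X C)"
  unfolding congruence_def
proof
  show "equiv A (cone_congruence A X C)"
  proof (rule equivI)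
    show "cone_congruence A X C \<subseteq> A \<times> A" by (auto simp: cone_congruence_def)
    show "refl_on A (cone_congruence A X C)"
      by (auto simp: refl_on_def cone_congruence_iff[OF A] dominated_refl[OF C])
    show "sym (cone_congruence A X C)"
      by (auto simp: sym_def cone_congruence_iff[OF A])
    show "trans (cone_congruence A X C)"
      by (auto simp: trans_def cone_congruence_iff[OF A] intro: dominated_trans[OF C])
  qed
  show "\<forall>(a, b)\<in>cone_congruence A X C. \<forall>(c, d)\<in>cone_congruence A X C.
      (a + c, b + d) \<in> cone_congruence A X C \<and> (a * c, b * d) \<in> cone_congruence A X C"
    by (auto simp: cone_congruence_iff[OF A] closed
        intro: dominated_supp_add[OF C] dominated_supp_mult[OF C])
qed

text \<open>The witness is the product of the maximal monomials of \<open>b\<close> and \<open>d\<close>.\<close>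

lemma strictly_dominated_twist:
  assumes C: "order_cone X C" and sub: "a \<in> laurent X" "b \<in> laurent X" "c \<in> laurent X" "d \<in> laurent X"
    and ab: "\<not> dominated C (supp b) (supp a)" and cd: "\<not> dominated C (supp d) (supp c)"
  shows "\<not> dominated C (supp (a * c + b * d)) (supp (a * d + b * c))"
proof -
  have strict: "\<exists>q\<in>supp g. (\<forall>p\<in>supp g. q - p \<in> C) \<and> (\<forall>p\<in>supp f. p - q \<notin> C)"
    if g: "g \<in> laurent X" and nd: "\<not> dominated C (supp g) (supp f)" for f g
  proof -
    obtain q0 where q0: "q0 \<in> supp g" "\<forall>p\<in>supp f. p - q0 \<notin> C"
      using nd by (auto simp: dominated_def)
    obtain q where q: "q \<in> supp g" "\<forall>p\<in>supp g. q - p \<in> C"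
      using order_cone_max[OF C finite_supp, of g] q0(1) g unfolding laurent_iff_supp by blast
    \<comment> \<open>Otherwise \<open>p - q0\<close>, which is \<open>(p - q) + (q - q0)\<close>,
      would be in \<open>C\<close>.\<close>
    have "p - q \<notin> C" if "p \<in> supp f" for p
      using order_cone_add[OF C, of "p - q" "q - q0"] q0 q that by auto
    then show ?thesis using q by blast
  qed
  obtain x where x: "x \<in> supp b" "\<forall>p\<in>supp b. x - p \<in> C" "\<forall>p\<in>supp a. p - x \<notin> C"
    using strict[OF sub(2) ab] by blast
  obtain y where y: "y \<in> supp d" "\<forall>p\<in>supp d. y - p \<in> C" "\<forall>p\<in>supp c. p - y \<notin> C"
    using strict[OF sub(4) cd] by blast
  obtain r where r: "r \<ge> 0" "x + y + (r, 0) \<in> supp (b * d)"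
    using supp_mult_lift[OF x(1) y(1)] by blast
  obtain s where s: "s \<ge> 0" "x + y + (r, 0) + (s, 0) \<in> supp (a * c + b * d)"
    using supp_add_lift[of _ "a * c" "b * d"] r(2) by blast
  have "z - (x + y + (r, 0) + (s, 0)) \<notin> C" if z: "z \<in> supp (a * d + b * c)" for z
  proof
    assume zC: "z - (x + y + (r, 0) + (s, 0)) \<in> C"
    \<comment> \<open>Swallowing may have raised the witness by \<open>r\<close> and
      \<open>s\<close>. A bound for the raised point also bounds \<open>x + y\<close>.\<close>
    have "(z - (x + y + (r, 0) + (s, 0))) + (r, 0) + (s, 0) \<in> C"
      using order_cone_add[OF C order_cone_add[OF C zC order_cone_vertical[OF C r(1)]]
          order_cone_vertical[OF C s(1)]] .
    moreover have "(z - (w + u + v)) + u + v = z - w" for z w u v :: "real \<times> (real ^ 'v)"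
      by simp
    ultimately have zC': "z - (x + y) \<in> C" by metis
    consider (ad) p q where "p \<in> supp a" "q \<in> supp d" "z = p + q"
      | (bc) p q where "p \<in> supp b" "q \<in> supp c" "z = p + q"
    proof -
      have "z \<in> supp (a * d) \<or> z \<in> supp (b * c)"
        using z supp_add_subset[of "a * d" "b * c"] by blast
      then show thesis
        using ad bc supp_mult_subset[of z a d] supp_mult_subset[of z b c] by blast
    qed
    then show False
    proof cases
      case ad
      then have "(z - (x + y)) + (y - q) \<in> C" using order_cone_add[OF C zC'] y by blast
      moreover have "(z - (x + y)) + (y - q) = p - x" using ad(3) by simp
      ultimately show ?thesis using x ad by metis
    next
      case bc
      then have "(z - (x + y)) + (x - p) \<in> C" using order_cone_add[OF C zC'] x by blast
      moreover have "(z - (x + y)) + (x - p) = q - y" using bc(3) by simp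
      ultimately show ?thesis using y bc by metis
    qed
  qed
  then show ?thesis using s(2) unfolding dominated_def by blast
qed

text \<open>If neither pair is in the congruence, each is strictly ordered one way. The entry of the
  twisted product that contains the product of the two larger members then strictly exceeds the
  other entry. Reversing a pair swaps the two entries, whence the four cases.\<close>

lemma cone_congruence_prime:
  assumes C: "order_cone X C" and A: "A \<subseteq> laurent X"
    and closed: "\<And>f g. f \<in> A \<Longrightarrow> g \<in> A \<Longrightarrow> f + g \<in> A \<and> f * g \<in> A" and one: "0 \<in> A" "1 \<in> A"
  shows "prime_congruence A (cone_congruence A X C)"
proof -
  let ?P = "cone_congruence A X C"
  have cong: "congruence A ?P"
    using cone_congruence_congruence[OF C A closed] .
  have "(1, 0) \<notin> ?P"
    using supp_monomial[of 0 X, OF zero_in_lattice]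
    unfolding cone_congruence_iff[OF A] dominated_def monomial_zero supp_zero by blast
  then have proper: "proper_congruence A ?P"
    using cong one unfolding proper_congruence_def by blast
  have "\<alpha> \<in> ?P \<or> \<beta> \<in> ?P"
    if ab: "\<alpha> \<in> A \<times> A" "\<beta> \<in> A \<times> A" and tw: "twisted_product \<alpha> \<beta> \<in> ?P" for \<alpha> \<beta>
  proof (rule ccontr)
    assume neg: "\<not> (\<alpha> \<in> ?P \<or> \<beta> \<in> ?P)"
    obtain a b where \<alpha>: "\<alpha> = (a, b)" by (cases \<alpha>)
    obtain c d where \<beta>: "\<beta> = (c, d)" by (cases \<beta>)
    have mem: "a \<in> laurent X" "b \<in> laurent X" "c \<in> laurent X" "d \<in> laurent X"
      using ab A by (auto simp: \<alpha> \<beta>)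
    have tw': "dominated C (supp (a * c + b * d)) (supp (a * d + b * c))"
      "dominated C (supp (a * d + b * c)) (supp (a * c + b * d))"
      using tw unfolding twisted_product_def \<alpha> \<beta> cone_congruence_iff[OF A] fst_conv snd_conv by blast+
    consider "\<not> dominated C (supp b) (supp a)" "\<not> dominated C (supp d) (supp c)"
      | "\<not> dominated C (supp b) (supp a)" "\<not> dominated C (supp c) (supp d)"
      | "\<not> dominated C (supp a) (supp b)" "\<not> dominated C (supp d) (supp c)"
      | "\<not> dominated C (supp a) (supp b)" "\<not> dominated C (supp c) (supp d)"
      using neg ab unfolding \<alpha> \<beta> cone_congruence_iff[OF A] by blast
    then show False
    proof cases
      case 1 then show ?thesis using strictly_dominated_twist[OF C mem] tw' by blast
    next
      case 2 then show ?thesis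
        using strictly_dominated_twist[OF C mem(1,2,4,3)] tw' by blast
    next
      case 3
      then have "\<not> dominated C (supp (b * c + a * d)) (supp (b * d + a * c))"
        by (rule strictly_dominated_twist[OF C mem(2,1,3,4)])
      then show ?thesis
        using tw' by (simp add: add.commute[of "b * c" "a * d"] add.commute[of "b * d" "a * c"])
    next
      case 4
      then have "\<not> dominated C (supp (b * d + a * c)) (supp (b * c + a * d))"
        by (rule strictly_dominated_twist[OF C mem(2,1,4,3)])
      then show ?thesis
        using tw' by (simp add: add.commute[of "b * c" "a * d"] add.commute[of "b * d" "a * c"])
    qed
  qed
  then show ?thesis using proper unfolding prime_congruence_def by blast
qed

section \<open>Congruences and primes of monomial semirings\<close>

lemma congruenceD:
  assumes "congruence A I"
  shows congruence_carrier: "(a, b) \<in> I \<Longrightarrow> a \<in> A \<and> b \<in> A"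
    and congruence_refl: "a \<in> A \<Longrightarrow> (a, a) \<in> I"
    and congruence_sym: "(a, b) \<in> I \<Longrightarrow> (b, a) \<in> I"
    and congruence_trans: "(a, b) \<in> I \<Longrightarrow> (b, c) \<in> I \<Longrightarrow> (a, c) \<in> I"
    and congruence_add: "(a, b) \<in> I \<Longrightarrow> (c, d) \<in> I \<Longrightarrow> (a + c, b + d) \<in> I"
    and congruence_mult: "(a, b) \<in> I \<Longrightarrow> (c, d) \<in> I \<Longrightarrow> (a * c, b * d) \<in> I"
proof -
  have eq: "I \<subseteq> A \<times> A" "refl_on A I" "sym I" "trans I"
    and ops: "\<And>a b c d. (a, b) \<in> I \<Longrightarrow> (c, d) \<in> I \<Longrightarrow> (a + c, b + d) \<in> I \<and> (a * c, b * d) \<in> I"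
    using assms unfolding congruence_def equiv_def by blast+
  show "(a, b) \<in> I \<Longrightarrow> a \<in> A \<and> b \<in> A" using eq(1) by blast
  show "a \<in> A \<Longrightarrow> (a, a) \<in> I" using eq(2) by (rule refl_onD)
  show "(a, b) \<in> I \<Longrightarrow> (b, a) \<in> I" using eq(3) by (rule symD)
  show "(a, b) \<in> I \<Longrightarrow> (b, c) \<in> I \<Longrightarrow> (a, c) \<in> I" using eq(4) by (rule transD)
  show "(a, b) \<in> I \<Longrightarrow> (c, d) \<in> I \<Longrightarrow> (a + c, b + d) \<in> I"
    "(a, b) \<in> I \<Longrightarrow> (c, d) \<in> I \<Longrightarrow> (a * c, b * d) \<in> I" using ops by blast+
qed

lemma congruence_image_eq_iff:
  assumes "congruence A I" "a \<in> A" "b \<in> A"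
  shows "I `` {a} = I `` {b} \<longleftrightarrow> (a, b) \<in> I"
  by (rule eq_equiv_class_iff) (use assms in \<open>auto simp: congruence_def\<close>)

text \<open>Common frame for both semirings, with \<open>M\<close> the lattice or its nonnegative
  part. By \<open>M_vertical\<close> every nonzero constant is an invertible monomial of
  \<open>A\<close>.\<close>

locale monomial_semiring =
  fixes M :: "(real \<times> (real ^ 'v::finite)) set" and A :: "'v laurent_poly set"
  assumes A_iff: "f \<in> A \<longleftrightarrow> supp f \<subseteq> M"
    and M_lattice: "M \<subseteq> lattice_vectors UNIV"
    and M_add: "p \<in> M \<Longrightarrow> q \<in> M \<Longrightarrow> p + q \<in> M"
    and M_vertical: "(r, 0) \<in> M"
begin

lemma M_zero: "0 \<in> M"
  using M_vertical[of 0] by (simp add: zero_prod_def)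

lemma monomial_in: "p \<in> M \<Longrightarrow> monomial p \<in> A"
  using M_lattice supp_monomial[of p UNIV] by (auto simp: A_iff)

lemma supp_in_M: "f \<in> A \<Longrightarrow> p \<in> supp f \<Longrightarrow> p \<in> M"
  by (meson A_iff subsetD)

lemma A_closed: "0 \<in> A" "1 \<in> A" "f \<in> A \<Longrightarrow> g \<in> A \<Longrightarrow> f + g \<in> A" "f \<in> A \<Longrightarrow> g \<in> A \<Longrightarrow> f * g \<in> A"
proof -
  show "0 \<in> A" by (simp add: A_iff)
  show "1 \<in> A" using monomial_in[OF M_zero] by simp
  show "f + g \<in> A" if "f \<in> A" "g \<in> A"
    using that supp_add_subset[of f g] by (auto simp: A_iff)
  show "f * g \<in> A" if "f \<in> A" "g \<in> A"
    unfolding A_iff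
  proof
    fix x assume "x \<in> supp (f * g)"
    then obtain p q where "p \<in> supp f" "q \<in> supp g" "x = p + q" by (rule supp_mult_subset)
    then show "x \<in> M" using supp_in_M that M_add by blast
  qed
qed

lemma monomial_mult: "p \<in> M \<Longrightarrow> q \<in> M \<Longrightarrow> monomial (p + q) = monomial p * monomial q"
  using M_lattice monomial_add by blast

section \<open>Reduction of a polynomial to a maximal monomial\<close>

lemma congruence_absorb:
  assumes I: "congruence A I" and f: "f \<in> A" and h: "h \<in> A"
    and q: "\<And>q. q \<in> supp f \<Longrightarrow> (monomial q + h, h) \<in> I"
  shows "(f + h, h) \<in> I"
proof -
  have "((\<Sum>q\<in>S. monomial q) + h, h) \<in> I" if "finite S" "S \<subseteq> supp f" for S
    using that
  proof (induction S rule: finite_induct)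
    case empty then show ?case using congruence_refl[OF I h] by simp
  next
    case (insert x S)
    have "monomial x \<in> A" using insert.prems supp_in_M[OF f] monomial_in by blast
    then have "(monomial x + ((\<Sum>q\<in>S. monomial q) + h), monomial x + h) \<in> I"
      using insert by (intro congruence_add[OF I] congruence_refl[OF I]) auto
    moreover have "(monomial x + h, h) \<in> I" using q insert.prems by simp
    ultimately show ?case
      using congruence_trans[OF I] insert.hyps by (simp add: add.assoc)
  qed
  from this[of "supp f"] show ?thesis using eq_sum_monomial[of f] by simp
qed

lemma monomial_add_supp: "p \<in> supp f \<Longrightarrow> monomial p + f = f"
  by (subst (1 2) eq_sum_monomial[of f])
    (simp add: sum.remove[of "supp f" p] laurent_poly_add_idem flip: add.assoc)

lemma congruence_max_monomial:
  assumes I: "congruence A I" and f: "f \<in> A" and p: "p \<in> supp f"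
    and q: "\<And>q. q \<in> supp f \<Longrightarrow> (monomial q + monomial p, monomial p) \<in> I"
  shows "(f, monomial p) \<in> I"
  using congruence_absorb[OF I f _ q] monomial_add_supp[OF p] f p monomial_in
  by (metis A_iff add.commute subsetD)

text \<open>Monomials outside \<open>F\<close> vanish modulo \<open>I\<close>, so \<open>f\<close>
  reduces to 0 or to a monomial in \<open>F\<close> that absorbs the others in
  \<open>F\<close>.\<close>

lemma congruent_max_monomial:
  assumes I: "congruence A I" and f: "f \<in> A"
    and zero: "\<And>q. q \<in> M \<Longrightarrow> q \<notin> F \<Longrightarrow> (monomial q, 0) \<in> I"
  shows "supp f \<inter> F = {} \<Longrightarrow> (f, 0) \<in> I"
    and "p \<in> supp f \<inter> F \<Longrightarrow>
      (\<And>q. q \<in> supp f \<inter> F \<Longrightarrow> (monomial q + monomial p, monomial p) \<in> I) \<Longrightarrow> (f, monomial p) \<in> I"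
proof -
  have nonface: "(monomial q + h, h) \<in> I" if "q \<in> supp f" "q \<notin> F" "h \<in> A" for q h
    using congruence_add[OF I zero[OF supp_in_M[OF f that(1)] that(2)] congruence_refl[OF I that(3)]]
    by simp
  show "(f, 0) \<in> I" if "supp f \<inter> F = {}"
    using congruence_absorb[OF I f A_closed(1)] nonface[OF _ _ A_closed(1)] that by auto
  assume p: "p \<in> supp f \<inter> F"
    and max: "\<And>q. q \<in> supp f \<inter> F \<Longrightarrow> (monomial q + monomial p, monomial p) \<in> I"
  have "p \<in> M" using p supp_in_M[OF f] by blast
  then have "(monomial q + monomial p, monomial p) \<in> I" if "q \<in> supp f" for q
    using max[of q] nonface[OF that _ monomial_in] that by blast
  then show "(f, monomial p) \<in> I"
    using congruence_max_monomial[OF I f] p by blast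
qed

text \<open>Each side reduces to a maximal monomial in \<open>F\<close>, and mutual domination makes
  the two maxima absorb each other. Since \<open>I\<close> is an arbitrary congruence, this serves
  both to describe primes and to show that given pairs generate a congruence.\<close>

lemma congruent_if_dominated:
  assumes I: "congruence A I" and A: "f \<in> A" "g \<in> A"
    and zero: "\<And>q. q \<in> M \<Longrightarrow> q \<notin> F \<Longrightarrow> (monomial q, 0) \<in> I"
    and le: "\<And>p q. p \<in> M \<inter> F \<Longrightarrow> q \<in> M \<inter> F \<Longrightarrow> q - p \<in> C \<Longrightarrow> (monomial p + monomial q, monomial q) \<in> I"
    and add: "\<And>x y. x \<in> C \<Longrightarrow> y \<in> C \<Longrightarrow> x + y \<in> C"
    and total: "\<And>p q. p \<in> M \<inter> F \<Longrightarrow> q \<in> M \<inter> F \<Longrightarrow> q - p \<in> C \<or> p - q \<in> C"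
    and d: "dominated C (supp f \<inter> F) (supp g \<inter> F)" "dominated C (supp g \<inter> F) (supp f \<inter> F)"
  shows "(f, g) \<in> I"
proof -
  note I_trans = congruence_trans[OF I] and I_sym = congruence_sym[OF I]
  have top: "\<exists>p\<in>supp h \<inter> F. (h, monomial p) \<in> I \<and> (\<forall>r\<in>supp h \<inter> F. p - r \<in> C)"
    if h: "h \<in> A" and ne: "supp h \<inter> F \<noteq> {}" for h
  proof -
    have hM: "supp h \<inter> F \<subseteq> M \<inter> F" using supp_in_M[OF h] by blast
    have "\<exists>q\<in>supp h \<inter> F. \<forall>p\<in>supp h \<inter> F. q - p \<in> C"
    proof (rule exists_max_difference[OF _ ne _ add])
      show "finite (supp h \<inter> F)" by simp
      show "q - p \<in> C \<or> p - q \<in> C" if "p \<in> supp h \<inter> F" "q \<in> supp h \<inter> F" for p q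
        by (rule total[OF subsetD[OF hM that(1)] subsetD[OF hM that(2)]])
    qed
    then obtain p where p: "p \<in> supp h \<inter> F" "\<forall>q\<in>supp h \<inter> F. p - q \<in> C" by (elim bexE)
    have "(h, monomial p) \<in> I"
    proof (rule congruent_max_monomial(2)[OF I h zero p(1)])
      fix q assume q: "q \<in> supp h \<inter> F"
      show "(monomial q + monomial p, monomial p) \<in> I"
        by (rule le[OF subsetD[OF hM q] subsetD[OF hM p(1)] bspec[OF p(2) q]])
    qed
    then show ?thesis using p by (intro bexI[of _ p] conjI)
  qed
  show ?thesis
  proof (cases "supp f \<inter> F = {}")
    case True
    then have "supp g \<inter> F = {}" using d(2) unfolding dominated_def by blast
    then show ?thesis
      using I_trans[OF congruent_max_monomial(1)[OF I A(1) zero True]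
          I_sym[OF congruent_max_monomial(1)[OF I A(2) zero]]] by simp
  next
    case False
    obtain p where p: "p \<in> supp f \<inter> F" "(f, monomial p) \<in> I" "\<forall>r\<in>supp f \<inter> F. p - r \<in> C"
      using top[OF A(1) False] by blast
    have "supp g \<inter> F \<noteq> {}" using d(1) False unfolding dominated_def by blast
    then obtain q where q: "q \<in> supp g \<inter> F" "(g, monomial q) \<in> I" "\<forall>r\<in>supp g \<inter> F. q - r \<in> C"
      using top[OF A(2)] by blast
    obtain q' where q': "q' \<in> supp g \<inter> F" "q' - p \<in> C" using d(1) p(1) unfolding dominated_def by blast
    obtain p' where p': "p' \<in> supp f \<inter> F" "p' - q \<in> C" using d(2) q(1) unfolding dominated_def by blast
    have M: "p \<in> M \<inter> F" "q \<in> M \<inter> F" using p(1) q(1) supp_in_M A by blast+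
    have "q - p \<in> C" using add[of "q - q'" "q' - p"] q(3) q' by simp
    then have pq: "(monomial p + monomial q, monomial q) \<in> I" by (rule le[OF M])
    have "p - q \<in> C" using add[of "p - p'" "p' - q"] p(3) p' by simp
    then have "(monomial q + monomial p, monomial p) \<in> I" by (rule le[OF M(2,1)])
    then have qp: "(monomial p + monomial q, monomial p) \<in> I" by (simp add: add.commute)
    show ?thesis
      by (rule I_trans[OF I_trans[OF p(2) I_trans[OF I_sym[OF qp] pq]] I_sym[OF q(2)]])
  qed
qed

section \<open>Surviving monomials and the preorder of a prime\<close>

definition face :: "('v laurent_poly \<times> 'v laurent_poly) set \<Rightarrow> (real \<times> (real ^ 'v)) set" where
  "face P = {p \<in> M. (monomial p, 0) \<notin> P}"

text \<open>Differences are taken because \<open>M\<close> need not be a group. That membership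
  depends on \<open>b - a\<close> alone is \<open>prime_cone_iff\<close>.\<close>

definition prime_cone :: "('v laurent_poly \<times> 'v laurent_poly) set \<Rightarrow> (real \<times> (real ^ 'v)) set" where
  "prime_cone P = {b - a | a b. a \<in> face P \<and> b \<in> face P \<and> (monomial a + monomial b, monomial b) \<in> P}"

context
  fixes P :: "('v laurent_poly \<times> 'v laurent_poly) set"
  assumes prime: "prime_congruence A P"
begin

lemma P_congruence: "congruence A P"
  using prime by (auto simp: prime_congruence_def proper_congruence_def)

lemmas P_carrier = congruence_carrier[OF P_congruence]
  and P_refl = congruence_refl[OF P_congruence]
  and P_sym = congruence_sym[OF P_congruence]
  and P_trans = congruence_trans[OF P_congruence]
  and P_add = congruence_add[OF P_congruence]
  and P_mult = congruence_mult[OF P_congruence]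

lemma P_one_zero: "(1, 0) \<notin> P"
proof
  assume one: "(1, 0) \<in> P"
  have zero: "(a, 0) \<in> P" if "a \<in> A" for a
    using P_mult[OF P_refl[OF that] one] by simp
  have "(a, b) \<in> P" if "a \<in> A" "b \<in> A" for a b
    using P_trans[OF zero[OF that(1)] P_sym[OF zero[OF that(2)]]] .
  then have "P = A \<times> A" using P_carrier by auto
  then show False using prime by (auto simp: prime_congruence_def proper_congruence_def)
qed

lemma P_prime:
  assumes "a \<in> A" "b \<in> A" "c \<in> A" "d \<in> A" "(a * c + b * d, a * d + b * c) \<in> P"
  shows "(a, b) \<in> P \<or> (c, d) \<in> P"
  using prime assms unfolding prime_congruence_def twisted_product_def by fastforce

text \<open>The twisted product of \<open>(a, 0)\<close> and \<open>(b, c)\<close> is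
  \<open>(a * b, a * c)\<close>.\<close>

lemma P_cancel:
  assumes "a \<in> A" "b \<in> A" "c \<in> A" "(a * b, a * c) \<in> P"
  shows "(a, 0) \<in> P \<or> (b, c) \<in> P"
  using P_prime[OF assms(1) A_closed(1) assms(2,3)] assms(4) by simp

text \<open>The twisted product of \<open>(a + b, a)\<close> and \<open>(a + b, b)\<close> lies on the diagonal.\<close>

lemma P_linear:
  assumes "a \<in> A" "b \<in> A"
  shows "(a + b, a) \<in> P \<or> (a + b, b) \<in> P"
proof -
  have left_idem: "x + (x + y) = x + y" for x y :: "'v laurent_poly"
    by (simp add: laurent_poly_add_idem flip: add.assoc)
  have "(a + b) * (a + b) + a * b = (a + b) * b + a * (a + b)"
    by (simp add: distrib_left distrib_right mult.commute[of b a] add_ac laurent_poly_add_idem left_idem)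
  then show ?thesis
    using P_prime[of "a + b" a "a + b" b] P_refl A_closed assms by simp
qed

lemma face_add_iff:
  assumes "p \<in> M" "q \<in> M"
  shows "p + q \<in> face P \<longleftrightarrow> p \<in> face P \<and> q \<in> face P"
proof -
  have ab: "monomial p \<in> A" "monomial q \<in> A" using assms monomial_in by auto
  have "(monomial p * monomial q, 0) \<in> P" if "(monomial p, 0) \<in> P"
    using P_mult[OF that P_refl[OF ab(2)]] by simp
  moreover have "(monomial p * monomial q, 0) \<in> P" if "(monomial q, 0) \<in> P"
    using P_mult[OF P_refl[OF ab(1)] that] by simp
  moreover have "(monomial p, 0) \<in> P \<or> (monomial q, 0) \<in> P" if "(monomial p * monomial q, 0) \<in> P"
    using P_cancel[OF ab A_closed(1)] that by simp
  ultimately show ?thesis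
    using assms M_add monomial_mult[OF assms] by (auto simp: face_def)
qed

lemma face_inverse: "p \<in> M \<Longrightarrow> - p \<in> M \<Longrightarrow> p \<in> face P"
  using face_add_iff[of p "- p"] P_one_zero M_zero by (simp add: face_def)

lemma face_vertical: "(r, 0) \<in> face P"
  using face_inverse[of "(r, 0)"] M_vertical[of r] M_vertical[of "- r"] by simp

lemma face_subset: "face P \<subseteq> M"
  by (auto simp: face_def)

text \<open>If \<open>b - a = b' - a'\<close>, then cross-multiplying the monomials gives equal
  products. Multiply the relation for \<open>a'\<close> and \<open>b'\<close> by the monomial of
  \<open>a\<close>, rewrite, and cancel the monomial of \<open>a'\<close>, which is not congruent to
  0.\<close>

lemma prime_cone_iff:
  assumes a: "a \<in> face P" and b: "b \<in> face P"
  shows "b - a \<in> prime_cone P \<longleftrightarrow> (monomial a + monomial b, monomial b) \<in> P"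
proof
  assume "b - a \<in> prime_cone P"
  then obtain a' b' where ab': "a' \<in> face P" "b' \<in> face P" "b - a = b' - a'"
      "(monomial a' + monomial b', monomial b') \<in> P"
    by (auto simp: prime_cone_def)
  have M: "a \<in> M" "b \<in> M" "a' \<in> M" "b' \<in> M" using assms ab' face_subset by blast+
  note A = monomial_in[OF M(1)] monomial_in[OF M(2)] monomial_in[OF M(3)] monomial_in[OF M(4)]
  have swap: "monomial a * monomial b' = monomial b * monomial a'"
    using ab'(3) M by (simp add: algebra_simps flip: monomial_mult)
  have "(monomial a * (monomial a' + monomial b'), monomial a * monomial b') \<in> P"
    using P_mult[OF P_refl[OF A(1)] ab'(4)] .
  then have "(monomial a' * (monomial a + monomial b), monomial a' * monomial b) \<in> P"
    by (simp add: distrib_left swap mult.commute)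
  then show "(monomial a + monomial b, monomial b) \<in> P"
    using P_cancel[of "monomial a'" "monomial a + monomial b" "monomial b"] A A_closed ab'(1)
    by (auto simp: face_def)
next
  assume "(monomial a + monomial b, monomial b) \<in> P"
  then show "b - a \<in> prime_cone P" using assms unfolding prime_cone_def by blast
qed

lemma prime_cone_add:
  assumes "x \<in> prime_cone P" "y \<in> prime_cone P"
  shows "x + y \<in> prime_cone P"
proof -
  obtain a b where ab: "a \<in> face P" "b \<in> face P" "x = b - a"
    "(monomial a + monomial b, monomial b) \<in> P"
    using assms(1) by (auto simp: prime_cone_def)
  obtain c d where cd: "c \<in> face P" "d \<in> face P" "y = d - c"
    "(monomial c + monomial d, monomial d) \<in> P"
    using assms(2) by (auto simp: prime_cone_def)
  have M: "a \<in> M" "b \<in> M" "c \<in> M" "d \<in> M" using ab cd face_subset by blast+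
  note A = monomial_in[OF M(1)] monomial_in[OF M(2)] monomial_in[OF M(3)] monomial_in[OF M(4)]
  let ?m = "\<lambda>p q. monomial p * monomial q"
  \<comment> \<open>Multiplying the first relation by \<open>c\<close> and the second by
    \<open>b\<close> makes them meet in the middle term \<open>?m b c\<close>.\<close>
  have ab': "(?m a c + ?m b c, ?m b c) \<in> P"
    using P_mult[OF ab(4) P_refl[OF A(3)]] by (simp add: distrib_right)
  have cd': "(?m b c + ?m b d, ?m b d) \<in> P"
    using P_mult[OF P_refl[OF A(2)] cd(4)] by (simp add: distrib_left)
  have mem: "?m a c \<in> A" "?m b d \<in> A" using A A_closed by auto
  have "(?m a c + (?m b c + ?m b d), ?m a c + ?m b d) \<in> P"
    using P_add[OF P_refl[OF mem(1)] cd'] .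
  moreover have "((?m a c + ?m b c) + ?m b d, ?m b c + ?m b d) \<in> P"
    using P_add[OF ab' P_refl[OF mem(2)]] .
  ultimately have "(?m a c + ?m b d, ?m b c + ?m b d) \<in> P"
    unfolding add.assoc by (rule P_trans[OF P_sym])
  then have "(?m a c + ?m b d, ?m b d) \<in> P"
    by (rule P_trans[OF _ cd'])
  then have "(b + d) - (a + c) \<in> prime_cone P"
    using prime_cone_iff[of "a + c" "b + d"] face_add_iff ab cd M by (simp add: monomial_mult)
  moreover have "(b + d) - (a + c) = x + y" using ab(3) cd(3) by simp
  ultimately show ?thesis by simp
qed

lemma prime_cone_total:
  assumes "a \<in> face P" "b \<in> face P"
  shows "b - a \<in> prime_cone P \<or> a - b \<in> prime_cone P"
proof -
  have "a \<in> M" "b \<in> M" using assms face_subset by blast+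
  then have "(monomial a + monomial b, monomial a) \<in> P \<or> (monomial a + monomial b, monomial b) \<in> P"
    by (intro P_linear monomial_in)
  then show ?thesis
    using prime_cone_iff[OF assms] prime_cone_iff[OF assms(2,1)] by (auto simp: add.commute)
qed

lemma prime_cone_vertical:
  assumes "0 \<le> r"
  shows "(r, 0) \<in> prime_cone P"
proof -
  have "monomial (0, 0) + monomial (r, 0) = (monomial (r, 0) :: 'v laurent_poly)"
    using assms by (auto intro!: poly_mapping_eqI
        simp: monomial_def term_of_def lookup_add lookup_single when_def max_def zero_trop_def)
  then show ?thesis
    using prime_cone_iff[OF face_vertical[of 0] face_vertical[of r]]
      P_refl[OF monomial_in[OF M_vertical[of r]]] by simp
qed

lemma nonface_zero: "q \<in> M \<Longrightarrow> q \<notin> face P \<Longrightarrow> (monomial q, 0) \<in> P"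
  by (simp add: face_def)

text \<open>For the inclusion from left to right: \<open>f\<close> absorbs its own monomials, so
  everything congruent to \<open>f\<close> absorbs them modulo \<open>P\<close>, in particular the
  maximal surviving monomial of \<open>g\<close>, or 0 if there is none. The converse is
  \<open>congruent_if_dominated\<close>.\<close>

lemma P_eq_dominated:
  "P = {(f, g) \<in> A \<times> A. dominated (prime_cone P) (supp f \<inter> face P) (supp g \<inter> face P) \<and>
    dominated (prime_cone P) (supp g \<inter> face P) (supp f \<inter> face P)}"
proof -
  let ?F = "face P" and ?C = "prime_cone P"
  have max: "\<exists>q\<in>S. \<forall>p\<in>S. q - p \<in> ?C" if "finite S" "S \<noteq> {}" "S \<subseteq> ?F" for S
    using exists_max_difference[OF that(1,2), of ?C] prime_cone_total prime_cone_add that(3) by blast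
  have top: "\<exists>q\<in>supp f \<inter> ?F. \<forall>p\<in>supp f \<inter> ?F. q - p \<in> ?C" if "supp f \<inter> ?F \<noteq> {}" for f
    by (rule max) (use that in auto)
  have dom: "dominated ?C (supp f \<inter> ?F) (supp g \<inter> ?F)" if fg: "(f, g) \<in> P" for f g
    unfolding dominated_def
  proof
    fix p assume p: "p \<in> supp f \<inter> ?F"
    have A: "f \<in> A" "g \<in> A" "monomial p \<in> A" using P_carrier fg p face_subset monomial_in by blast+
    have swallow: "(monomial p + h, h) \<in> P" if h: "(g, h) \<in> P" for h
    proof -
      have fh: "(f, h) \<in> P" using P_trans[OF fg h] .
      have "(monomial p + f, monomial p + h) \<in> P" using P_add[OF P_refl[OF A(3)] fh] .
      then have "(monomial p + h, f) \<in> P" using monomial_add_supp[of p f] p P_sym by simp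
      then show ?thesis by (rule P_trans[OF _ fh])
    qed
    show "\<exists>q\<in>supp g \<inter> ?F. q - p \<in> ?C"
    proof (cases "supp g \<inter> ?F = {}")
      case True
      have "(g, 0) \<in> P"
        by (rule congruent_max_monomial(1)[OF P_congruence A(2) nonface_zero True])
      then have "(monomial p, 0) \<in> P" using swallow[of 0] by simp
      then show ?thesis using p by (simp add: face_def)
    next
      case False
      then obtain q where q: "q \<in> supp g \<inter> ?F" "\<forall>r\<in>supp g \<inter> ?F. q - r \<in> ?C"
        using top[of g] by blast
      have "(g, monomial q) \<in> P"
      proof (rule congruent_max_monomial(2)[OF P_congruence A(2) nonface_zero q(1)])
        fix r assume "r \<in> supp g \<inter> ?F"
        then show "(monomial r + monomial q, monomial q) \<in> P"
          using q prime_cone_iff[of r q] by blast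
      qed
      then have "(monomial p + monomial q, monomial q) \<in> P" by (rule swallow)
      then show ?thesis using prime_cone_iff[of p q] p q(1) by auto
    qed
  qed
  have conv: "(f, g) \<in> P" if A: "f \<in> A" "g \<in> A" and d: "dominated ?C (supp f \<inter> ?F) (supp g \<inter> ?F)"
    "dominated ?C (supp g \<inter> ?F) (supp f \<inter> ?F)" for f g
    by (rule congruent_if_dominated[OF P_congruence A nonface_zero _ prime_cone_add _ d])
      (use prime_cone_iff prime_cone_total in blast)+
  show ?thesis
  proof (intro equalityI subsetI)
    fix z assume z: "z \<in> P"
    obtain f g where fg: "z = (f, g)" by (cases z)
    have "(g, f) \<in> P" using P_sym z fg by simp
    then show "z \<in> {(f, g) \<in> A \<times> A. dominated ?C (supp f \<inter> ?F) (supp g \<inter> ?F) \<and>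
        dominated ?C (supp g \<inter> ?F) (supp f \<inter> ?F)}"
      using dom P_carrier z fg by simp
  qed (use conv in auto)
qed

text \<open>Every lattice vector on \<open>Y\<close> being a difference of surviving monomials,
  totality on those monomials extends to the lattice.\<close>

lemma prime_eq_cone_congruence:
  assumes face: "face P = M \<inter> vectors Y"
    and diff: "\<And>y. y \<in> lattice_vectors Y \<Longrightarrow> \<exists>a\<in>face P. \<exists>b\<in>face P. y = b - a"
  shows "order_cone Y (prime_cone P) \<and> P = cone_congruence A Y (prime_cone P)"
proof
  have FY: "face P \<subseteq> lattice_vectors Y"
    using face M_lattice by (auto simp: lattice_vectors_def)
  have "prime_cone P \<subseteq> lattice_vectors Y"
    using FY unfolding prime_cone_def by blast
  moreover have "x \<in> prime_cone P \<or> - x \<in> prime_cone P" if "x \<in> lattice_vectors Y" for x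
    using diff[OF that] prime_cone_total by fastforce
  ultimately show "order_cone Y (prime_cone P)"
    unfolding order_cone_def using prime_cone_add prime_cone_vertical by blast
  have "supp f \<inter> face P = supp f \<inter> vectors Y" if "f \<in> A" for f
    using that face by (auto simp: A_iff)
  then show "P = cone_congruence A Y (prime_cone P)"
    by (subst P_eq_dominated) (auto simp: cone_congruence_def)
qed

end

end

section \<open>The primes of the Laurent and polynomial semirings as cone congruences\<close>

lemma monomial_semiring_laurent: "monomial_semiring (lattice_vectors X) (laurent X)"
  by unfold_locales (use laurent_iff_supp lattice_vectors_mono[of X UNIV] in auto)

lemma monomial_semiring_polys: "monomial_semiring (nonneg_lattice X) (polys X)"
  by unfold_locales
    (use polys_iff_supp lattice_vectors_mono[of X UNIV] in \<open>auto simp: nonneg_lattice_def\<close>)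

text \<open>Laurent monomials are units, so none of them is congruent to 0 and all variables
  survive.\<close>

lemma laurent_prime_cone:
  assumes P: "prime_congruence (laurent X) P"
  shows "\<exists>C. order_cone X C \<and> P = cone_congruence (laurent X) X C"
proof -
  interpret monomial_semiring "lattice_vectors X" "laurent X" by (rule monomial_semiring_laurent)
  have F: "face P = lattice_vectors X"
    using face_inverse[OF P] face_subset[OF P] by blast
  have "\<exists>a\<in>face P. \<exists>b\<in>face P. y = b - a" if "y \<in> lattice_vectors X" for y
    using that unfolding F by (intro bexI[of _ 0] bexI[of _ y]) auto
  moreover have "face P = lattice_vectors X \<inter> vectors X"
    using F by (auto simp: lattice_vectors_def)
  ultimately show ?thesis
    using prime_eq_cone_congruence[OF P] by blast
qed

lemma var_eq_monomial: "var j = monomial (point 0 (axis j 1))"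
  by (simp add: var_def)

lemma nonneg_lattice_diff:
  assumes "y \<in> lattice_vectors Y"
  shows "\<exists>a\<in>nonneg_lattice Y. \<exists>b\<in>nonneg_lattice Y. y = b - a"
proof -
  \<comment> \<open>The negative part of the exponent vector, so that \<open>y + a\<close> has the
    positive part as its exponents.\<close>
  define a where "a = ((0::real), (\<chi> j. max 0 (- (snd y $ j))))"
  have "max 0 (- (snd y $ j)) \<in> \<int>" for j
    using assms by (auto simp: lattice_vectors_def max_def)
  then have a: "a \<in> nonneg_lattice Y"
    using assms by (auto simp: nonneg_lattice_def lattice_vectors_def vectors_def a_def)
  have "y + a \<in> lattice_vectors Y" using assms a by (auto simp: nonneg_lattice_def)
  then have "y + a \<in> nonneg_lattice Y"
    by (auto simp: nonneg_lattice_def a_def)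
  then show ?thesis using a by (metis add_diff_cancel_right')
qed

lemma nonneg_lattice_decompose:
  assumes "p \<in> nonneg_lattice Y"
  shows "\<exists>m. p = (fst p, 0) + (\<Sum>j\<in>Y. real (m j) *\<^sub>R point 0 (axis j 1))"
proof -
  have "\<exists>m::nat. snd p $ j = real m" for j
  proof -
    have "snd p $ j \<in> \<int>" "snd p $ j \<ge> 0" using assms by (auto simp: nonneg_lattice_def lattice_vectors_def)
    then show ?thesis by (metis Ints_cases nonneg_int_cases of_int_0_le_iff of_int_of_nat_eq)
  qed
  then obtain m where m: "\<And>j. snd p $ j = real (m j)" by metis
  have "snd p $ i = (\<Sum>j\<in>Y. real (m j) * (if i = j then 1 else 0))" for i
  proof (cases "i \<in> Y")
    case False
    then have "snd p $ i = 0" using assms by (auto simp: nonneg_lattice_def lattice_vectors_def vectors_def)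
    moreover have "(\<Sum>j\<in>Y. real (m j) * (if i = j then 1 else 0)) = 0"
      using False by (intro sum.neutral) auto
    ultimately show ?thesis by simp
  qed (simp add: m if_distrib[of "(*) _"] cong: if_cong)
  then have "p = (fst p, 0) + (\<Sum>j\<in>Y. real (m j) *\<^sub>R point 0 (axis j 1))"
    by (simp add: prod_eq_iff vec_eq_iff point_def fst_sum snd_sum axis_def if_distrib[of of_int] cong: if_cong)
  then show ?thesis by blast
qed

text \<open>A product of monomials survives exactly if its factors do, so the surviving monomials
  are those in the surviving variables.\<close>

lemma polys_prime_cone:
  fixes X :: "'v::finite set"
  assumes P: "prime_congruence (polys X) P"
  defines "Y \<equiv> {j \<in> X. (var j, 0) \<notin> P}"
  shows "\<exists>C. order_cone Y C \<and> P = cone_congruence (polys X) Y C"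
proof -
  interpret monomial_semiring "nonneg_lattice X" "polys X" by (rule monomial_semiring_polys)
  let ?e = "\<lambda>j. point 0 (axis j 1) :: real \<times> (real ^ 'v)"
  have e: "?e j \<in> nonneg_lattice X \<longleftrightarrow> j \<in> X" for j
    by (auto simp: nonneg_lattice_def point_in_lattice_iff) (auto simp: axis_def point_def)
  have eF: "?e j \<in> face P \<longleftrightarrow> j \<in> Y" for j
    by (auto simp: face_def e Y_def var_eq_monomial)
  have add: "a + b \<in> face P" if "a \<in> face P" "b \<in> face P" for a b
    using face_add_iff[OF P] that face_subset[OF P] by blast
  have zero: "0 \<in> face P" using face_vertical[OF P, of 0] by (simp add: zero_prod_def)
  have sum: "(\<Sum>i\<in>I. f i) \<in> face P" if "\<And>i. i \<in> I \<Longrightarrow> f i \<in> face P" for I :: "'i set" and f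
    using that by (induction I rule: infinite_finite_induct) (auto simp: zero intro: add)
  have scale: "real m *\<^sub>R a \<in> face P" if "a \<in> face P" for m a
    using that by (induction m) (auto simp: zero scaleR_add_left intro: add)
  have F: "face P = nonneg_lattice X \<inter> vectors Y"
  proof (intro equalityI subsetI)
    fix p assume p: "p \<in> face P"
    have pM: "p \<in> nonneg_lattice X" using p face_subset[OF P] by blast
    have "snd p $ j = 0" if "j \<notin> Y" for j
    proof (rule ccontr)
      assume nz: "snd p $ j \<noteq> 0"
      have jX: "j \<in> X" using nz pM by (auto simp: nonneg_lattice_def lattice_vectors_def vectors_def)
      have "snd p $ j \<in> \<int>" "0 \<le> snd p $ j"
        using pM by (auto simp: nonneg_lattice_def lattice_vectors_def)
      \<comment> \<open>A nonzero exponent is at least 1 by integrality, so the variable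
        \<open>j\<close> can be split off without leaving the nonnegative lattice.\<close>
      then have "1 \<le> snd p $ j" using nz by (auto elim!: Ints_cases)
      then have "0 \<le> snd (p - ?e j) $ i" for i
        using pM by (auto simp: nonneg_lattice_def point_def axis_def)
      moreover have "p - ?e j \<in> lattice_vectors X"
        using pM e[of j] jX by (auto simp: nonneg_lattice_def)
      ultimately have "p - ?e j \<in> nonneg_lattice X" by (simp add: nonneg_lattice_def)
      then have "?e j \<in> face P"
        using face_add_iff[OF P, of "p - ?e j" "?e j"] e[of j] jX p by simp
      then show False using that eF by blast
    qed
    then show "p \<in> nonneg_lattice X \<inter> vectors Y" using pM by (simp add: vectors_def)
  next
    fix p assume "p \<in> nonneg_lattice X \<inter> vectors Y"
    then have "p \<in> nonneg_lattice Y" by (auto simp: nonneg_lattice_def lattice_vectors_def)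
    then obtain m where m: "p = (fst p, 0) + (\<Sum>j\<in>Y. real (m j) *\<^sub>R ?e j)"
      using nonneg_lattice_decompose by blast
    have "(fst p, 0) + (\<Sum>j\<in>Y. real (m j) *\<^sub>R ?e j) \<in> face P"
      by (intro add sum scale face_vertical[OF P]) (simp add: eF)
    then show "p \<in> face P" using m by simp
  qed
  have "Y \<subseteq> X" by (auto simp: Y_def)
  then have "face P = nonneg_lattice Y"
    unfolding F by (auto simp: nonneg_lattice_def lattice_vectors_def vectors_def)
  then have "\<exists>a\<in>face P. \<exists>b\<in>face P. y = b - a" if "y \<in> lattice_vectors Y" for y
    using nonneg_lattice_diff[OF that] by simp
  then show ?thesis using prime_eq_cone_congruence[OF P F] by blast
qed

section \<open>Lexicographic cones of matrices\<close>

lemma lex_nonneg_0 [simp]: "lex_nonneg 0 w"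
  by (simp add: lex_nonneg_def)

lemma first_nonzero_Suc: "first_nonzero w (Suc i) \<longleftrightarrow> w 0 = 0 \<and> first_nonzero (\<lambda>i. w (Suc i)) i"
  by (auto simp: first_nonzero_def less_Suc_eq_0_disj)

text \<open>Peeling off the first row makes the lexicographic comparison recursive; the facts about
  it below then follow by induction on the number of rows.\<close>

lemma lex_nonneg_Suc:
  "lex_nonneg (Suc l) w \<longleftrightarrow> 0 < w 0 \<or> w 0 = 0 \<and> lex_nonneg l (\<lambda>i. w (Suc i))"
proof
  assume "lex_nonneg (Suc l) w"
  then consider "\<forall>i<Suc l. w i = 0" | i where "i < Suc l" "first_nonzero w i" "0 < w i"
    by (auto simp: lex_nonneg_def)
  then show "0 < w 0 \<or> w 0 = 0 \<and> lex_nonneg l (\<lambda>i. w (Suc i))"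
  proof cases
    case 2
    then show ?thesis
      by (cases i) (auto simp: lex_nonneg_def first_nonzero_Suc)
  qed (auto simp: lex_nonneg_def)
next
  assume "0 < w 0 \<or> w 0 = 0 \<and> lex_nonneg l (\<lambda>i. w (Suc i))"
  then consider "0 < w 0" | "w 0 = 0" "\<forall>i<l. w (Suc i) = 0"
    | i where "w 0 = 0" "i < l" "first_nonzero (\<lambda>i. w (Suc i)) i" "0 < w (Suc i)"
    by (auto simp: lex_nonneg_def)
  then show "lex_nonneg (Suc l) w"
  proof cases
    case 1
    then have "first_nonzero w 0" by (simp add: first_nonzero_def)
    then show ?thesis using 1 unfolding lex_nonneg_def by blast
  next
    case 2
    then have "\<forall>i<Suc l. w i = 0" by (auto simp: less_Suc_eq_0_disj)
    then show ?thesis unfolding lex_nonneg_def by blast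
  next
    case 3
    then have "first_nonzero w (Suc i)" by (simp add: first_nonzero_Suc)
    then show ?thesis using 3 unfolding lex_nonneg_def by (metis Suc_less_eq)
  qed
qed

lemma lex_nonneg_add: "lex_nonneg l w \<Longrightarrow> lex_nonneg l w' \<Longrightarrow> lex_nonneg l (\<lambda>i. w i + w' i)"
  by (induction l arbitrary: w w') (auto simp: lex_nonneg_Suc)

lemma lex_nonneg_total: "lex_nonneg l w \<or> lex_nonneg l (\<lambda>i. - w i)"
  by (induction l arbitrary: w) (force simp: lex_nonneg_Suc)+

lemma lex_nonneg_antisym: "lex_nonneg l w \<Longrightarrow> lex_nonneg l (\<lambda>i. - w i) \<Longrightarrow> i < l \<Longrightarrow> w i = 0"
proof (induction l arbitrary: w i)
  case (Suc l)
  then have w0: "w 0 = 0" "lex_nonneg l (\<lambda>i. w (Suc i))" "lex_nonneg l (\<lambda>i. - w (Suc i))"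
    by (auto simp: lex_nonneg_Suc)
  show ?case
    using Suc.IH[OF w0(2,3)] w0(1) Suc.prems(3) by (cases i) auto
qed simp

lemma lex_nonneg_scale: "lex_nonneg l w \<Longrightarrow> 0 \<le> r \<Longrightarrow> lex_nonneg l (\<lambda>i. r * w i)"
proof (cases "r = 0")
  assume "lex_nonneg l w" "0 \<le> r" "r \<noteq> 0"
  then show ?thesis
    by (induction l arbitrary: w) (auto simp: lex_nonneg_Suc zero_less_mult_iff)
qed (simp add: lex_nonneg_def)

lemma mat_app_add: "mat_app X U (x + y) i = mat_app X U x i + mat_app X U y i"
  by (simp add: mat_app_def distrib_left sum.distrib)

lemma mat_app_minus: "mat_app X U (- x) i = - mat_app X U x i"
  by (simp add: mat_app_def sum_negf)

lemma mat_app_vertical: "mat_app X U (r, 0) i = r * U i None"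
  by (simp add: mat_app_def)

definition matrix_cone :: "'v::finite set \<Rightarrow> nat \<Rightarrow> 'v matrix \<Rightarrow> (real \<times> (real ^ 'v)) set" where
  "matrix_cone X l U = {y \<in> lattice_vectors X. lex_nonneg l (mat_app X U y)}"

text \<open>The first column is the image of \<open>(1, 0)\<close>, so its sign condition says that
  the upward direction is nonnegative.\<close>

lemma order_cone_matrix_cone:
  assumes "lex_nonneg l (\<lambda>i. U i None)"
  shows "order_cone X (matrix_cone X l U)"
  unfolding order_cone_def
proof (intro conjI ballI allI impI)
  show "matrix_cone X l U \<subseteq> lattice_vectors X" by (simp add: matrix_cone_def)
  fix x y assume "x \<in> matrix_cone X l U" "y \<in> matrix_cone X l U"
  then show "x + y \<in> matrix_cone X l U"
    unfolding matrix_cone_def using lex_nonneg_add[of l "mat_app X U x" "mat_app X U y"]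
    by (simp add: mat_app_add[abs_def] lattice_vectors_closed)
next
  fix x assume x: "x \<in> lattice_vectors X"
  have "mat_app X U (- x) = (\<lambda>i. - mat_app X U x i)" by (rule ext) (rule mat_app_minus)
  then show "x \<in> matrix_cone X l U \<or> - x \<in> matrix_cone X l U"
    unfolding matrix_cone_def using lex_nonneg_total[of l "mat_app X U x"] x
    by (simp add: lattice_vectors_closed)
next
  fix r :: real assume "0 \<le> r"
  then have "lex_nonneg l (mat_app X U (r, 0))"
    using lex_nonneg_scale[OF assms] by (simp add: mat_app_vertical[abs_def])
  then show "(r, 0) \<in> matrix_cone X l U" by (simp add: matrix_cone_def)
qed

text \<open>The generators say that larger monomials absorb smaller ones. Any congruence containing
  them identifies mutually dominating polynomials, by \<open>congruent_if_dominated\<close> with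
  \<open>F = UNIV\<close>.\<close>

lemma laurent_prime_eq_cone_congruence:
  assumes U: "lex_nonneg l (\<lambda>i. U i None)"
  shows "laurent_prime X l U = cone_congruence (laurent X) X (matrix_cone X l U)"
proof -
  let ?A = "laurent X" and ?C = "matrix_cone X l U"
  interpret monomial_semiring "lattice_vectors X" ?A by (rule monomial_semiring_laurent)
  note C = order_cone_matrix_cone[where U = U and X = X, OF U]
  let ?G = "{(term_of c1 n1 + term_of c2 n2, term_of c2 n2) | c1 n1 c2 n2.
        term_of c1 n1 \<in> laurent X \<and> term_of c2 n2 \<in> laurent X \<and>
        lex_nonneg l (mat_app X U (point c2 n2 - point c1 n1))}"
  have term_in: "term_of c n \<in> ?A \<longleftrightarrow> point c n \<in> lattice_vectors X" for c n
    using supp_monomial[OF supp_lattice_UNIV, of "point c n" "term_of c n"]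
    by (simp add: A_iff point_in_supp_iff term_of_def)
  have "?G \<subseteq> cone_congruence ?A X ?C"
  proof
    fix z assume "z \<in> ?G"
    then obtain c n d m where z: "z = (term_of c n + term_of d m, term_of d m)"
      and mem: "term_of c n \<in> ?A" "term_of d m \<in> ?A"
      and lex: "lex_nonneg l (mat_app X U (point d m - point c n))" by blast
    have dm: "point d m - point c n \<in> ?C"
      using mem lex unfolding matrix_cone_def term_in by blast
    have supp: "supp (term_of c n) = {point c n}" "supp (term_of d m) = {point d m}"
      using mem supp_monomial[of "point c n" X] supp_monomial[of "point d m" X] by (auto simp: term_in)
    have le: "dominated ?C (supp (term_of c n)) (supp (term_of d m))"
      using dm by (simp add: supp dominated_def)
    have "dominated ?C (supp (term_of c n + term_of d m)) (supp (term_of d m + term_of d m))"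
      by (rule dominated_supp_add[OF C le dominated_refl[OF C]])
    moreover have "dominated ?C (supp (0 + term_of d m)) (supp (term_of c n + term_of d m))"
      by (rule dominated_supp_add[OF C _ dominated_refl[OF C]]) (simp add: dominated_def)
    ultimately show "z \<in> cone_congruence ?A X ?C"
      unfolding z cone_congruence_iff[OF order_refl] using mem A_closed
      by (simp add: laurent_poly_add_idem)
  qed
  moreover have "congruence ?A (cone_congruence ?A X ?C)"
    by (rule cone_congruence_congruence[OF C order_refl]) (simp add: A_closed)
  ultimately have sub: "laurent_prime X l U \<subseteq> cone_congruence ?A X ?C"
    unfolding laurent_prime_def generated_congruence_def by blast
  have "(f, g) \<in> I" if fg: "(f, g) \<in> cone_congruence ?A X ?C" and I: "congruence ?A I" "?G \<subseteq> I" for f g I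
  proof -
    have A: "f \<in> ?A" "g \<in> ?A" and d: "dominated ?C (supp f) (supp g)" "dominated ?C (supp g) (supp f)"
      using fg by (auto simp: cone_congruence_iff)
    have gen: "(monomial p + monomial q, monomial q) \<in> I" if pq: "p \<in> lattice_vectors X" "q \<in> lattice_vectors X"
      "q - p \<in> ?C" for p q
    proof -
      obtain c n where p: "p = point c n" using pq(1) by (rule lattice_vectorE)
      obtain c' n' where q: "q = point c' n'" using pq(2) by (rule lattice_vectorE)
      have "lex_nonneg l (mat_app X U (point c' n' - point c n))"
        using pq(3) by (simp add: p q matrix_cone_def)
      then have "(term_of c n + term_of c' n', term_of c' n') \<in> ?G"
        using pq(1,2) unfolding p q term_in[symmetric] by blast
      then have "(term_of c n + term_of c' n', term_of c' n') \<in> I" using I(2) by (rule rev_subsetD)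
      then show ?thesis by (simp add: p q)
    qed
    show ?thesis
    proof (rule congruent_if_dominated[where F = UNIV and C = ?C, OF I(1) A])
      fix p q assume pq: "p \<in> lattice_vectors X \<inter> UNIV" "q \<in> lattice_vectors X \<inter> UNIV"
      show "q - p \<in> ?C \<Longrightarrow> (monomial p + monomial q, monomial q) \<in> I"
        using gen pq by blast
      have "q - p \<in> lattice_vectors X" using pq by blast
      then show "q - p \<in> ?C \<or> p - q \<in> ?C" using order_cone_total[OF C, of "q - p"] by auto
    qed (use d order_cone_add[OF C] in auto)
  qed
  moreover have "cone_congruence ?A X ?C \<subseteq> ?A \<times> ?A" by (auto simp: cone_congruence_def)
  ultimately have "cone_congruence ?A X ?C \<subseteq> laurent_prime X l U"
    unfolding laurent_prime_def generated_congruence_def by (intro subsetI IntI InterI) auto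
  then show ?thesis using sub by (rule subset_antisym[rotated])
qed

section \<open>Real combinations of lattice points\<close>

lemma Dirichlet_approx_finite:
  fixes u :: "'i \<Rightarrow> real" and N :: nat
  assumes "finite I" "N > 0"
  shows "\<exists>q::nat. q > 0 \<and> (\<exists>p::'i \<Rightarrow> int. \<forall>i\<in>I. \<bar>real q * u i - of_int (p i)\<bar> < 1 / N)"
proof -
  obtain e and n :: nat where e: "bij_betw e I {..<n}"
    using ex_bij_betw_finite_nat[OF assms(1)] by (metis atLeast0LessThan)
  obtain q p where q: "0 < q"
    "\<And>i. i < n \<Longrightarrow> \<bar>of_int q * u (inv_into I e i) - of_int (p i)\<bar> < 1 / N"
    using Dirichlet_approx_simult[OF assms(2), of n "\<lambda>i. u (inv_into I e i)"] by blast
  have "\<bar>real (nat q) * u i - of_int (p (e i))\<bar> < 1 / N" if "i \<in> I" for i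
  proof -
    have "e i < n" "inv_into I e (e i) = i"
      using e that by (auto simp: bij_betw_def)
    then show ?thesis using q(2)[of "e i"] q(1) by simp
  qed
  then show ?thesis
    using q(1) by (intro exI[of _ "nat q"] conjI exI[of _ "\<lambda>i. p (e i)"]) auto
qed

text \<open>The exponents are integral, so a sufficiently good simultaneous rational approximation of the
  coefficients reproduces them exactly, and only the first coordinate is perturbed.\<close>

lemma lattice_combination_approx:
  fixes c :: "'i \<Rightarrow> real \<times> (real ^ 'v::finite)" and u :: "'i \<Rightarrow> real" and N :: nat
  assumes I: "finite I" and c: "\<And>i. i \<in> I \<Longrightarrow> c i \<in> lattice_vectors X" and x: "x \<in> lattice_vectors X"
    and eq: "x = (\<Sum>i\<in>I. u i *\<^sub>R c i) + (r, 0)" and N: "(\<Sum>i\<in>I. norm (c i)) < real N"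
  obtains q :: nat and p :: "'i \<Rightarrow> int" and \<epsilon> \<delta>
  where "q > 0" "\<And>i. i \<in> I \<Longrightarrow> real q * u i = of_int (p i) + \<epsilon> i" "\<And>i. i \<in> I \<Longrightarrow> \<bar>\<epsilon> i\<bar> < 1 / N"
    "(\<Sum>i\<in>I. \<epsilon> i *\<^sub>R c i) = (\<delta>, 0)" "\<bar>\<delta>\<bar> \<le> (\<Sum>i\<in>I. norm (c i)) / N"
    "real q *\<^sub>R x = (\<Sum>i\<in>I. of_int (p i) *\<^sub>R c i) + (real q * r + \<delta>, 0)"
proof -
  let ?K = "\<Sum>i\<in>I. norm (c i)"
  have K: "0 \<le> ?K" by (simp add: sum_nonneg)
  have N0: "N > 0" using K N by (cases N) auto
  obtain q :: nat and p :: "'i \<Rightarrow> int" where q: "q > 0" "\<And>i. i \<in> I \<Longrightarrow> \<bar>real q * u i - of_int (p i)\<bar> < 1 / N"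
    using Dirichlet_approx_finite[OF I N0, of u] by blast
  define \<epsilon> where "\<epsilon> i = real q * u i - of_int (p i)" for i
  define d where "d = (\<Sum>i\<in>I. \<epsilon> i *\<^sub>R c i)"
  have "norm d \<le> (\<Sum>i\<in>I. norm (\<epsilon> i *\<^sub>R c i))" unfolding d_def by (rule norm_sum)
  also have "\<dots> \<le> (\<Sum>i\<in>I. 1 / N * norm (c i))"
    unfolding norm_scaleR real_norm_def \<epsilon>_def
    by (intro sum_mono mult_right_mono less_imp_le[OF q(2)]) auto
  also have "\<dots> = ?K / N" by (simp add: sum_distrib_left[symmetric] sum_divide_distrib)
  finally have nd: "norm d \<le> ?K / N" .
  have qx: "real q *\<^sub>R x = (\<Sum>i\<in>I. of_int (p i) *\<^sub>R c i) + (real q * r, 0) + d"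
    by (simp add: eq d_def \<epsilon>_def scaleR_add_right scaleR_sum_right algebra_simps sum_subtractf)
  \<comment> \<open>The exponent part of the error is integral because all the other terms are, and
    \<open>N\<close> is large enough to keep it below 1 in absolute value.\<close>
  have "snd d $ j = 0" for j
  proof -
    have "snd d $ j = real q * snd x $ j - (\<Sum>i\<in>I. of_int (p i) * snd (c i) $ j)"
      using arg_cong[OF qx, of "\<lambda>y. snd y $ j"] by (simp add: snd_sum)
    also have "\<dots> \<in> \<int>"
      using x c by (intro Ints_diff Ints_mult Ints_sum) (auto simp: lattice_vectors_def)
    finally have int: "snd d $ j \<in> \<int>" .
    have "\<bar>snd d $ j\<bar> \<le> norm d"
      using component_le_norm_cart[of "snd d" j] norm_snd_le[of "snd d" "fst d"] by simp
    also have "\<dots> < 1" using nd N N0 by (simp add: divide_less_eq order.strict_trans1)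
    finally show ?thesis using int by (auto elim!: Ints_cases)
  qed
  then obtain \<delta> where d: "d = (\<delta>, 0)" by (metis prod.collapse vec_eq_iff zero_index)
  have "\<bar>\<delta>\<bar> \<le> ?K / N" using norm_fst_le[of \<delta> "snd d"] nd by (simp add: d)
  moreover have "real q *\<^sub>R x = (\<Sum>i\<in>I. of_int (p i) *\<^sub>R c i) + (real q * r + \<delta>, 0)"
    unfolding qx d by (simp add: add.assoc)
  moreover have "real q * u i = of_int (p i) + \<epsilon> i" for i by (simp add: \<epsilon>_def)
  moreover have "\<bar>\<epsilon> i\<bar> < 1 / N" if "i \<in> I" for i using q(2)[OF that] by (simp add: \<epsilon>_def)
  ultimately show thesis
    using that[of q p \<epsilon> \<delta>] q(1) d by (simp add: d_def)
qed

lemma order_cone_integer_combination: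
  assumes C: "order_cone X C" and c: "\<And>i. i \<in> I \<Longrightarrow> c i \<in> C" and x: "x \<in> lattice_vectors X"
    and p: "\<And>i. i \<in> I \<Longrightarrow> 0 \<le> p i" and q: "q > 0" and s: "0 \<le> s"
    and eq: "real q *\<^sub>R x = (\<Sum>i\<in>I. of_int (p i) *\<^sub>R c i) + (s, 0)"
  shows "x \<in> C"
proof (rule order_cone_cancel_scale[OF C x q])
  have "of_int (p i) *\<^sub>R c i \<in> C" if "i \<in> I" for i
    using order_cone_scale[OF C c[OF that], of "nat (p i)"] p[OF that] by simp
  then show "real q *\<^sub>R x \<in> C"
    unfolding eq by (intro order_cone_add[OF C] order_cone_sum[OF C] order_cone_vertical[OF C s])
qed

text \<open>Approximating the coefficients perturbs the first coordinate by some \<open>\<delta>\<close>. A positive slack \<open>r\<close>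
  absorbs it; if \<open>r = 0\<close> and \<open>\<delta> < 0\<close>, adding the approximation errors to the coefficients creates a
  positive slack.\<close>

lemma order_cone_real_combination:
  fixes u :: "'i \<Rightarrow> real"
  assumes C: "order_cone X C" and I: "finite I" and c: "\<And>i. i \<in> I \<Longrightarrow> c i \<in> C"
    and u: "\<And>i. i \<in> I \<Longrightarrow> 0 \<le> u i" and r: "0 \<le> r" and x: "x \<in> lattice_vectors X"
    and eq: "x = (\<Sum>i\<in>I. u i *\<^sub>R c i) + (r, 0)"
  shows "x \<in> C"
proof -
  \<comment> \<open>A zero coefficient has no room for an approximation error, whereas a positive
    one stays nonnegative after rounding once \<open>N\<close> is large.\<close>
  define J where "J = {i \<in> I. 0 < u i}"
  have J: "finite J" "\<And>i. i \<in> J \<Longrightarrow> c i \<in> C" "\<And>i. i \<in> J \<Longrightarrow> 0 < u i"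
    using I c by (auto simp: J_def)
  have L: "c i \<in> lattice_vectors X" if "i \<in> J" for i
    using J(2)[OF that] order_cone_subset[OF C] by blast
  have "(\<Sum>i\<in>I. u i *\<^sub>R c i) = (\<Sum>i\<in>J. u i *\<^sub>R c i)"
    using I u by (intro sum.mono_neutral_right) (force simp: J_def)+
  then have eqJ: "x = (\<Sum>i\<in>J. u i *\<^sub>R c i) + (r, 0)" using eq by simp
  let ?K = "\<Sum>i\<in>J. norm (c i)"
  \<comment> \<open>The three bounds on \<open>N\<close> make the exponents exact, keep the vertical
    error below the slack \<open>t\<close>, and keep the rounded coefficients nonnegative.\<close>
  have large: "\<exists>N::nat. ?K < N \<and> ?K / t < N \<and> (\<forall>i\<in>J. 1 / N < v i)"
    if "t > 0" and v: "\<And>i. i \<in> J \<Longrightarrow> 0 < v i" for t and v :: "'i \<Rightarrow> real"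
  proof -
    obtain N :: nat where N: "?K + ?K / t + (\<Sum>i\<in>J. 1 / v i) + 1 < N" using reals_Archimedean2 by blast
    have nn: "0 \<le> ?K" "0 \<le> ?K / t" "0 \<le> (\<Sum>i\<in>J. 1 / v i)"
      using that by (simp_all add: sum_nonneg less_imp_le)
    have "1 / N < v i" if i: "i \<in> J" for i
    proof -
      have "1 / v i \<le> (\<Sum>i\<in>J. 1 / v i)"
        using J(1) i v by (intro member_le_sum) (auto intro: less_imp_le)
      then have "1 / v i < N" using N nn by linarith
      then show ?thesis using v[OF i] nn N by (simp add: field_simps)
    qed
    then show ?thesis using N nn by (intro exI[of _ N]) auto
  qed
  have coeff_nonneg: "0 \<le> p" if "real q * v = of_int p + e" "\<bar>e\<bar> < 1 / N" "1 / N < v" "0 < q"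
    for q N :: nat and v e and p :: int
  proof -
    have "0 \<le> 1 / real N" by simp
    then have "0 < v" using that(3) by linarith
    then have "v \<le> real q * v" using that(4) by (simp add: mult_le_cancel_right1)
    then have "0 < real_of_int p" using that by linarith
    then show ?thesis by simp
  qed
  have slack: "x \<in> C" if vpos: "\<And>i. i \<in> J \<Longrightarrow> 0 < v i" and s: "0 < s"
    and eqv: "x = (\<Sum>i\<in>J. v i *\<^sub>R c i) + (s, 0)" for v s
  proof -
    obtain N :: nat where N: "?K < N" "?K / s < N" "\<forall>i\<in>J. 1 / N < v i" using large[OF s, of v] vpos by blast
    obtain q :: nat and p \<epsilon> \<delta> where q: "q > 0" "\<And>i. i \<in> J \<Longrightarrow> real q * v i = of_int (p i) + \<epsilon> i"
      "\<And>i. i \<in> J \<Longrightarrow> \<bar>\<epsilon> i\<bar> < 1 / N" "(\<Sum>i\<in>J. \<epsilon> i *\<^sub>R c i) = (\<delta>, 0)" "\<bar>\<delta>\<bar> \<le> ?K / N"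
      "real q *\<^sub>R x = (\<Sum>i\<in>J. of_int (p i) *\<^sub>R c i) + (real q * s + \<delta>, 0)"
      by (rule lattice_combination_approx[OF J(1) L x eqv N(1)]) (assumption, rule that, assumption+)
    have "0 \<le> ?K" by (simp add: sum_nonneg)
    then have "?K / N < s" using N s by (simp add: field_simps)
    moreover have "s \<le> real q * s" using q(1) s by (simp add: mult_le_cancel_right1)
    ultimately have "0 \<le> real q * s + \<delta>" using q(5) by linarith
    moreover have "0 \<le> p i" if "i \<in> J" for i
      using coeff_nonneg q(1) q(2,3)[OF that] N(3) that by blast
    ultimately show ?thesis
      using order_cone_integer_combination[OF C J(2) x _ q(1) _ q(6)] by blast
  qed
  show ?thesis
  proof (cases "r > 0")
    case True
    then show ?thesis using slack[OF J(3) _ eqJ] by blast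
  next
    case False
    then have r0: "r = 0" using r by simp
    obtain N :: nat where N: "?K < N" "\<forall>i\<in>J. 1 / N < u i" using large[OF zero_less_one, of u] J(3) by auto
    obtain q :: nat and p \<epsilon> \<delta> where q: "q > 0" "\<And>i. i \<in> J \<Longrightarrow> real q * u i = of_int (p i) + \<epsilon> i"
      "\<And>i. i \<in> J \<Longrightarrow> \<bar>\<epsilon> i\<bar> < 1 / N" "(\<Sum>i\<in>J. \<epsilon> i *\<^sub>R c i) = (\<delta>, 0)" "\<bar>\<delta>\<bar> \<le> ?K / N"
      "real q *\<^sub>R x = (\<Sum>i\<in>J. of_int (p i) *\<^sub>R c i) + (real q * r + \<delta>, 0)"
      by (rule lattice_combination_approx[OF J(1) L x eqJ N(1)]) (assumption, rule that, assumption+)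
    show ?thesis
    proof (cases "\<delta> \<ge> 0")
      case True
      have "0 \<le> p i" if "i \<in> J" for i
        using coeff_nonneg q(1) q(2,3)[OF that] N(2) that by blast
      then show ?thesis
        using order_cone_integer_combination[OF C J(2) x _ q(1) _ q(6)] True r0 by simp
    next
      case False
      have "0 < u i + \<epsilon> i" if "i \<in> J" for i
        using q(3)[OF that] N(2) that by fastforce
      moreover have "x = (\<Sum>i\<in>J. (u i + \<epsilon> i) *\<^sub>R c i) + (- \<delta>, 0)"
        using q(4) eqJ r0 by (simp add: scaleR_add_left sum.distrib flip: zero_prod_def)
      ultimately show ?thesis using slack[of "\<lambda>i. u i + \<epsilon> i" "- \<delta>"] False by simp
    qed
  qed
qed

text \<open>A convex combination equal to 0 can be solved for \<open>- v\<close>, where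
  \<open>v\<close> has positive weight. This exhibits \<open>- v\<close> as a nonnegative real
  combination of elements of \<open>C\<close>, contradicting strictness.\<close>

lemma zero_notin_hull_strict:
  assumes C: "order_cone X C" and S: "\<And>y. y \<in> S \<Longrightarrow> y \<in> C \<and> - y \<notin> C"
  shows "0 \<notin> convex hull S"
proof
  assume "0 \<in> convex hull S"
  then obtain F u where F: "finite F" "F \<subseteq> S" "\<forall>v\<in>F. 0 \<le> u v" "sum u F = 1" "(\<Sum>v\<in>F. u v *\<^sub>R v) = 0"
    unfolding convex_hull_explicit by blast
  obtain v where v: "v \<in> F" "u v > 0"
  proof -
    have "\<not> (\<forall>v\<in>F. u v \<le> 0)" using F(4) sum_nonpos[of F u] by auto
    then show thesis using that by force
  qed
  have "(\<Sum>w\<in>F - {v}. u w *\<^sub>R w) = - (u v *\<^sub>R v)"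
    using F(1,5) v(1) by (simp add: sum.remove add_eq_0_iff)
  then have "(1 / u v) *\<^sub>R (\<Sum>w\<in>F - {v}. u w *\<^sub>R w) = - v"
    using v(2) by simp
  then have "- v = (\<Sum>w\<in>F - {v}. (u w / u v) *\<^sub>R w) + (0, 0)"
    by (simp add: scaleR_sum_right divide_inverse mult.commute flip: zero_prod_def)
  then have eq: "- v = (\<Sum>w\<in>F - {v}. (u w / u v) *\<^sub>R w) + (0, 0)" .
  have FC: "w \<in> C" if "w \<in> F" for w using S F(2) that by blast
  have "- v \<in> lattice_vectors X"
    by (rule lattice_vectors_closed(3)[OF subsetD[OF order_cone_subset[OF C] FC[OF v(1)]]])
  moreover have "0 \<le> u w / u v" if "w \<in> F - {v}" for w using F(3) v(2) that by simp
  ultimately have "- v \<in> C"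
    using order_cone_real_combination[OF C _ _ _ order_refl _ eq] F(1) FC by simp
  then show False using S F(2) v(1) by blast
qed

section \<open>Every order cone is the cone of a matrix\<close>

text \<open>Relativising to a subspace lets the induction continue on the kernel of the row just
  found. The second conjunct is the nondegeneracy that t-admissibility asks of each row.\<close>

lemma order_cone_rows:
  fixes C :: "(real \<times> (real ^ 'v::finite)) set"
  assumes C: "order_cone X C" and W: "subspace W"
  shows "\<exists>l w. (\<forall>y\<in>lattice_vectors X \<inter> W. y \<in> C \<longleftrightarrow> lex_nonneg l (\<lambda>i. w i \<bullet> y)) \<and>
    (\<forall>i<l. \<exists>v\<in>lattice_vectors X \<inter> W. first_nonzero (\<lambda>i. w i \<bullet> v) i)"
  using W
proof (induction "dim W" arbitrary: W rule: less_induct)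
  case less
  show ?case
  proof (cases "lattice_vectors X \<inter> W \<subseteq> C")
    case True
    then show ?thesis by (intro exI[of _ 0]) auto
  next
    case False
    then obtain x where x: "x \<in> lattice_vectors X" "x \<in> W" "x \<notin> C" by blast
    define S where "S = {y \<in> C \<inter> W. - y \<notin> C}"
    have xS: "- x \<in> S"
      using x order_cone_total[OF C] subspace_neg[OF less.prems] by (auto simp: S_def)
    have "0 \<notin> convex hull S"
      by (rule zero_notin_hull_strict[OF C]) (simp add: S_def)
    moreover have "convex hull S \<noteq> {}" using xS by auto
    \<comment> \<open>Choosing \<open>a\<close> in the span puts it into \<open>W\<close> and
      prevents it from vanishing on all of \<open>S\<close>, since it would then be orthogonal to
      itself.\<close>
    ultimately obtain a where a: "a \<in> span (convex hull S)" "a \<noteq> 0" "\<And>y. y \<in> convex hull S \<Longrightarrow> 0 \<le> a \<bullet> y"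
      using separating_hyperplane_set_0_inspan[OF convex_convex_hull] by metis
    have hull_sub: "a \<in> V" if "subspace V" "S \<subseteq> V" for V
    proof -
      have "convex hull S \<subseteq> V" using that by (intro hull_minimal subspace_imp_convex)
      then show ?thesis using a(1) that(1) span_minimal by blast
    qed
    have aW: "a \<in> W" using hull_sub[OF less.prems] by (auto simp: S_def)
    have "\<not> S \<subseteq> {y. a \<bullet> y = 0}"
      using hull_sub[OF subspace_hyperplane, of a] a(2) by auto
    then obtain v where v: "v \<in> S" "a \<bullet> v \<noteq> 0" by auto
    have aS: "0 \<le> a \<bullet> y" if "y \<in> S" for y
      using a(3) that hull_inc by metis
    \<comment> \<open>Separation controls the sign on \<open>S\<close> only. If \<open>y\<close> and
      \<open>- y\<close> are both in \<open>C\<close>, then \<open>- x\<close> plus any multiple of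
      \<open>y\<close> stays in \<open>S\<close>, so \<open>a \<bullet> y\<close> cannot be
      negative.\<close>
    have aC: "0 \<le> a \<bullet> y" if y: "y \<in> C" "y \<in> W" for y
    proof (cases "- y \<in> C")
      case False then show ?thesis using aS y by (simp add: S_def)
    next
      case True
      have "0 \<le> a \<bullet> (- x) + real m * (a \<bullet> y)" for m :: nat
      proof -
        have my: "real m *\<^sub>R y \<in> C" by (rule order_cone_scale[OF C y(1)])
        have "- x \<in> C" using xS by (simp add: S_def)
        then have "- x + real m *\<^sub>R y \<in> C" by (rule order_cone_add[OF C _ my])
        moreover have "- (- x + real m *\<^sub>R y) \<notin> C"
          using order_cone_add[OF C my, of "- (- x + real m *\<^sub>R y)"] x(3) by auto
        moreover have "- x + real m *\<^sub>R y \<in> W"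
          using x y less.prems by (intro subspace_add subspace_neg subspace_scale)
        ultimately have "- x + real m *\<^sub>R y \<in> S" by (simp add: S_def)
        from aS[OF this] show ?thesis by (simp add: inner_add_right inner_diff_right)
      qed
      moreover obtain m :: nat where "a \<bullet> (- x) < real m * - (a \<bullet> y)" if "a \<bullet> y < 0"
        using ex_less_of_nat_mult[of "- (a \<bullet> y)" "a \<bullet> (- x)"] by (meson neg_0_less_iff_less)
      ultimately show ?thesis by (smt (verit, best) mult_minus_right)
    qed
    define W' where "W' = W \<inter> {y. a \<bullet> y = 0}"
    have W': "subspace W'"
      unfolding W'_def by (rule subspace_inter[OF less.prems subspace_hyperplane])
    have "a \<notin> W'" using a(2) by (simp add: W'_def)
    moreover have "W' \<subseteq> W" by (simp add: W'_def)
    ultimately have "W' \<subset> W" using aW by blast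
    then have "dim W' < dim W"
      by (intro dim_psubset)
        (simp only: span_eq_iff[THEN iffD2, OF W'] span_eq_iff[THEN iffD2, OF less.prems])
    from less.hyps[OF this W'] obtain l w where
      IH: "\<And>y. y \<in> lattice_vectors X \<inter> W' \<Longrightarrow> y \<in> C \<longleftrightarrow> lex_nonneg l (\<lambda>i. w i \<bullet> y)"
        "\<And>i. i < l \<Longrightarrow> \<exists>v\<in>lattice_vectors X \<inter> W'. first_nonzero (\<lambda>i. w i \<bullet> v) i"
      by (elim exE conjE) blast
    define w' where "w' = case_nat a w"
    have w': "w' 0 = a" "w' (Suc i) = w i" for i by (simp_all add: w'_def)
    have "y \<in> C \<longleftrightarrow> lex_nonneg (Suc l) (\<lambda>i. w' i \<bullet> y)" if y: "y \<in> lattice_vectors X \<inter> W" for y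
    proof -
      have neg: "y \<in> C \<or> - y \<in> C" "- y \<in> W"
        using y order_cone_total[OF C, of y] subspace_neg[OF less.prems, of y] by blast+
      have "y \<in> C" if "0 < a \<bullet> y" using neg aC[of "- y"] that by fastforce
      moreover have "y \<notin> C" if "a \<bullet> y < 0" using aC[of y] y that by auto
      moreover have "y \<in> C \<longleftrightarrow> lex_nonneg l (\<lambda>i. w i \<bullet> y)" if "a \<bullet> y = 0"
        using IH(1)[of y] y that by (simp add: W'_def)
      ultimately show ?thesis
        using linorder_less_linear[of "a \<bullet> y" 0] by (auto simp: lex_nonneg_Suc w')
    qed
    moreover have "\<exists>v\<in>lattice_vectors X \<inter> W. first_nonzero (\<lambda>i. w' i \<bullet> v) i" if "i < Suc l" for i
    proof (cases i)
      case 0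
      have "v \<in> lattice_vectors X \<inter> W" using v(1) order_cone_subset[OF C] unfolding S_def by blast
      then show ?thesis using v(2) 0 by (intro bexI[of _ v]) (simp_all add: first_nonzero_def w')
    next
      case (Suc j)
      then have "j < l" using that by simp
      then obtain v' where "v' \<in> lattice_vectors X \<inter> W'" "first_nonzero (\<lambda>i. w i \<bullet> v') j"
        using IH(2) by blast
      then have "v' \<in> lattice_vectors X \<inter> W" "first_nonzero (\<lambda>i. w' i \<bullet> v') (Suc j)"
        by (simp_all add: first_nonzero_Suc w' W'_def)
      then show ?thesis unfolding Suc by (rule bexI[rotated])
    qed
    ultimately show ?thesis by (intro exI[of _ "Suc l"] exI[of _ w'] conjI ballI allI impI) auto
  qed
qed

lemma order_cone_matrix:
  assumes C: "order_cone X C"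
  obtains l U where "t_admissible X l U" "C = matrix_cone X l U"
proof -
  have "subspace (vectors X)"
    by (auto simp: subspace_def vectors_def)
  moreover have "lattice_vectors X \<inter> vectors X = lattice_vectors X"
    by (auto simp: lattice_vectors_def)
  ultimately obtain l w where w: "\<And>y. y \<in> lattice_vectors X \<Longrightarrow> y \<in> C \<longleftrightarrow> lex_nonneg l (\<lambda>i. w i \<bullet> y)"
    "\<And>i. i < l \<Longrightarrow> \<exists>v\<in>lattice_vectors X. first_nonzero (\<lambda>i. w i \<bullet> v) i"
    using order_cone_rows[OF C, of "vectors X"] by auto
  define U where "U i a = (case a of None \<Rightarrow> fst (w i) | Some j \<Rightarrow> snd (w i) $ j)" for i a
  have app: "mat_app X U y = (\<lambda>i. w i \<bullet> y)" if "y \<in> lattice_vectors X" for y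
  proof
    fix i
    have "(\<Sum>j\<in>X. snd (w i) $ j * snd y $ j) = (\<Sum>j\<in>UNIV. snd (w i) $ j * snd y $ j)"
      using that by (intro sum.mono_neutral_left) (auto simp: lattice_vectors_def vectors_def)
    then show "mat_app X U y i = w i \<bullet> y"
      by (simp add: mat_app_def U_def inner_prod_def inner_vec_def)
  qed
  have "lex_nonneg l (mat_app X U (1, 0))"
    using order_cone_vertical[OF C, of 1] w(1)[of "(1, 0)"] app[of "(1, 0)"] by simp
  then have "lex_nonneg l (\<lambda>i. U i None)"
    by (simp add: mat_app_vertical[abs_def])
  moreover have "\<forall>i<l. \<exists>v\<in>lattice_vectors X. first_nonzero (mat_app X U v) i"
    using w(2) app by metis
  ultimately have "t_admissible X l U" by (simp add: t_admissible_def)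
  moreover have "C = matrix_cone X l U"
    using w(1) app order_cone_subset[OF C] unfolding matrix_cone_def by auto
  ultimately show thesis using that by blast
qed

section \<open>Newton polytopes\<close>

lemma compact_newt: "compact (newt f)"
  unfolding newt_eq_hull_supp by (intro finite_imp_compact_convex_hull finite_supp)

text \<open>The vertical line through \<open>p\<close> meets the compact polytope in a compact set,
  whose top lies on the hat.\<close>

lemma newt_below_hat:
  assumes "p \<in> newt f"
  shows "\<exists>r\<ge>0. p + (r, 0) \<in> newt_hat f"
proof -
  let ?S = "{z. (z, snd p) \<in> newt f}"
  have "?S = fst ` (newt f \<inter> (UNIV \<times> {snd p}))" by force
  moreover have "compact (newt f \<inter> (UNIV \<times> {snd p}))"
    by (intro compact_Int_closed compact_newt closed_Times) auto
  then have "compact (fst ` (newt f \<inter> (UNIV \<times> {snd p})))"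
    by (intro compact_continuous_image continuous_on_fst continuous_on_id)
  ultimately have "compact ?S" by simp
  moreover have p: "fst p \<in> ?S" using assms by simp
  ultimately obtain z where z: "z \<in> ?S" "\<forall>t\<in>?S. t \<le> z"
    using compact_attains_sup[of ?S] by (metis empty_iff)
  have "fst p \<le> z" using z(2) p by blast
  moreover have "(z, snd p) \<in> newt_hat f"
    using z unfolding newt_hat_def by (auto simp: not_less[symmetric])
  ultimately show ?thesis
    by (intro exI[of _ "z - fst p"]) (cases p, simp)
qed

lemma newt_hat_subset: "newt_hat f \<subseteq> newt f"
  by (auto simp: newt_hat_def)

text \<open>Some point above \<open>p\<close> is a convex combination of points of \<open>g\<close>.
  If \<open>p\<close> exceeded all of these, solving for one with positive weight would write
  \<open>q - p\<close> as a nonnegative real combination of the differences \<open>p - w\<close> and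
  an upward vector, which puts it in \<open>C\<close>.\<close>

lemma dominated_if_hat_subset:
  assumes C: "order_cone X C" and f: "f \<in> laurent X" and g: "g \<in> laurent X"
    and hat: "newt_hat f \<subseteq> newt_hat g"
  shows "dominated C (supp f) (supp g)"
  unfolding dominated_def
proof
  fix p assume p: "p \<in> supp f"
  have "p \<in> newt f" using p unfolding newt_eq_hull_supp by (rule hull_inc)
  then obtain r where r: "r \<ge> 0" "p + (r, 0) \<in> newt g"
    using newt_below_hat[of p f] hat newt_hat_subset[of g] by blast
  obtain u where u: "\<And>q. q \<in> supp g \<Longrightarrow> 0 \<le> u q" "sum u (supp g) = 1"
    "(\<Sum>q\<in>supp g. u q *\<^sub>R q) = p + (r, 0)"
    using r(2) unfolding newt_eq_hull_supp convex_hull_finite[OF finite_supp] by blast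
  have L: "q - p \<in> lattice_vectors X" if "q \<in> supp g" for q
    using that p f g unfolding laurent_iff_supp by blast
  obtain q where q: "q \<in> supp g" "u q > 0"
  proof -
    have "\<not> (\<forall>q\<in>supp g. u q \<le> 0)" using u(2) sum_nonpos[of "supp g" u] by auto
    then show thesis using that by force
  qed
  show "\<exists>q\<in>supp g. q - p \<in> C"
  proof (rule ccontr)
    assume no: "\<not> (\<exists>q\<in>supp g. q - p \<in> C)"
    have pos: "p - w \<in> C" if "w \<in> supp g" for w
      using order_cone_total[OF C L[OF that]] no that by auto
    have "(\<Sum>w\<in>supp g. u w *\<^sub>R (w - p)) = (r, 0)"
      by (simp add: scaleR_diff_right sum_subtractf u(2,3) flip: scaleR_sum_left)
    then have "u q *\<^sub>R (q - p) = (\<Sum>w\<in>supp g - {q}. u w *\<^sub>R (p - w)) + (r, 0)"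
      using q(1) by (simp add: sum.remove sum_subtractf scaleR_diff_right algebra_simps)
    then have "(1 / u q) *\<^sub>R (u q *\<^sub>R (q - p)) =
        (1 / u q) *\<^sub>R ((\<Sum>w\<in>supp g - {q}. u w *\<^sub>R (p - w)) + (r, 0))" by simp
    then have eq: "q - p = (\<Sum>w\<in>supp g - {q}. (u w / u q) *\<^sub>R (p - w)) + (r / u q, 0)"
      using q(2) by (simp add: scaleR_add_right scaleR_sum_right divide_inverse mult.commute)
    have "q - p \<in> C"
      using order_cone_real_combination[OF C _ _ _ _ L[OF q(1)] eq] pos u(1) q(2) r(1) by simp
    then show False using no q(1) by blast
  qed
qed

lemma order_cone_halfspace:
  assumes "0 \<le> fst w"
  shows "order_cone X {y \<in> lattice_vectors X. 0 \<le> w \<bullet> y}"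
  unfolding order_cone_def
proof (intro conjI ballI allI impI)
  fix x y assume "x \<in> {y \<in> lattice_vectors X. 0 \<le> w \<bullet> y}" "y \<in> {y \<in> lattice_vectors X. 0 \<le> w \<bullet> y}"
  then show "x + y \<in> {y \<in> lattice_vectors X. 0 \<le> w \<bullet> y}"
    by (simp add: lattice_vectors_closed inner_add_right)
next
  fix x assume "x \<in> lattice_vectors X"
  then show "x \<in> {y \<in> lattice_vectors X. 0 \<le> w \<bullet> y} \<or> - x \<in> {y \<in> lattice_vectors X. 0 \<le> w \<bullet> y}"
    by (simp add: lattice_vectors_closed linear)
next
  fix r :: real assume "0 \<le> r"
  then show "(r, 0) \<in> {y \<in> lattice_vectors X. 0 \<le> w \<bullet> y}"
    using assms by (simp add: inner_prod_def)
qed simp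

text \<open>If some point of \<open>f\<close> lies outside the downward closure of the Newton polytope of \<open>g\<close>, a
  separating functional has nonnegative first coordinate and hence defines an order cone.\<close>

lemma newt_subset_down_if_dominated:
  assumes f: "f \<in> laurent X" and g: "g \<in> laurent X"
    and dom: "\<And>C. order_cone X C \<Longrightarrow> dominated C (supp f) (supp g)"
  shows "newt f \<subseteq> {y - (r, 0) | y r. y \<in> newt g \<and> 0 \<le> r}"
proof -
  \<comment> \<open>Writing the downward closure as the Minkowski sum of a compact convex set and a
    closed convex ray makes it closed and convex, as strict separation requires.\<close>
  let ?R = "{r::real. r \<le> 0} \<times> {0 :: real ^ 'a}"
  let ?D = "{y + z | y z. y \<in> newt g \<and> z \<in> ?R}"
  have D: "{y - (r, 0) | y r. y \<in> newt g \<and> 0 \<le> r} = ?D"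
  proof (intro equalityI subsetI)
    fix x assume "x \<in> {y - (r, 0) | y r. y \<in> newt g \<and> 0 \<le> r}"
    then obtain y r where "x = y + (- r, 0)" "y \<in> newt g" "0 \<le> r" by auto
    then show "x \<in> ?D" by (intro CollectI exI[of _ y] exI[of _ "(- r, 0)"]) auto
  next
    fix x assume "x \<in> ?D"
    then obtain y r where "x = y - (- r, 0)" "y \<in> newt g" "r \<le> 0" by auto
    then show "x \<in> {y - (r, 0) | y r. y \<in> newt g \<and> 0 \<le> r}"
      by (intro CollectI exI[of _ y] exI[of _ "- r"]) auto
  qed
  have closedR: "closed ?R"
    by (intro closed_Times) (auto simp flip: atMost_def)
  have convexR: "convex ?R"
    by (intro convex_Times) (auto simp flip: atMost_def)
  have convexD: "convex ?D"
  proof -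
    have "?D = (\<Union>y\<in>newt g. \<Union>z\<in>?R. {y + z})" by blast
    then show ?thesis using convex_sums[OF _ convexR, of "newt g"]
      by (simp add: newt_eq_hull_supp convex_convex_hull)
  qed
  have closedD: "closed ?D"
  proof -
    have "?D = (\<Union>y\<in>newt g. \<Union>z\<in>?R. {y + z})" by blast
    then show ?thesis using compact_closed_sums[OF compact_newt closedR, of g] by simp
  qed
  have "supp f \<subseteq> ?D"
  proof
    fix p assume p: "p \<in> supp f"
    show "p \<in> ?D"
    proof (rule ccontr)
      assume "p \<notin> ?D"
      then obtain a b where ab: "a \<bullet> p < b" "\<forall>x\<in>?D. a \<bullet> x > b"
        using separating_hyperplane_closed_point[OF convexD closedD] by blast
      \<comment> \<open>Domination for the trivial cone only says that the support of
        \<open>g\<close> is nonempty.\<close>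
      obtain q0 where q0: "q0 \<in> supp g"
      proof -
        have "order_cone X (lattice_vectors X)"
          by (auto simp: order_cone_def)
        from dom[OF this] p that show thesis unfolding dominated_def by blast
      qed
      have in_newt: "q \<in> newt g" if "q \<in> supp g" for q
        using that unfolding newt_eq_hull_supp by (rule hull_inc)
      have shift: "b < a \<bullet> q - r * fst a" if "q \<in> supp g" "0 \<le> r" for q r
      proof -
        have "q + (- r, 0) \<in> ?D" 
          using in_newt[OF that(1)] that(2) by (intro CollectI exI[of _ q] exI[of _ "(- r, 0)"]) auto
        then have "b < a \<bullet> (q + (- r, 0))" using ab(2) by blast
        then show ?thesis by (simp add: inner_add_right inner_prod_def algebra_simps)
      qed
      \<comment> \<open>Otherwise moving \<open>q0\<close> down by
        \<open>(a \<bullet> q0 - b) / fst a\<close> would bring the functional down to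
        \<open>b\<close>.\<close>
      have "fst a \<le> 0"
      proof (rule ccontr)
        assume pos: "\<not> fst a \<le> 0"
        have "0 \<le> (a \<bullet> q0 - b) / fst a" using shift[OF q0, of 0] pos by simp
        from shift[OF q0 this] pos show False by simp
      qed
      then have "order_cone X {y \<in> lattice_vectors X. 0 \<le> (- a) \<bullet> y}"
        by (intro order_cone_halfspace) simp
      from dom[OF this] p obtain q where "q \<in> supp g" "0 \<le> (- a) \<bullet> (q - p)"
        unfolding dominated_def by blast
      then show False using shift[of q 0] ab(1) by (simp add: inner_diff_right)
    qed
  qed
  then have "newt f \<subseteq> ?D"
    unfolding newt_eq_hull_supp[of f] using convexD by (rule hull_minimal)
  then show ?thesis using D by simp
qed

text \<open>Going up from a hat point of \<open>f\<close> into the polytope of \<open>g\<close> and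
  then up again into that of \<open>f\<close> cannot gain height, so the first move is zero.\<close>

lemma newt_hat_subset_if_down:
  assumes fg: "newt f \<subseteq> {y - (r, 0) | y r. y \<in> newt g \<and> 0 \<le> r}"
    and gf: "newt g \<subseteq> {y - (r, 0) | y r. y \<in> newt f \<and> 0 \<le> r}"
  shows "newt_hat f \<subseteq> newt_hat g"
proof
  fix x assume x: "x \<in> newt_hat f"
  obtain x0 x1 where x01: "x = (x0, x1)" by (cases x)
  have xf: "(x0, x1) \<in> newt f" "\<And>z. z > x0 \<Longrightarrow> (z, x1) \<notin> newt f"
    using x by (auto simp: x01 newt_hat_def)
  have down: "\<exists>r\<ge>0. (z + r, x1) \<in> newt h"
    if sub: "newt h' \<subseteq> {y - (r, 0) | y r. y \<in> newt h \<and> 0 \<le> r}" and z: "(z, x1) \<in> newt h'" for h h' z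
  proof -
    obtain y r where y: "(z, x1) = y - (r, 0)" "y \<in> newt h" "0 \<le> r" using subsetD[OF sub z] by blast
    have "y = (z + r, x1)" using y(1) by (cases y) auto
    then show ?thesis using y by blast
  qed
  obtain r where r: "r \<ge> 0" "(x0 + r, x1) \<in> newt g" using down[OF fg xf(1)] by blast
  obtain s where s: "s \<ge> 0" "(x0 + r + s, x1) \<in> newt f" using down[OF gf r(2)] by blast
  have "r = 0" using xf(2)[of "x0 + r + s"] r s by (cases "x0 < x0 + r + s") auto
  then have "(x0, x1) \<in> newt g" using r by simp
  moreover have "(z, x1) \<notin> newt g" if "z > x0" for z
  proof
    assume "(z, x1) \<in> newt g"
    then obtain t where "t \<ge> 0" "(z + t, x1) \<in> newt f" using down[OF gf] by blast
    then show False using xf(2)[of "z + t"] that by simp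
  qed
  ultimately show "x \<in> newt_hat g" by (simp add: x01 newt_hat_def)
qed

lemma newt_hat_eq_iff_all_cones:
  assumes A: "A \<subseteq> laurent X" and f: "f \<in> A" and g: "g \<in> A"
  shows "(\<forall>C. order_cone X C \<longrightarrow> (f, g) \<in> cone_congruence A X C) \<longleftrightarrow> newt_hat f = newt_hat g"
proof
  have L: "f \<in> laurent X" "g \<in> laurent X" using assms by auto
  assume "\<forall>C. order_cone X C \<longrightarrow> (f, g) \<in> cone_congruence A X C"
  then have dom: "dominated C (supp f) (supp g)" "dominated C (supp g) (supp f)" if "order_cone X C" for C
    using that unfolding cone_congruence_iff[OF A] by blast+
  note down = newt_subset_down_if_dominated[OF L dom(1)] newt_subset_down_if_dominated[OF L(2,1) dom(2)]
  show "newt_hat f = newt_hat g"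
    using newt_hat_subset_if_down down by (intro equalityI) blast+
next
  have L: "f \<in> laurent X" "g \<in> laurent X" using assms by auto
  assume "newt_hat f = newt_hat g"
  then show "\<forall>C. order_cone X C \<longrightarrow> (f, g) \<in> cone_congruence A X C"
    using dominated_if_hat_subset L f g unfolding cone_congruence_iff[OF A] by blast
qed

section \<open>Dimension\<close>

text \<open>Since \<open>real m *\<^sub>R x - y \<notin> C\<close> says that \<open>m\<close> copies
  of \<open>x\<close> stay strictly below \<open>y\<close>, these are strictly positive elements in
  increasing archimedean classes.\<close>

definition arch_chain ::
    "'v::finite set \<Rightarrow> (real \<times> (real ^ 'v)) set \<Rightarrow> (real \<times> (real ^ 'v)) list \<Rightarrow> bool" where
  "arch_chain Y C gs \<longleftrightarrow> set gs \<subseteq> lattice_vectors Y \<and> (\<forall>g\<in>set gs. - g \<notin> C) \<and>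
     sorted_wrt (\<lambda>x y. \<forall>m::nat. real m *\<^sub>R x - y \<notin> C) gs"

text \<open>If \<open>g\<close> were a real combination of earlier elements, rounding its
  coefficients up and replacing each element by the largest one, \<open>x0\<close>, would bound
  \<open>g\<close> by a multiple of \<open>x0\<close>.\<close>

lemma arch_chain_independent:
  assumes C: "order_cone Y C" and "arch_chain Y C gs"
  shows "distinct gs \<and> independent (set gs)"
  using assms(2)
proof (induction gs rule: rev_induct)
  case Nil
  then show ?case by (simp add: independent_empty)
next
  case (snoc g xs)
  have sub: "set xs \<subseteq> lattice_vectors Y" "g \<in> lattice_vectors Y"
    and pos: "\<And>x. x \<in> set xs \<Longrightarrow> - x \<notin> C" "- g \<notin> C"
    and sorted: "sorted_wrt (\<lambda>x y. \<forall>m::nat. real m *\<^sub>R x - y \<notin> C) xs"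
    and last: "\<And>x m. x \<in> set xs \<Longrightarrow> real m *\<^sub>R x - g \<notin> C"
    using snoc.prems by (auto simp: arch_chain_def sorted_wrt_append)
  have IH: "distinct xs" "independent (set xs)"
    using snoc.IH sub(1) pos(1) sorted by (auto simp: arch_chain_def)
  have xC: "x \<in> C" if "x \<in> set xs" for x
    using order_cone_total[OF C, of "- x"] pos(1)[OF that] sub(1) that by auto
  have "g \<notin> span (set xs)"
  proof
    assume g: "g \<in> span (set xs)"
    have "xs \<noteq> []" using g pos(2) order_cone_zero[OF C] by auto
    define x0 where "x0 = List.last xs"
    have x0: "x0 \<in> set xs" using \<open>xs \<noteq> []\<close> by (simp add: x0_def)
    have max: "x0 - x \<in> C" if x: "x \<in> set xs" for x
    proof (cases "x = x0")
      case False
      have eq: "xs = butlast xs @ [x0]" using \<open>xs \<noteq> []\<close> by (simp add: x0_def)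
      have "x \<in> set (butlast xs)"
        using x False by (subst (asm) eq) simp
      moreover have "sorted_wrt (\<lambda>x y. \<forall>m::nat. real m *\<^sub>R x - y \<notin> C) (butlast xs @ [x0])"
        using sorted eq by simp
      ultimately have "real 1 *\<^sub>R x - x0 \<notin> C"
        unfolding sorted_wrt_append by fastforce
      then have "- (x - x0) \<in> C"
        using order_cone_total[OF C, of "x - x0"] sub(1) x x0 by auto
      then show ?thesis by simp
    qed (simp add: order_cone_zero[OF C])
    obtain r where r: "g = (\<Sum>x\<in>set xs. r x *\<^sub>R x)"
      using g span_finite[of "set xs"] by auto
    \<comment> \<open>Integer upper bounds make \<open>y\<close> a lattice vector and a nonnegative
      real combination of elements of \<open>C\<close> at once.\<close>
    define m where "m x = nat \<lceil>\<bar>r x\<bar>\<rceil>" for x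
    have m: "r x \<le> real (m x)" for x
      unfolding m_def by (meson abs_ge_self order_trans real_nat_ceiling_ge)
    define y where "y = (\<Sum>x\<in>set xs. real (m x) *\<^sub>R x) - g"
    have yL: "y \<in> lattice_vectors Y"
      unfolding y_def using sub
      by (intro lattice_vectors_closed(2) lattice_vectors_sum lattice_vectors_scale) auto
    have yeq: "y = (\<Sum>x\<in>set xs. (real (m x) - r x) *\<^sub>R x) + (0, 0)"
      by (simp add: y_def r scaleR_diff_left sum_subtractf flip: zero_prod_def)
    have "y \<in> C"
      using order_cone_real_combination[OF C _ _ _ order_refl yL yeq] xC m by simp
    moreover have "(\<Sum>x\<in>set xs. real (m x) *\<^sub>R (x0 - x)) \<in> C"
      using order_cone_scale[OF C max] by (intro order_cone_sum[OF C])
    ultimately have "(\<Sum>x\<in>set xs. real (m x) *\<^sub>R (x0 - x)) + y \<in> C"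
      by (intro order_cone_add[OF C])
    also have "(\<Sum>x\<in>set xs. real (m x) *\<^sub>R (x0 - x)) + y = real (\<Sum>x\<in>set xs. m x) *\<^sub>R x0 - g"
      by (simp add: y_def scaleR_diff_right sum_subtractf flip: scaleR_sum_left)
    finally show False using last[OF x0] by blast
  qed
  then show ?case
    using IH span_superset[of "set xs"] by (auto simp: independent_insert)
qed

lemma arch_chain_length:
  fixes Y :: "'v::finite set"
  assumes C: "order_cone Y C" and gs: "arch_chain Y C gs"
  shows "length gs \<le> card Y + 1"
proof -
  let ?B = "insert (1, 0) ((\<lambda>j. (0, axis j 1)) ` Y) :: (real \<times> (real ^ 'v)) set"
  have "lattice_vectors Y \<subseteq> span ?B"
  proof
    fix y assume y: "y \<in> lattice_vectors Y"
    let ?s = "fst y *\<^sub>R (1, 0) + (\<Sum>j\<in>Y. snd y $ j *\<^sub>R (0, axis j 1))"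
    have "snd ?s $ i = snd y $ i" for i
    proof -
      have "snd ?s $ i = (\<Sum>j\<in>Y. if i = j then snd y $ j else 0)"
        unfolding snd_add snd_sum by (simp add: axis_def if_distrib[of "(*) _"] cong: if_cong)
      also have "\<dots> = snd y $ i"
        using y by (simp add: lattice_vectors_def vectors_def)
      finally show ?thesis .
    qed
    then have "snd ?s = snd y" unfolding vec_eq_iff by blast
    moreover have "fst ?s = fst y" by (simp add: fst_sum)
    ultimately have "y = ?s" by (intro prod_eqI) (rule sym, assumption)+
    also have "\<dots> \<in> span ?B"
      by (intro span_add span_scale span_sum span_base) auto
    finally show "y \<in> span ?B" .
  qed
  then have "set gs \<subseteq> span ?B" using gs by (auto simp: arch_chain_def)
  moreover have ind: "distinct gs" "independent (set gs)"
    using arch_chain_independent[OF C gs] by auto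
  ultimately have "card (set gs) \<le> card ?B"
    using independent_span_bound[of ?B "set gs"] by simp
  also have "\<dots> \<le> Suc (card Y)"
    by (rule order_trans[OF card_insert_le_m1[of "Suc (card Y)"]]) (simp_all add: card_image_le)
  finally show ?thesis using ind(1) by (simp add: distinct_card)
qed

text \<open>Passing to a strictly larger prime either identifies new pairs of monomials, which gives an
  element infinitely smaller than a given chain, or kills a variable, whose inverse is then
  infinitely larger.\<close>

context monomial_semiring
begin

text \<open>Recovers the preorder from the congruence. If \<open>a\<close> and \<open>b\<close>
  share an exponent, their sum is a single monomial; the vertical lifts \<open>r\<close> and
  \<open>s\<close> cover that case.\<close>

lemma monomial_pair_iff:
  assumes C: "order_cone Y C" and ab: "a \<in> M \<inter> vectors Y" "b \<in> M \<inter> vectors Y"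
  shows "(monomial a + monomial b, monomial b) \<in> cone_congruence A Y C \<longleftrightarrow> b - a \<in> C"
proof -
  have supp: "supp (monomial a) = {a}" "supp (monomial b) = {b}"
    using ab M_lattice supp_monomial[of _ UNIV] by blast+
  have sub: "supp (monomial a + monomial b) \<subseteq> {a, b}"
    using supp_add_subset[of "monomial a" "monomial b"] supp by auto
  have Int: "supp (monomial a + monomial b) \<inter> vectors Y = supp (monomial a + monomial b)"
    "supp (monomial b) \<inter> vectors Y = {b}"
    using sub ab supp by auto
  have A: "monomial a + monomial b \<in> A" "monomial b \<in> A"
    using ab monomial_in A_closed by auto
  obtain r where r: "r \<ge> 0" "a + (r, 0) \<in> supp (monomial a + monomial b)"
    using supp_add_lift[of a "monomial a" "monomial b"] supp by auto
  obtain s where s: "s \<ge> 0" "b + (s, 0) \<in> supp (monomial a + monomial b)"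
    using supp_add_lift[of b "monomial a" "monomial b"] supp by auto
  show ?thesis
  proof
    assume "(monomial a + monomial b, monomial b) \<in> cone_congruence A Y C"
    then have "dominated C (supp (monomial a + monomial b)) {b}"
      using Int by (simp add: cone_congruence_def)
    then have "b - (a + (r, 0)) \<in> C" using r(2) unfolding dominated_def by blast
    then have "(b - (a + (r, 0))) + (r, 0) \<in> C"
      by (rule order_cone_add[OF C _ order_cone_vertical[OF C r(1)]])
    moreover have "(b - (a + (r, 0))) + (r, 0) = b - a" by simp
    ultimately show "b - a \<in> C" by simp
  next
    assume ba: "b - a \<in> C"
    have "dominated C (supp (monomial a + monomial b)) {b}"
      using sub ba order_cone_zero[OF C] unfolding dominated_def by auto
    moreover have "dominated C {b} (supp (monomial a + monomial b))"
      unfolding dominated_def using s(2) order_cone_vertical[OF C s(1)]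
      by (auto intro!: bexI[of _ "b + (s, 0)"])
    ultimately show "(monomial a + monomial b, monomial b) \<in> cone_congruence A Y C"
      using A Int by (simp add: cone_congruence_def)
  qed
qed

lemma arch_chain_extend:
  assumes M: "nonneg_lattice X \<subseteq> M"
    and C: "order_cone Y C" and C': "order_cone Y' C'" and Y: "Y \<subseteq> X" "Y' \<subseteq> X"
    and less: "cone_congruence A Y C \<subset> cone_congruence A Y' C'"
    and gs: "arch_chain Y' C' gs"
  shows "\<exists>gs'. arch_chain Y C gs' \<and> length gs' = Suc (length gs)"
proof -
  let ?P = "cone_congruence A Y C" and ?Q = "cone_congruence A Y' C'"
  let ?e = "\<lambda>j. point 0 (axis j 1) :: real \<times> (real ^ 'v)"
  have nonneg_M: "nonneg_lattice Z \<subseteq> M \<inter> vectors Z" if "Z \<subseteq> X" for Z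
    using M lattice_vectors_mono[OF that] by (auto simp: nonneg_lattice_def lattice_vectors_def)
  have e: "?e j \<in> nonneg_lattice Z \<longleftrightarrow> j \<in> Z" for j and Z :: "'v set"
    by (auto simp: nonneg_lattice_def point_in_lattice_iff) (auto simp: axis_def point_def)
  have e_vec: "?e j \<in> vectors Z \<longleftrightarrow> j \<in> Z" for j and Z :: "'v set"
    by (auto simp: vectors_def point_def axis_def)
  \<comment> \<open>A variable killed by the smaller congruence is killed by the larger one.\<close>
  have YY: "Y' \<subseteq> Y"
  proof
    fix j assume j: "j \<in> Y'"
    have eM: "?e j \<in> M" using e[of j X] j Y(2) M by blast
    have supp: "supp (monomial (?e j)) = {?e j}"
      using eM M_lattice supp_monomial[of _ UNIV] by blast
    show "j \<in> Y"
    proof (rule ccontr)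
      assume "j \<notin> Y"
      then have "supp (monomial (?e j)) \<inter> vectors Y = {}" using supp e_vec by auto
      then have "(monomial (?e j), 0) \<in> ?P"
        using monomial_in[OF eM] A_closed(1) by (simp add: cone_congruence_def dominated_def)
      then have "dominated C' (supp (monomial (?e j)) \<inter> vectors Y') {}"
        using less by (auto simp: cone_congruence_def)
      then show False using supp e_vec[of j Y'] j unfolding dominated_def by blast
    qed
  qed
  have sub: "y \<in> C'" if y: "y \<in> C" "y \<in> lattice_vectors Y'" for y
  proof -
    obtain a b where ab: "a \<in> nonneg_lattice Y'" "b \<in> nonneg_lattice Y'" "y = b - a"
      using nonneg_lattice_diff[OF y(2)] by blast
    have mem: "a \<in> M \<inter> vectors Y'" "b \<in> M \<inter> vectors Y'" using ab nonneg_M[OF Y(2)] by blast+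
    moreover have "vectors Y' \<subseteq> vectors Y" using YY by (auto simp: vectors_def)
    ultimately have "a \<in> M \<inter> vectors Y" "b \<in> M \<inter> vectors Y" by blast+
    then have "(monomial a + monomial b, monomial b) \<in> ?P"
      using y(1) ab(3) by (simp add: monomial_pair_iff[OF C])
    then have "(monomial a + monomial b, monomial b) \<in> ?Q" using less by blast
    then show ?thesis using ab(3) by (simp add: monomial_pair_iff[OF C' mem])
  qed
  have gs_L: "set gs \<subseteq> lattice_vectors Y'" and gs_pos: "\<And>g. g \<in> set gs \<Longrightarrow> - g \<notin> C'"
    and gs_sorted: "sorted_wrt (\<lambda>x y. \<forall>m::nat. real m *\<^sub>R x - y \<notin> C') gs"
    using gs by (auto simp: arch_chain_def)
  have gs_C: "set gs \<subseteq> lattice_vectors Y" using gs_L lattice_vectors_mono[OF YY] by blast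
  have pos_C: "- g \<notin> C" if "g \<in> set gs" for g
    using sub[of "- g"] gs_pos[OF that] gs_L that by blast
  have sorted_C: "sorted_wrt (\<lambda>x y. \<forall>m::nat. real m *\<^sub>R x - y \<notin> C) gs"
    using gs_sorted
  proof (rule sorted_wrt_mono_rel[rotated])
    fix x y assume "x \<in> set gs" "y \<in> set gs" "\<forall>m::nat. real m *\<^sub>R x - y \<notin> C'"
    then show "\<forall>m::nat. real m *\<^sub>R x - y \<notin> C"
      using sub gs_L lattice_vectors_scale by blast
  qed
  show ?thesis
  proof (cases "Y' = Y")
    case True
    have CC': "C \<subseteq> C'" using sub order_cone_subset[OF C] True by blast
    have "C \<noteq> C'" using less True by blast
    \<comment> \<open>For \<open>C\<close> the vector \<open>- y\<close> is strictly positive, but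
      for \<open>C'\<close> it is equivalent to 0. It is thus infinitely smaller than the given
      chain and goes in front.\<close>
    then obtain y where y: "y \<in> C'" "y \<notin> C" using CC' by blast
    have yL: "y \<in> lattice_vectors Y" using y(1) order_cone_subset[OF C'] True by blast
    have "real m *\<^sub>R (- y) - g \<notin> C" if g: "g \<in> set gs" for m g
    proof
      assume "real m *\<^sub>R (- y) - g \<in> C"
      then have "(real m *\<^sub>R (- y) - g) + real m *\<^sub>R y \<in> C'"
        using CC' order_cone_add[OF C'] order_cone_scale[OF C' y(1)] by blast
      then show False using gs_pos[OF g] by simp
    qed
    then have "arch_chain Y C (- y # gs)"
      using gs_C pos_C sorted_C y(2) yL by (auto simp: arch_chain_def lattice_vectors_closed(3))
    then show ?thesis by (intro exI[of _ "- y # gs"]) simp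
  next
    case False
    then obtain j where j: "j \<in> Y" "j \<notin> Y'" using YY by blast
    \<comment> \<open>If \<open>h + ?e j\<close> were in \<open>C\<close>, a relation between the
      monomials at \<open>a\<close> and \<open>b + ?e j\<close> would persist in the larger
      congruence, where the second is killed and the first survives. So \<open>- ?e j\<close>
      exceeds all of \<open>lattice_vectors Y'\<close> and goes to the end.\<close>
    have top: "h + ?e j \<notin> C" if h: "h \<in> lattice_vectors Y'" for h
    proof
      assume hC: "h + ?e j \<in> C"
      obtain a b where ab: "a \<in> nonneg_lattice Y'" "b \<in> nonneg_lattice Y'" "h = b - a"
        using nonneg_lattice_diff[OF h] by blast
      have mem: "a \<in> M \<inter> vectors Y'" "b \<in> M \<inter> vectors Y'" using ab nonneg_M[OF Y(2)] by blast+
      have eM: "?e j \<in> M \<inter> vectors Y" using e[of j Y] j(1) nonneg_M[OF Y(1)] by blast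
      have VY: "vectors Y' \<subseteq> vectors Y" using YY by (auto simp: vectors_def)
      have be: "b + ?e j \<in> M \<inter> vectors Y" "a \<in> M \<inter> vectors Y"
        using mem eM VY M_add by (auto simp: vectors_def)
      have "(monomial a + monomial (b + ?e j), monomial (b + ?e j)) \<in> ?P"
        using hC ab(3) by (simp add: monomial_pair_iff[OF C be(2,1)] algebra_simps)
      then have "(monomial a + monomial (b + ?e j), monomial (b + ?e j)) \<in> ?Q" using less by blast
      then have dom: "dominated C' (supp (monomial a + monomial (b + ?e j)) \<inter> vectors Y')
          (supp (monomial (b + ?e j)) \<inter> vectors Y')"
        by (simp add: cone_congruence_def)
      have supp: "supp (monomial a) = {a}" "supp (monomial (b + ?e j)) = {b + ?e j}"
        using be M_lattice supp_monomial[of _ UNIV] by blast+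
      have "snd (b + ?e j) $ j = 1"
        using mem(2) j(2) by (simp add: vectors_def point_def axis_def)
      then have "b + ?e j \<notin> vectors Y'" using j(2) by (auto simp: vectors_def)
      then have empty: "supp (monomial (b + ?e j)) \<inter> vectors Y' = {}" using supp by simp
      obtain r where "a + (r, 0) \<in> supp (monomial a + monomial (b + ?e j))"
        using supp_add_lift[of a "monomial a" "monomial (b + ?e j)"] supp by blast
      moreover have "a + (r, 0) \<in> vectors Y'" using mem(1) by (simp add: vectors_def)
      ultimately show False using dom unfolding empty dominated_def by blast
    qed
    have "real m *\<^sub>R g - (- ?e j) \<notin> C" if "g \<in> set gs" for m g
      using top[OF lattice_vectors_scale, of g m] gs_L that by auto
    moreover have "?e j \<notin> C" using top[of 0] by simp
    moreover have "- ?e j \<in> lattice_vectors Y" using e[of j Y] j(1) by (auto simp: nonneg_lattice_def)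
    ultimately have "arch_chain Y C (gs @ [- ?e j])"
      using gs_C pos_C sorted_C by (auto simp: arch_chain_def sorted_wrt_append)
    then show ?thesis by (intro exI[of _ "gs @ [- ?e j]"]) simp
  qed
qed

text \<open>Descending from the largest prime, where the empty list is a chain, each strict
  inclusion lengthens the archimedean chain by one.\<close>

lemma prime_chain_length:
  assumes M: "nonneg_lattice X \<subseteq> M"
    and form: "\<And>P. prime_congruence A P \<Longrightarrow> \<exists>Y C. Y \<subseteq> X \<and> order_cone Y C \<and> P = cone_congruence A Y C"
    and P: "\<And>i. i \<le> n \<Longrightarrow> prime_congruence A (P i)" and less: "\<And>i. i < n \<Longrightarrow> P i \<subset> P (Suc i)"
  shows "n \<le> card X + 1"
proof -
  have "\<exists>Y C gs. Y \<subseteq> X \<and> order_cone Y C \<and> P (n - d) = cone_congruence A Y C \<and> arch_chain Y C gs \<and>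
    length gs = d" if "d \<le> n" for d
    using that
  proof (induction d)
    case 0
    obtain Y C where "Y \<subseteq> X" "order_cone Y C" "P n = cone_congruence A Y C"
      using form[OF P] by blast
    moreover have "arch_chain Y C []" by (simp add: arch_chain_def)
    ultimately show ?case by (metis diff_zero list.size(3))
  next
    case (Suc d)
    then obtain Y' C' gs where IH: "Y' \<subseteq> X" "order_cone Y' C'" "P (n - d) = cone_congruence A Y' C'"
      "arch_chain Y' C' gs" "length gs = d" by auto
    obtain Y C where Y: "Y \<subseteq> X" "order_cone Y C" "P (n - Suc d) = cone_congruence A Y C"
      using form[OF P[of "n - Suc d"]] by auto
    have "P (n - Suc d) \<subset> P (n - d)"
      using less[of "n - Suc d"] Suc.prems by (simp add: Suc_diff_Suc)
    then have "cone_congruence A Y C \<subset> cone_congruence A Y' C'" using Y IH by simp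
    from arch_chain_extend[OF M Y(2) IH(2) Y(1) IH(1) this IH(4)] obtain gs' where
      "arch_chain Y C gs'" "length gs' = Suc d" using IH(5) by auto
    then show ?case using Y by blast
  qed
  from this[of n] obtain Y C gs where "Y \<subseteq> X" "order_cone Y C" "arch_chain Y C gs" "length gs = n"
    by auto
  then have "n \<le> card Y + 1" using arch_chain_length by blast
  also have "card Y \<le> card X" using \<open>Y \<subseteq> X\<close> by (intro card_mono) auto
  finally show ?thesis by simp
qed

end

text \<open>For \<open>e\<close> enumerating \<open>X\<close>, truncations to the first rows give
  the flag of cones behind a longest chain of primes; all \<open>card X + 1\<close> rows give an
  antisymmetric cone.\<close>

definition lex_matrix :: "(nat \<Rightarrow> 'v) \<Rightarrow> 'v matrix" where
  "lex_matrix e i a = (case i of 0 \<Rightarrow> of_bool (a = None) | Suc m \<Rightarrow> of_bool (a = Some (e m)))"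

lemma mat_app_lex_matrix:
  "mat_app X (lex_matrix e) y 0 = fst y"
  "e m \<in> X \<Longrightarrow> mat_app X (lex_matrix e) y (Suc m) = snd y $ e m"
proof -
  show "mat_app X (lex_matrix e) y 0 = fst y" by (simp add: mat_app_def lex_matrix_def)
  have "(\<Sum>j\<in>X. of_bool (j = e m) * snd y $ j) = (\<Sum>j\<in>X. if j = e m then snd y $ j else 0)"
    by (rule sum.cong) auto
  then show "mat_app X (lex_matrix e) y (Suc m) = snd y $ e m" if "e m \<in> X"
    using that by (simp add: mat_app_def lex_matrix_def)
qed

lemma order_cone_lex_matrix: "order_cone X (matrix_cone X l (lex_matrix e))"
  by (rule order_cone_matrix_cone, cases l) (simp_all add: lex_nonneg_Suc lex_matrix_def)

lemma lex_nonneg_Suc_imp: "lex_nonneg (Suc l) w \<Longrightarrow> lex_nonneg l w"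
proof (induction l arbitrary: w)
  case (Suc l)
  from Suc.prems Suc.IH[of "\<lambda>i. w (Suc i)"] show ?case
    by (subst lex_nonneg_Suc) (auto simp: lex_nonneg_Suc[of "Suc l"])
qed simp

lemma not_lex_nonneg_Suc: "(\<forall>i<l. w i = 0) \<Longrightarrow> w l < 0 \<Longrightarrow> \<not> lex_nonneg (Suc l) w"
proof (induction l arbitrary: w)
  case (Suc l)
  have "w 0 = 0" "\<not> lex_nonneg (Suc l) (\<lambda>i. w (Suc i))"
    using Suc.prems Suc.IH[of "\<lambda>i. w (Suc i)"] by auto
  then show ?case by (simp add: lex_nonneg_Suc[of "Suc l"])
qed (simp add: lex_nonneg_Suc)

lemma (in monomial_semiring) prime_chain_exists:
  assumes M: "nonneg_lattice X \<subseteq> M" and A: "A \<subseteq> laurent X"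
  shows "\<exists>P. (\<forall>i\<le>card X + 1. prime_congruence A (P i)) \<and> (\<forall>i<card X + 1. P i \<subset> P (Suc i))"
proof -
  let ?k = "card X"
  obtain e where e: "bij_betw e {0..<?k} X"
    using ex_bij_betw_nat_finite[of X] by auto
  have eX: "e m \<in> X" if "m < ?k" for m using e that by (auto simp: bij_betw_def)
  have e_inj: "e m = e m' \<longleftrightarrow> m = m'" if "m < ?k" "m' < ?k" for m m'
    using e that by (auto simp: bij_betw_def inj_on_def)
  let ?C = "\<lambda>m. matrix_cone X m (lex_matrix e)"
  \<comment> \<open>Fewer rows give a larger cone, so the count runs backwards, from all
    \<open>card X + 1\<close> rows at \<open>i = 0\<close> to none.\<close>
  define P where "P i = cone_congruence A X (?C (?k + 1 - i))" for i
  have prime: "prime_congruence A (P i)" for i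
    unfolding P_def using cone_congruence_prime[OF order_cone_lex_matrix A] A_closed by blast
  have less: "P i \<subset> P (Suc i)" if i: "i < ?k + 1" for i
  proof -
    define m where "m = ?k - i"
    have m: "?k + 1 - i = Suc m" "?k + 1 - Suc i = m" "m \<le> ?k" using i by (auto simp: m_def)
    \<comment> \<open>The unit vector that row \<open>m\<close> detects and the earlier rows do not:
      \<open>- v\<close> enters the cone when that row is dropped.\<close>
    define v where "v = (case m of 0 \<Rightarrow> (1, 0) | Suc m' \<Rightarrow> point 0 (axis (e m') 1))"
    have v: "v \<in> nonneg_lattice X"
    proof (cases m)
      case (Suc m')
      then have "e m' \<in> X" using eX m(3) by simp
      then show ?thesis
        by (auto simp: v_def Suc nonneg_lattice_def point_in_lattice_iff) (auto simp: axis_def point_def)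
    qed (auto simp: v_def nonneg_lattice_def)
    have coord: "mat_app X (lex_matrix e) (- v) i = (if i = m then - 1 else 0)" if "i \<le> ?k" for i
    proof (cases i)
      case 0
      then show ?thesis
        by (cases m) (simp_all add: mat_app_lex_matrix v_def point_def)
    next
      case (Suc i')
      then have i': "i' < ?k" using that by simp
      note row = mat_app_lex_matrix(2)[where e = e and m = i' and X = X, OF eX[OF i']]
      show ?thesis
      proof (cases m)
        case (Suc m')
        then show ?thesis using \<open>i = Suc i'\<close> e_inj[OF i', of m'] m(3)
          by (auto simp: row v_def point_def axis_def)
      qed (simp add: \<open>i = Suc i'\<close> row v_def)
    qed
    have vL: "- v \<in> lattice_vectors X" using v by (auto simp: nonneg_lattice_def)
    have v_in: "0 - v \<in> ?C m"
      using vL coord m(3) by (simp add: matrix_cone_def lex_nonneg_def)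
    have v_notin: "0 - v \<notin> ?C (Suc m)"
      using not_lex_nonneg_Suc[of m "mat_app X (lex_matrix e) (- v)"] coord m(3)
      by (simp add: matrix_cone_def)
    have mem: "v \<in> M \<inter> vectors X" "0 \<in> M \<inter> vectors X"
      using v M M_zero by (auto simp: nonneg_lattice_def lattice_vectors_def vectors_def)
    have "?C (Suc m) \<subseteq> ?C m" by (auto simp: matrix_cone_def intro: lex_nonneg_Suc_imp)
    then have "P i \<subseteq> P (Suc i)"
      unfolding P_def m cone_congruence_def dominated_def by blast
    moreover have "(monomial v + monomial 0, monomial 0) \<in> P (Suc i)"
      using monomial_pair_iff[OF order_cone_lex_matrix mem] v_in unfolding P_def m by blast
    moreover have "(monomial v + monomial 0, monomial 0) \<notin> P i"
      using monomial_pair_iff[OF order_cone_lex_matrix mem] v_notin unfolding P_def m by blast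
    ultimately show ?thesis by blast
  qed
  show ?thesis using prime less by (intro exI[of _ P]) blast
qed

lemma (in monomial_semiring) congruence_dim_eq:
  assumes M: "nonneg_lattice X \<subseteq> M" and A: "A \<subseteq> laurent X"
    and form: "\<And>P. prime_congruence A P \<Longrightarrow> \<exists>Y C. Y \<subseteq> X \<and> order_cone Y C \<and> P = cone_congruence A Y C"
  shows "congruence_dim A = enat (card X + 1)"
  unfolding congruence_dim_def
proof (rule antisym)
  show "Sup {enat n | n. \<exists>P :: nat \<Rightarrow> _. (\<forall>i\<le>n. prime_congruence A (P i)) \<and> (\<forall>i<n. P i \<subset> P (Suc i))}
      \<le> enat (card X + 1)"
  proof (rule Sup_least)
    fix x assume "x \<in> {enat n | n. \<exists>P :: nat \<Rightarrow> _.
      (\<forall>i\<le>n. prime_congruence A (P i)) \<and> (\<forall>i<n. P i \<subset> P (Suc i))}"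
    then obtain n and P :: "nat \<Rightarrow> _" where x: "x = enat n"
      and P: "\<forall>i\<le>n. prime_congruence A (P i)" "\<forall>i<n. P i \<subset> P (Suc i)" by blast
    have "n \<le> card X + 1"
      by (rule prime_chain_length[OF M form, of n P]) (use P in blast)+
    then show "x \<le> enat (card X + 1)" by (simp add: x)
  qed
  show "enat (card X + 1) \<le>
      Sup {enat n | n. \<exists>P :: nat \<Rightarrow> _. (\<forall>i\<le>n. prime_congruence A (P i)) \<and> (\<forall>i<n. P i \<subset> P (Suc i))}"
    by (rule Sup_upper) (use prime_chain_exists[OF M A] in blast)
qed

section \<open>Minimal primes and the radical\<close>

text \<open>Lexicographic composition: \<open>C\<close> decides first, and \<open>E\<close> breaks
  its ties.\<close>

lemma order_cone_refine:
  assumes C: "order_cone X C" and E: "order_cone X E"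
  shows "order_cone X {y \<in> C. - y \<in> C \<longrightarrow> y \<in> E}"
  unfolding order_cone_def
proof (intro conjI ballI allI impI)
  show "{y \<in> C. - y \<in> C \<longrightarrow> y \<in> E} \<subseteq> lattice_vectors X"
    using order_cone_subset[OF C] by blast
  fix x y assume "x \<in> {y \<in> C. - y \<in> C \<longrightarrow> y \<in> E}" "y \<in> {y \<in> C. - y \<in> C \<longrightarrow> y \<in> E}"
  then have x: "x \<in> C" "- x \<in> C \<Longrightarrow> x \<in> E" and y: "y \<in> C" "- y \<in> C \<Longrightarrow> y \<in> E" by auto
  have "x + y \<in> E" if neg: "- (x + y) \<in> C"
  proof -
    have "- x \<in> C" using order_cone_add[OF C neg y(1)] by simp
    moreover have "- y \<in> C" using order_cone_add[OF C neg x(1)] by simp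
    ultimately show ?thesis using order_cone_add[OF E] x(2) y(2) by blast
  qed
  then show "x + y \<in> {y \<in> C. - y \<in> C \<longrightarrow> y \<in> E}"
    using order_cone_add[OF C x(1) y(1)] by blast
next
  fix x assume "x \<in> lattice_vectors X"
  then have "x \<in> C \<or> - x \<in> C" "x \<in> E \<or> - x \<in> E"
    using order_cone_total[OF C, of x] order_cone_total[OF E, of x] by blast+
  then show "x \<in> {y \<in> C. - y \<in> C \<longrightarrow> y \<in> E} \<or> - x \<in> {y \<in> C. - y \<in> C \<longrightarrow> y \<in> E}"
    by auto
next
  fix r :: real assume "0 \<le> r"
  then show "(r, 0) \<in> {y \<in> C. - y \<in> C \<longrightarrow> y \<in> E}"
    using order_cone_vertical[OF C] order_cone_vertical[OF E] by blast
qed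

lemma antisymmetric_order_cone_exists:
  fixes X :: "'v::finite set"
  shows "\<exists>E. order_cone X E \<and> (\<forall>y\<in>E. - y \<in> E \<longrightarrow> y = 0)"
proof -
  obtain e where e: "bij_betw e {0..<card X} X"
    using ex_bij_betw_nat_finite[of X] by auto
  let ?E = "matrix_cone X (card X + 1) (lex_matrix e)"
  have "y = 0" if y: "y \<in> ?E" "- y \<in> ?E" for y
  proof -
    have L: "y \<in> lattice_vectors X" using y by (simp add: matrix_cone_def)
    have "mat_app X (lex_matrix e) (- y) = (\<lambda>i. - mat_app X (lex_matrix e) y i)"
      by (rule ext) (rule mat_app_minus)
    then have coord: "mat_app X (lex_matrix e) y i = 0" if "i < card X + 1" for i
      using lex_nonneg_antisym[of "card X + 1" "mat_app X (lex_matrix e) y" i] y that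
      by (simp add: matrix_cone_def)
    have "fst y = 0" using coord[of 0] by (simp add: mat_app_lex_matrix)
    moreover have "snd y $ j = 0" for j
    proof (cases "j \<in> X")
      case True
      then obtain m where m: "m < card X" "j = e m"
        using e unfolding bij_betw_def by (metis atLeast0LessThan imageE lessThan_iff)
      have "e m \<in> X" using True m(2) by simp
      then show ?thesis using coord[of "Suc m"] m by (simp add: mat_app_lex_matrix)
    next
      case False
      then show ?thesis using L by (simp add: lattice_vectors_def vectors_def)
    qed
    ultimately show "y = 0" by (simp add: prod_eq_iff vec_eq_iff)
  qed
  then show ?thesis using order_cone_lex_matrix by (intro exI[of _ ?E]) blast
qed

text \<open>Monomials involving a variable outside \<open>Y\<close> are made smaller than all others by first
  comparing the total degree in those variables.\<close>

lemma cone_congruence_polys_extend: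
  fixes X :: "'v::finite set"
  assumes C: "order_cone Y C" and Y: "Y \<subseteq> X"
  shows "\<exists>D. order_cone X D \<and> (\<forall>E. E \<subseteq> D \<longrightarrow> cone_congruence (polys X) X E \<subseteq> cone_congruence (polys X) Y C)"
proof -
  define w :: "real \<times> (real ^ 'v)" where "w = (0, \<chi> j. if j \<in> X - Y then - 1 else 0)"
  define pr :: "real \<times> (real ^ 'v) \<Rightarrow> real \<times> (real ^ 'v)"
    where "pr y = (fst y, \<chi> j. if j \<in> Y then snd y $ j else 0)" for y
  have pr_L: "pr y \<in> lattice_vectors Y" if "y \<in> lattice_vectors X" for y
    using that by (simp add: pr_def lattice_vectors_def vectors_def)
  have pr_add: "pr (x + y) = pr x + pr y" for x y by (simp add: pr_def vec_eq_iff)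
  have pr_neg: "pr (- x) = - pr x" for x by (simp add: pr_def vec_eq_iff)
  have pr_id: "pr y = y" if "y \<in> vectors Y" for y
    using that by (simp add: pr_def vectors_def prod_eq_iff vec_eq_iff)
  let ?H = "{y \<in> lattice_vectors X. 0 \<le> w \<bullet> y}"
  let ?B = "{y \<in> lattice_vectors X. pr y \<in> C}"
  let ?D = "{y \<in> ?H. - y \<in> ?H \<longrightarrow> y \<in> ?B}"
  have H: "order_cone X ?H" by (rule order_cone_halfspace) (simp add: w_def)
  have B: "order_cone X ?B"
    unfolding order_cone_def
  proof (intro conjI ballI allI impI)
    fix x y assume "x \<in> ?B" "y \<in> ?B"
    then show "x + y \<in> ?B" by (simp add: lattice_vectors_closed pr_add order_cone_add[OF C])
  next
    fix x assume "x \<in> lattice_vectors X"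
    then show "x \<in> ?B \<or> - x \<in> ?B"
      using order_cone_total[OF C pr_L, of x] by (auto simp: lattice_vectors_closed pr_neg)
  next
    fix r :: real assume "0 \<le> r"
    moreover have "pr (r, 0) = (r, 0)" by (rule pr_id) (simp add: vectors_def)
    ultimately show "(r, 0) \<in> ?B" by (simp add: order_cone_vertical[OF C])
  qed simp
  have D: "order_cone X ?D" by (rule order_cone_refine[OF H B])
  have w: "w \<bullet> y = - (\<Sum>j\<in>X - Y. snd y $ j)" for y
  proof -
    have "(\<Sum>j\<in>UNIV. (if j \<in> X - Y then - 1 else 0) * snd y $ j) = (\<Sum>j\<in>X - Y. - snd y $ j)"
      by (rule sum.mono_neutral_cong_right) auto
    then show ?thesis by (simp add: w_def inner_prod_def inner_vec_def sum_negf)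
  qed
  \<comment> \<open>The cone \<open>E\<close> is left free inside \<open>?D\<close> because
    \<open>?D\<close> is later refined to an antisymmetric cone.\<close>
  have dom: "dominated C (supp f \<inter> vectors Y) (supp g \<inter> vectors Y)"
    if f: "f \<in> polys X" and g: "g \<in> polys X" and E: "E \<subseteq> ?D"
      and d: "dominated E (supp f \<inter> vectors X) (supp g \<inter> vectors X)" for f g E
    unfolding dominated_def
  proof
    fix p assume p: "p \<in> supp f \<inter> vectors Y"
    have "p \<in> vectors X" using p Y by (auto simp: vectors_def)
    then obtain q where q: "q \<in> supp g" "q - p \<in> ?D"
      using d p E unfolding dominated_def by blast
    have nn: "q \<in> nonneg_lattice X" using g q(1) unfolding polys_iff_supp by blast
    have qnn: "0 \<le> snd q $ j" for j using nn by (simp add: nonneg_lattice_def)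
    \<comment> \<open>Here nonnegative exponents matter: \<open>q\<close> lies above
      \<open>p\<close>, which has degree 0 in the variables outside \<open>Y\<close>, so
      \<open>q\<close> has degree 0 there and each of these exponents vanishes.\<close>
    have "w \<bullet> p = 0" using p by (simp add: w vectors_def)
    then have wq: "w \<bullet> (q - p) = w \<bullet> q" by (simp add: inner_diff_right)
    moreover have "0 \<le> w \<bullet> (q - p)" using q(2) by blast
    moreover have "0 \<le> (\<Sum>j\<in>X - Y. snd q $ j)" by (intro sum_nonneg qnn)
    ultimately have sum0: "(\<Sum>j\<in>X - Y. snd q $ j) = 0" by (simp add: w)
    then have "\<forall>j\<in>X - Y. snd q $ j = 0"
      using sum_nonneg_eq_0_iff[of "X - Y" "\<lambda>j. snd q $ j"] qnn by simp
    moreover have "\<forall>j. j \<notin> X \<longrightarrow> snd q $ j = 0"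
      using nn by (simp add: nonneg_lattice_def lattice_vectors_def vectors_def)
    ultimately have qY: "q \<in> vectors Y" unfolding vectors_def by blast
    have "w \<bullet> - (q - p) = 0" unfolding inner_minus_right wq w[of q] sum0 by simp
    moreover have "- (q - p) \<in> lattice_vectors X" using q(2) lattice_vectors_closed(3) by blast
    ultimately have "- (q - p) \<in> ?H" by (intro CollectI conjI) simp_all
    then have "pr (q - p) \<in> C" using q(2) by blast
    moreover have "q - p \<in> vectors Y" using qY p by (simp add: vectors_def)
    ultimately have "q - p \<in> C" by (simp add: pr_id)
    then show "\<exists>q\<in>supp g \<inter> vectors Y. q - p \<in> C" using q(1) qY by blast
  qed
  have "cone_congruence (polys X) X E \<subseteq> cone_congruence (polys X) Y C" if "E \<subseteq> ?D" for E
    using dom[OF _ _ that] unfolding cone_congruence_def by blast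
  then show ?thesis using D by blast
qed

lemma cone_congruence_mono: "E \<subseteq> C \<Longrightarrow> cone_congruence A Y E \<subseteq> cone_congruence A Y C"
  unfolding cone_congruence_def dominated_def by blast

text \<open>The cone \<open>D\<close> accounts for all variables, killed ones included; breaking its
  ties antisymmetrically only shrinks the congruence. Both the minimal primes and the radical are
  read off from this.\<close>

lemma prime_contains_antisymmetric:
  assumes A: "A = laurent X \<or> A = polys X" and P: "prime_congruence A P"
  shows "\<exists>C. order_cone X C \<and> (\<forall>y\<in>C. - y \<in> C \<longrightarrow> y = 0) \<and> cone_congruence A X C \<subseteq> P"
proof -
  have "\<exists>D. order_cone X D \<and> (\<forall>E. E \<subseteq> D \<longrightarrow> cone_congruence A X E \<subseteq> P)"
    using A
  proof
    assume "A = laurent X"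
    then show ?thesis using laurent_prime_cone[of X P] P cone_congruence_mono by metis
  next
    assume A: "A = polys X"
    then obtain C where "order_cone {j \<in> X. (var j, 0) \<notin> P} C"
      "P = cone_congruence (polys X) {j \<in> X. (var j, 0) \<notin> P} C"
      using polys_prime_cone[of X P] P by blast
    then show ?thesis
      using cone_congruence_polys_extend[of "{j \<in> X. (var j, 0) \<notin> P}" C X] A by auto
  qed
  then obtain D where D: "order_cone X D" "\<And>E. E \<subseteq> D \<Longrightarrow> cone_congruence A X E \<subseteq> P" by blast
  obtain E where E: "order_cone X E" "\<forall>y\<in>E. - y \<in> E \<longrightarrow> y = 0"
    using antisymmetric_order_cone_exists by blast
  let ?C = "{y \<in> D. - y \<in> D \<longrightarrow> y \<in> E}"
  have "y = 0" if y: "y \<in> ?C" "- y \<in> ?C" for y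
  proof -
    have "y \<in> E" "- y \<in> E" using y by auto
    then show ?thesis using E(2) by blast
  qed
  then show ?thesis
    using order_cone_refine[OF D(1) E(1)] D(2)[of ?C] by blast
qed

lemma cone_congruence_prime_cases:
  assumes A: "A = laurent X \<or> A = polys X" and C: "order_cone X C"
  shows "prime_congruence A (cone_congruence A X C)"
  using A
proof
  assume "A = laurent X"
  then show ?thesis
    by (intro cone_congruence_prime[OF C]) (use laurent_subsemiring in auto)
next
  assume "A = polys X"
  then show ?thesis
    by (intro cone_congruence_prime[OF C]) (use polys_subsemiring polys_subset_laurent[of X] in auto)
qed

lemma cone_congruence_zero_iff:
  assumes "A \<subseteq> laurent X" "(f, 0) \<in> cone_congruence A X C"
  shows "f = 0"
proof -
  have "dominated C (supp f) {}" using assms(2) unfolding cone_congruence_iff[OF assms(1)] by simp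
  then have "supp f = {}" unfolding dominated_def by blast
  then show ?thesis by simp
qed

lemma minimal_prime_cone:
  assumes A: "A = laurent X \<or> A = polys X" and P: "minimal_prime_congruence A P"
  obtains C where "order_cone X C" "\<forall>y\<in>C. - y \<in> C \<longrightarrow> y = 0" "P = cone_congruence A X C"
proof -
  have prime: "prime_congruence A P" and min: "\<And>Q. prime_congruence A Q \<Longrightarrow> Q \<subseteq> P \<Longrightarrow> Q = P"
    using P unfolding minimal_prime_congruence_def by blast+
  obtain C where C: "order_cone X C" "\<forall>y\<in>C. - y \<in> C \<longrightarrow> y = 0" "cone_congruence A X C \<subseteq> P"
    using prime_contains_antisymmetric[OF A prime] by blast
  then have "cone_congruence A X C = P"
    using min cone_congruence_prime_cases[OF A C(1)] by blast
  then show thesis using that C by blast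
qed

text \<open>A lattice vector in the kernel lies in the cone together with its negative.\<close>

lemma matrix_cone_Ker:
  assumes "\<forall>y\<in>matrix_cone X l U. - y \<in> matrix_cone X l U \<longrightarrow> y = 0"
  shows "Ker X l U \<inter> lattice_vectors X = {0}"
proof (intro equalityI subsetI)
  fix y assume y: "y \<in> Ker X l U \<inter> lattice_vectors X"
  then have "\<forall>i<l. mat_app X U y i = 0" "\<forall>i<l. mat_app X U (- y) i = 0"
    by (auto simp: Ker_def mat_app_minus)
  then have "y \<in> matrix_cone X l U" "- y \<in> matrix_cone X l U"
    using y by (auto simp: matrix_cone_def lex_nonneg_def lattice_vectors_closed)
  then show "y \<in> {0}" using assms by blast
next
  fix y :: "real \<times> (real ^ 'a)" assume "y \<in> {0}"
  then show "y \<in> Ker X l U \<inter> lattice_vectors X"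
    by (simp add: Ker_def vectors_def mat_app_def)
qed

text \<open>Primes that kill variables do not shrink the intersection, since each of them contains a
  cone congruence in all variables.\<close>

lemma Rad_Id_on:
  assumes A: "A = laurent X \<or> A = polys X"
  shows "Rad A (Id_on A) = {(f, g) \<in> A \<times> A. \<forall>C. order_cone X C \<longrightarrow> (f, g) \<in> cone_congruence A X C}"
proof (intro equalityI subsetI)
  fix z assume z: "z \<in> Rad A (Id_on A)"
  have "z \<in> cone_congruence A X C" if C: "order_cone X C" for C
  proof -
    have prime: "prime_congruence A (cone_congruence A X C)"
      by (rule cone_congruence_prime_cases[OF A C])
    then have "congruence A (cone_congruence A X C)"
      by (simp add: prime_congruence_def proper_congruence_def)
    then have "Id_on A \<subseteq> cone_congruence A X C"
      using congruence_refl by (auto simp: Id_on_def)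
    then show ?thesis using z prime unfolding Rad_def by blast
  qed
  moreover have "z \<in> A \<times> A" using z by (simp add: Rad_def)
  ultimately show "z \<in> {(f, g) \<in> A \<times> A. \<forall>C. order_cone X C \<longrightarrow> (f, g) \<in> cone_congruence A X C}"
    by auto
next
  fix z assume z: "z \<in> {(f, g) \<in> A \<times> A. \<forall>C. order_cone X C \<longrightarrow> (f, g) \<in> cone_congruence A X C}"
  have "z \<in> P" if P: "prime_congruence A P" for P
    using prime_contains_antisymmetric[OF A P] z by blast
  then show "z \<in> Rad A (Id_on A)" using z by (auto simp: Rad_def)
qed

text \<open>Every prime allows cancelling a factor that it does not kill. With zero kernels a
  nonzero factor is killed by none of them, so cancellation passes to the intersection.\<close>

lemma (in monomial_semiring) QC_Inter_primes:
  assumes I: "I = A \<times> A \<inter> \<Inter>\<P>" and proper: "I \<noteq> A \<times> A"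
    and prime: "\<And>P. P \<in> \<P> \<Longrightarrow> prime_congruence A P"
    and kernel: "\<And>P f. P \<in> \<P> \<Longrightarrow> (f, 0) \<in> P \<Longrightarrow> f = 0"
  shows "QC A I"
proof -
  have cong: "congruence A P" if "P \<in> \<P>" for P
    using prime[OF that] by (simp add: prime_congruence_def proper_congruence_def)
  have cong_I: "congruence A I"
    unfolding congruence_def
  proof
    show "equiv A I"
    proof (rule equivI)
      show "I \<subseteq> A \<times> A" using I by blast
      show "refl_on A I" using I congruence_refl[OF cong] by (auto simp: refl_on_def)
      show "sym I" using I congruence_sym[OF cong] by (auto simp: sym_def)
      show "trans I"
      proof (rule transI)
        fix x y z assume "(x, y) \<in> I" "(y, z) \<in> I"
        then show "(x, z) \<in> I" using I congruence_trans[OF cong, of _ x y z] by auto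
      qed
    qed
    show "\<forall>(a, b)\<in>I. \<forall>(c, d)\<in>I. (a + c, b + d) \<in> I \<and> (a * c, b * d) \<in> I"
      using I congruence_add[OF cong] congruence_mult[OF cong] A_closed(3,4) by auto
  qed
  have cancel: "(a, 0) \<in> I \<or> (b, c) \<in> I" if abc: "a \<in> A" "b \<in> A" "c \<in> A" "(a * b, a * c) \<in> I" for a b c
  proof (cases "a = 0")
    case True
    then show ?thesis using congruence_refl[OF cong_I A_closed(1)] by simp
  next
    case False
    have "(b, c) \<in> P" if P: "P \<in> \<P>" for P
    proof -
      have "(a * b, a * c) \<in> P" using abc(4) I P by blast
      then show ?thesis using P_cancel[OF prime[OF P] abc(1-3)] kernel[OF P] False by blast
    qed
    then show ?thesis using I abc by blast
  qed
  show ?thesis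
    unfolding QC_def proper_congruence_def
  proof (intro conjI ballI impI cong_I proper)
    fix a b c assume abc: "a \<in> A" "b \<in> A" "c \<in> A" and eq: "I `` {a * b} = I `` {a * c}"
    have "(a * b, a * c) \<in> I"
      using congruence_image_eq_iff[OF cong_I A_closed(4) A_closed(4)] abc eq by simp
    then show "I `` {a} = I `` {0} \<or> I `` {b} = I `` {c}"
      using cancel[OF abc] abc
      by (simp add: congruence_image_eq_iff[OF cong_I _ A_closed(1)] congruence_image_eq_iff[OF cong_I])
  qed
qed

section \<open>Generators of the primes of the polynomial semiring\<close>

lemma polys_mono: "Y \<subseteq> X \<Longrightarrow> polys Y \<subseteq> polys X"
  using lattice_vectors_mono[of Y X] by (auto simp: polys_iff_supp nonneg_lattice_def subset_iff)

text \<open>A congruence containing the generators sends every monomial with a variable in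
  \<open>H\<close> to 0 and orders the others by \<open>C\<close>, which suffices for
  \<open>congruent_if_dominated\<close>.\<close>

lemma polys_prime_generated:
  fixes X :: "'v::finite set"
  assumes P: "prime_congruence (polys X) P"
  shows "\<exists>H l U. H \<subseteq> X \<and> t_admissible (X - H) l U \<and>
    prime_congruence (polys (X - H)) (poly_prime (X - H) l U) \<and>
    P = generated_congruence (polys X) ({(var j, 0) | j. j \<in> H} \<union> poly_prime (X - H) l U)"
proof -
  define H where "H = {j \<in> X. (var j, 0) \<in> P}"
  let ?Y = "X - H"
  have "{j \<in> X. (var j, 0) \<notin> P} = ?Y" by (auto simp: H_def)
  then obtain C where C: "order_cone ?Y C" and P_eq: "P = cone_congruence (polys X) ?Y C"
    using polys_prime_cone[OF P] by auto
  obtain l U where U: "t_admissible ?Y l U" "C = matrix_cone ?Y l U"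
    using order_cone_matrix[OF C] .
  have "laurent_prime ?Y l U = cone_congruence (laurent ?Y) ?Y C"
    using U laurent_prime_eq_cone_congruence[of l U ?Y] by (simp add: t_admissible_def)
  then have Q: "poly_prime ?Y l U = cone_congruence (polys ?Y) ?Y C"
    unfolding poly_prime_def by (simp only: cone_congruence_Int[OF polys_subset_laurent])
  have prime_Q: "prime_congruence (polys ?Y) (poly_prime ?Y l U)"
    unfolding Q by (rule cone_congruence_prime_cases[OF _ C]) simp
  let ?G = "{(var j, 0) | j. j \<in> H} \<union> poly_prime ?Y l U"
  have cong_P: "congruence (polys X) P"
    using P by (simp add: prime_congruence_def proper_congruence_def)
  have "polys ?Y \<subseteq> polys X" by (rule polys_mono) blast
  then have "poly_prime ?Y l U \<subseteq> P"
    unfolding Q P_eq using cone_congruence_Int by blast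
  then have "?G \<subseteq> P" by (auto simp: H_def)
  then have "generated_congruence (polys X) ?G \<subseteq> P"
    using cong_P unfolding generated_congruence_def by blast
  moreover have "(f, g) \<in> I" if fg: "(f, g) \<in> P" and I: "congruence (polys X) I" "?G \<subseteq> I" for f g I
  proof -
    interpret monomial_semiring "nonneg_lattice X" "polys X" by (rule monomial_semiring_polys)
    interpret Y: monomial_semiring "nonneg_lattice ?Y" "polys ?Y" by (rule monomial_semiring_polys)
    have MY: "nonneg_lattice X \<inter> vectors ?Y = nonneg_lattice ?Y"
      by (auto simp: nonneg_lattice_def lattice_vectors_def vectors_def)
    have fgA: "f \<in> polys X" "g \<in> polys X"
      and d: "dominated C (supp f \<inter> vectors ?Y) (supp g \<inter> vectors ?Y)"
        "dominated C (supp g \<inter> vectors ?Y) (supp f \<inter> vectors ?Y)"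
      using fg unfolding P_eq cone_congruence_def by blast+
    show ?thesis
    proof (rule congruent_if_dominated[where F = "vectors ?Y" and C = C, OF I(1) fgA _ _ _ _ d])
      fix q assume q: "q \<in> nonneg_lattice X" "q \<notin> vectors ?Y"
      then obtain j where j: "j \<notin> ?Y" "snd q $ j \<noteq> 0" by (auto simp: vectors_def)
      have jX: "j \<in> X" using q(1) j(2) by (auto simp: nonneg_lattice_def lattice_vectors_def vectors_def)
      let ?e = "point 0 (axis j 1) :: real \<times> (real ^ 'v)"
      have "snd q $ j \<in> \<int>" "0 \<le> snd q $ j"
        using q(1) by (auto simp: nonneg_lattice_def lattice_vectors_def)
      then have "1 \<le> snd q $ j" using j(2) by (auto elim!: Ints_cases)
      then have "0 \<le> snd (q - ?e) $ i" for i
        using q(1) by (auto simp: nonneg_lattice_def point_def axis_def)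
      moreover have e: "?e \<in> nonneg_lattice X"
        using jX by (auto simp: nonneg_lattice_def point_in_lattice_iff) (auto simp: axis_def point_def)
      ultimately have qe: "q - ?e \<in> nonneg_lattice X"
        using q(1) by (auto simp: nonneg_lattice_def)
      have "(var j, 0) \<in> I" using I(2) j(1) jX by blast
      then have "(monomial (q - ?e) * monomial ?e, monomial (q - ?e) * 0) \<in> I"
        unfolding var_eq_monomial
        by (rule congruence_mult[OF I(1) congruence_refl[OF I(1) monomial_in[OF qe]]])
      then show "(monomial q, 0) \<in> I"
        using monomial_mult[OF qe e] by simp
    next
      fix p q assume pq: "p \<in> nonneg_lattice X \<inter> vectors ?Y" "q \<in> nonneg_lattice X \<inter> vectors ?Y"
      then have Y: "p \<in> nonneg_lattice ?Y \<inter> vectors ?Y" "q \<in> nonneg_lattice ?Y \<inter> vectors ?Y"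
        using MY by blast+
      show "(monomial p + monomial q, monomial q) \<in> I" if "q - p \<in> C"
        using Y.monomial_pair_iff[OF C Y] that I(2) unfolding Q by blast
      have "q - p \<in> lattice_vectors ?Y" using Y by (auto simp: nonneg_lattice_def)
      then show "q - p \<in> C \<or> p - q \<in> C" using order_cone_total[OF C, of "q - p"] by auto
    next
      show "x + y \<in> C" if "x \<in> C" "y \<in> C" for x y using order_cone_add[OF C that] .
    qed
  qed
  moreover have "P \<subseteq> polys X \<times> polys X" unfolding P_eq cone_congruence_def by blast
  ultimately have "P = generated_congruence (polys X) ?G"
    unfolding generated_congruence_def by (intro equalityI subsetI) auto
  then show ?thesis
    using U(1) prime_Q by (intro exI[of _ H] exI[of _ l] exI[of _ U]) (auto simp: H_def)
qed

theorem theorem4p14: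
  fixes X :: "'v::finite set" and k :: nat
  assumes "card X = k"
  shows
    \<comment> \<open>(i)\<close>
    "((\<forall>P. prime_congruence (laurent X) P \<longrightarrow>
          (\<exists>l U. t_admissible X l U \<and> P = laurent_prime X l U)) \<and>
      (\<forall>P. prime_congruence (polys X) P \<longrightarrow>
          (\<exists>H l U. H \<subseteq> X \<and> t_admissible (X - H) l U \<and>
             prime_congruence (polys (X - H)) (poly_prime (X - H) l U) \<and>
             P = generated_congruence (polys X)
                   ({(var j, 0) | j. j \<in> H} \<union> poly_prime (X - H) l U))))
    \<and>
     ((\<forall>P. minimal_prime_congruence (polys X) P \<longrightarrow> congruence_kernel (polys X) P = {0}) \<and>
      (\<forall>P. minimal_prime_congruence (polys X) P \<longrightarrow>
          (\<exists>l U. t_admissible X l U \<and> Ker X l U \<inter> lattice_vectors X = {0} \<and>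
             P = poly_prime X l U)) \<and>
      (\<forall>P. minimal_prime_congruence (laurent X) P \<longrightarrow>
          (\<exists>l U. t_admissible X l U \<and> Ker X l U \<inter> lattice_vectors X = {0} \<and>
             P = laurent_prime X l U)))
    \<and>
     (congruence_dim (laurent X) = enat (k + 1) \<and> congruence_dim (polys X) = enat (k + 1))
    \<and>
     ((\<forall>f \<in> laurent X. \<forall>g \<in> laurent X.
          (f, g) \<in> Rad (laurent X) (Id_on (laurent X)) \<longleftrightarrow> newt_hat f = newt_hat g) \<and>
      (\<forall>f \<in> polys X. \<forall>g \<in> polys X.
          (f, g) \<in> Rad (polys X) (Id_on (polys X)) \<longleftrightarrow> newt_hat f = newt_hat g))
    \<and>
     ((\<forall>I. radical_congruence (laurent X) I \<and> I \<noteq> laurent X \<times> laurent X \<longrightarrow>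
          QC (laurent X) I) \<and>
      QC (polys X) (Rad (polys X) (Id_on (polys X))))"
proof -
  interpret L: monomial_semiring "lattice_vectors X" "laurent X" by (rule monomial_semiring_laurent)
  interpret N: monomial_semiring "nonneg_lattice X" "polys X" by (rule monomial_semiring_polys)
  have matrix: "\<exists>l U. t_admissible X l U \<and> C = matrix_cone X l U \<and>
      laurent_prime X l U = cone_congruence (laurent X) X C \<and>
      poly_prime X l U = cone_congruence (polys X) X C" if C: "order_cone X C" for C
  proof -
    obtain l U where U: "t_admissible X l U" "C = matrix_cone X l U"
      using order_cone_matrix[OF C] .
    have L: "laurent_prime X l U = cone_congruence (laurent X) X C"
      using U laurent_prime_eq_cone_congruence[of l U X] by (simp add: t_admissible_def)
    have "poly_prime X l U = cone_congruence (polys X) X C"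
      unfolding poly_prime_def L by (rule cone_congruence_Int[OF polys_subset_laurent])
    then show ?thesis using U L by blast
  qed
  have i_laurent: "\<exists>l U. t_admissible X l U \<and> P = laurent_prime X l U"
    if "prime_congruence (laurent X) P" for P
    using laurent_prime_cone[OF that] matrix by metis
  have ii_kernel: "congruence_kernel (polys X) P = {0}"
    if P: "minimal_prime_congruence (polys X) P" for P
  proof -
    obtain C where C: "order_cone X C" "P = cone_congruence (polys X) X C"
      using minimal_prime_cone[OF _ P, of X] by blast
    have "congruence (polys X) P"
      using P by (simp add: minimal_prime_congruence_def prime_congruence_def proper_congruence_def)
    then have "(0, 0) \<in> P" using congruence_refl N.A_closed(1) by blast
    then show ?thesis
      using cone_congruence_zero_iff[OF polys_subset_laurent] N.A_closed(1) C(2)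
      by (auto simp: congruence_kernel_def)
  qed
  have minimal: "\<exists>l U. t_admissible X l U \<and> Ker X l U \<inter> lattice_vectors X = {0} \<and>
      laurent_prime X l U = cone_congruence (laurent X) X C \<and>
      poly_prime X l U = cone_congruence (polys X) X C"
    if C: "order_cone X C" and antisym: "\<forall>y\<in>C. - y \<in> C \<longrightarrow> y = 0" for C
  proof -
    obtain l U where U: "t_admissible X l U" "C = matrix_cone X l U"
      "laurent_prime X l U = cone_congruence (laurent X) X C"
      "poly_prime X l U = cone_congruence (polys X) X C"
      using matrix[OF C] by blast
    then show ?thesis using matrix_cone_Ker[of X l U] antisym by blast
  qed
  have ii_polys: "\<exists>l U. t_admissible X l U \<and> Ker X l U \<inter> lattice_vectors X = {0} \<and> P = poly_prime X l U"
    if P: "minimal_prime_congruence (polys X) P" for P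
  proof -
    obtain C where C: "order_cone X C" "\<forall>y\<in>C. - y \<in> C \<longrightarrow> y = 0" "P = cone_congruence (polys X) X C"
      using minimal_prime_cone[OF _ P, of X] by blast
    then show ?thesis using minimal[OF C(1,2)] by metis
  qed
  have ii_laurent: "\<exists>l U. t_admissible X l U \<and> Ker X l U \<inter> lattice_vectors X = {0} \<and> P = laurent_prime X l U"
    if P: "minimal_prime_congruence (laurent X) P" for P
  proof -
    obtain C where C: "order_cone X C" "\<forall>y\<in>C. - y \<in> C \<longrightarrow> y = 0" "P = cone_congruence (laurent X) X C"
      using minimal_prime_cone[OF _ P, of X] by blast
    then show ?thesis using minimal[OF C(1,2)] by metis
  qed
  have form_laurent: "\<exists>Y C. Y \<subseteq> X \<and> order_cone Y C \<and> P = cone_congruence (laurent X) Y C"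
    if "prime_congruence (laurent X) P" for P
    using laurent_prime_cone[OF that] by blast
  have form_polys: "\<exists>Y C. Y \<subseteq> X \<and> order_cone Y C \<and> P = cone_congruence (polys X) Y C"
    if P: "prime_congruence (polys X) P" for P
  proof -
    obtain C where "order_cone {j \<in> X. (var j, 0) \<notin> P} C"
      "P = cone_congruence (polys X) {j \<in> X. (var j, 0) \<notin> P} C"
      using polys_prime_cone[OF P] by blast
    then show ?thesis
      by (intro exI[of _ "{j \<in> X. (var j, 0) \<notin> P}"] exI[of _ C] conjI) auto
  qed
  have nonneg: "nonneg_lattice X \<subseteq> lattice_vectors X" by (auto simp: nonneg_lattice_def)
  have iii: "congruence_dim (laurent X) = enat (k + 1)" "congruence_dim (polys X) = enat (k + 1)"
    using L.congruence_dim_eq[OF nonneg order_refl form_laurent]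
      N.congruence_dim_eq[OF order_refl polys_subset_laurent form_polys] assms by simp_all
  have iv_laurent: "(f, g) \<in> Rad (laurent X) (Id_on (laurent X)) \<longleftrightarrow> newt_hat f = newt_hat g"
    if "f \<in> laurent X" "g \<in> laurent X" for f g
    using newt_hat_eq_iff_all_cones[OF order_refl that] that by (simp add: Rad_Id_on[of "laurent X" X])
  have iv_polys: "(f, g) \<in> Rad (polys X) (Id_on (polys X)) \<longleftrightarrow> newt_hat f = newt_hat g"
    if "f \<in> polys X" "g \<in> polys X" for f g
    using newt_hat_eq_iff_all_cones[OF polys_subset_laurent that] that by (simp add: Rad_Id_on[of "polys X" X])
  have v_laurent: "QC (laurent X) I"
    if I: "radical_congruence (laurent X) I \<and> I \<noteq> laurent X \<times> laurent X" for I
  proof (rule L.QC_Inter_primes)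
    show "I = laurent X \<times> laurent X \<inter> \<Inter>{P. prime_congruence (laurent X) P \<and> I \<subseteq> P}"
      using I by (simp add: radical_congruence_def Rad_def)
    fix P f assume "P \<in> {P. prime_congruence (laurent X) P \<and> I \<subseteq> P}" "(f, 0) \<in> P"
    then show "f = 0"
      using laurent_prime_cone cone_congruence_zero_iff[OF order_refl] by blast
  qed (use I in auto)
  have v_polys: "QC (polys X) (Rad (polys X) (Id_on (polys X)))"
  proof (rule N.QC_Inter_primes)
    \<comment> \<open>The family consists of the cone congruences in all variables instead of all
      primes, because primes that kill a variable have a nonzero kernel.\<close>
    let ?R = "Rad (polys X) (Id_on (polys X))" and ?P = "{cone_congruence (polys X) X C | C. order_cone X C}"
    show eq: "?R = polys X \<times> polys X \<inter> \<Inter>?P"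
      by (subst Rad_Id_on[of "polys X" X]) auto
    show "?R \<noteq> polys X \<times> polys X"
    proof -
      obtain C where "order_cone X C" using antisymmetric_order_cone_exists by blast
      then have "(1, 0) \<notin> ?R"
        using eq cone_congruence_zero_iff[OF polys_subset_laurent, of 1 X C] by fastforce
      then show ?thesis using N.A_closed(1,2) by blast
    qed
    show "prime_congruence (polys X) P" if "P \<in> ?P" for P
      using that cone_congruence_prime_cases[of "polys X" X] by blast
    show "f = 0" if "P \<in> ?P" "(f, 0) \<in> P" for P f
      using that cone_congruence_zero_iff[OF polys_subset_laurent] by blast
  qed
  show ?thesis
    by (intro conjI allI impI ballI i_laurent polys_prime_generated ii_kernel ii_polys ii_laurent
        iii iv_laurent iv_polys v_laurent v_polys) simp_all
qed

end
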